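(* Let $T>0$ and let $\varepsilon>0$ be a (small enough) fixed parameter such that the set $\mathcal{Q}_{\mathrm{ad}}^\varepsilon$ is non-empty. There exists a constant $C_{\mathrm{obs}}^\varepsilon>0$ such that for every $q\in\mathcal{Q}_{\mathrm{ad}}^\varepsilon$, $$\|(\varphi_0,\varphi_1)\|_{\mathbf V}^2\le C_{\mathrm{obs}}^\varepsilon\,\|\varphi_t\|_{L^2(q)}^2\qquad\text{for all }(\varphi_0,\varphi_1)\in\mathbf V=H^1_0(0,1)\times L^2(0,1),$$ where $\varphi$ is the solution of the homogeneous wave equation $\varphi_{tt}-\varphi_{xx}=0$ in $Q_T$, $\varphi=0$ on $\{0,1\}\times(0,T)$, $(\varphi,\varphi_t)(\cdot,0)=(\varphi_0,\varphi_1)$ in $(0,1)$.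
   Context: $\Omega=(0,1)$ and $Q_T=\Omega\times(0,T)$, with points written $(x,t)$. The norm on $\mathbf V=H^1_0(\Omega)\times L^2(\Omega)$ is $\|(\varphi_0,\varphi_1)\|_{\mathbf V}^2=\|\varphi_0'\|_{L^2(\Omega)}^2+\|\varphi_1\|_{L^2(\Omega)}^2$. For $(\varphi_0,\varphi_1)\in\mathbf V$ the wave equation has a unique solution $\varphi\in C([0,T];H^1_0(\Omega))\cap C^1([0,T];L^2(\Omega))$. Geometric optics condition: a set $q\subset Q_T$ satisfies it if every characteristic line of the wave equation starting from a point of $\overline\Omega\times\{0\}$ and reflected on $\{0,1\}\times(0,T)$ according to the laws of geometric optics meets $q$. Explicitly, letting $\pi(s)\in[0,1]$ be the distance from $s\in\mathbb R$ to the nearest even integer: for every $x_0\in[0,1]$ and each sign $\sigma\in\{+1,-1\}$ there is $t\in[0,T]$ with $(\pi(x_0+\sigma t),t)\in q$. For $q\subset Q_T$ and $\varepsilon>0$, the $\varepsilon$-interior of $q$ is $q^\varepsilon=\{(x,t)\in q:\ d((x,t),\partial q)>\varepsilon\}$ ($d$ Euclidean distance, $\partial q$ the boundary of $q$ in $\mathbb R^2$). Then $$\mathcal Q_{\mathrm{ad}}^\varepsilon=\{q\subset Q_T:\ q\text{ open and } q^\varepsilon\text{ satisfies the geometric optics condition}\}.$$ *)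

theory Defs
  imports "HOL-Analysis.Analysis"
begin

text \<open>Elements of \<open>L\<^sup>2\<close> and of the Sobolev spaces are represented by functions, not by classes
  modulo null sets; norms and membership depend only on the class. Values outside the
  set \<open>S\<close> are irrelevant.\<close>

definition L2 :: "'a::euclidean_space set \<Rightarrow> ('a \<Rightarrow> real) set" where
  "L2 S = {f \<in> borel_measurable (lebesgue_on S). integrable (lebesgue_on S) (\<lambda>x. (f x)\<^sup>2)}"

definition L2_norm :: "'a::euclidean_space set \<Rightarrow> ('a \<Rightarrow> real) \<Rightarrow> real" where
  "L2_norm S f = sqrt (LINT x|lebesgue_on S. (f x)\<^sup>2)"

definition dir_deriv :: "'a::real_normed_vector \<Rightarrow> ('a \<Rightarrow> real) \<Rightarrow> 'a \<Rightarrow> real" where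
  "dir_deriv v f p = frechet_derivative f (at p) v"

text \<open>Infinitely differentiable functions: the rule is read coinductively, so every iterated
  directional derivative of \<open>f\<close> is differentiable everywhere.\<close>

coinductive smooth :: "('a::euclidean_space \<Rightarrow> real) \<Rightarrow> bool" where
  "(\<forall>p. f differentiable (at p)) \<Longrightarrow> (\<forall>v. smooth (dir_deriv v f)) \<Longrightarrow> smooth f"

definition test_functions :: "'a::euclidean_space set \<Rightarrow> ('a \<Rightarrow> real) set" where
  "test_functions S =
     {w. smooth w \<and> compact (closure {p. w p \<noteq> 0}) \<and> closure {p. w p \<noteq> 0} \<subseteq> S}"

abbreviation Omega :: "real set" where
  "Omega \<equiv> {0<..<1}"

definition has_weak_deriv :: "(real \<Rightarrow> real) \<Rightarrow> (real \<Rightarrow> real) \<Rightarrow> bool" where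
  "has_weak_deriv f g \<longleftrightarrow>
     (\<forall>w\<in>test_functions Omega.
        (LINT x|lebesgue_on Omega. f x * deriv w x) = - (LINT x|lebesgue_on Omega. g x * w x))"

definition H1 :: "(real \<Rightarrow> real) set" where
  "H1 = {f \<in> L2 Omega. \<exists>g\<in>L2 Omega. has_weak_deriv f g}"

text \<open>The weak derivative is unique up to a null set; some representative is chosen.\<close>

definition weak_deriv :: "(real \<Rightarrow> real) \<Rightarrow> real \<Rightarrow> real" where
  "weak_deriv f = (SOME g. g \<in> L2 Omega \<and> has_weak_deriv f g)"

definition H1_norm :: "(real \<Rightarrow> real) \<Rightarrow> real" where
  "H1_norm f = sqrt ((L2_norm Omega f)\<^sup>2 + (L2_norm Omega (weak_deriv f))\<^sup>2)"

definition H10 :: "(real \<Rightarrow> real) set" where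
  "H10 = {f \<in> H1. \<exists>w. (\<forall>n. w n \<in> test_functions Omega) \<and>
                      (\<lambda>n. H1_norm (\<lambda>x. w n x - f x)) \<longlonglongrightarrow> 0}"

definition V_space :: "((real \<Rightarrow> real) \<times> (real \<Rightarrow> real)) set" where
  "V_space = H10 \<times> L2 Omega"

definition V_norm :: "(real \<Rightarrow> real) \<times> (real \<Rightarrow> real) \<Rightarrow> real" where
  "V_norm = (\<lambda>(\<phi>0, \<phi>1). sqrt ((L2_norm Omega (weak_deriv \<phi>0))\<^sup>2 + (L2_norm Omega \<phi>1)\<^sup>2))"

definition QT :: "real \<Rightarrow> (real \<times> real) set" where
  "QT T = Omega \<times> {0<..<T}"

text \<open>Curves \<open>u\<close> in \<open>C([0,T];X)\<close>, for a space \<open>X\<close> of functions with norm \<open>N\<close>, are written as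
  functions of \<open>(x,t)\<close>.\<close>

definition continuous_curve ::
  "(real \<Rightarrow> real) set \<Rightarrow> ((real \<Rightarrow> real) \<Rightarrow> real) \<Rightarrow> real \<Rightarrow> (real \<times> real \<Rightarrow> real) \<Rightarrow> bool" where
  "continuous_curve X N T u \<longleftrightarrow>
     (\<forall>s\<in>{0..T}. (\<lambda>x. u (x, s)) \<in> X \<and>
        ((\<lambda>t. N (\<lambda>x. u (x, t) - u (x, s))) \<longlongrightarrow> 0) (at s within {0..T}))"

definition L2_curve_deriv :: "real \<Rightarrow> (real \<times> real \<Rightarrow> real) \<Rightarrow> (real \<times> real \<Rightarrow> real) \<Rightarrow> bool" where
  "L2_curve_deriv T u v \<longleftrightarrow>
     (\<forall>s\<in>{0..T}.
        ((\<lambda>t. L2_norm Omega (\<lambda>x. (u (x, t) - u (x, s)) / (t - s) - v (x, s))) \<longlongrightarrow> 0)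
          (at s within {0..T}))"

text \<open>The function \<open>\<phi>\<close> is the solution with initial data \<open>(\<phi>0, \<phi>1)\<close> and \<open>\<phi>t\<close> is its time
  derivative. Joint measurability is required because a family of representatives of
  \<open>\<phi>(\<sqdot>,t)\<close> chosen separately for each \<open>t\<close> need not be jointly measurable. The equation
  holds in the sense of distributions, and the boundary condition is part of \<open>H10\<close>.\<close>

definition wave_solution ::
  "real \<Rightarrow> (real \<Rightarrow> real) \<times> (real \<Rightarrow> real) \<Rightarrow> (real \<times> real \<Rightarrow> real) \<Rightarrow> (real \<times> real \<Rightarrow> real) \<Rightarrow> bool"
where
  "wave_solution T = (\<lambda>(\<phi>0, \<phi>1) \<phi> \<phi>t.
     \<phi> \<in> borel_measurable (lebesgue_on (QT T)) \<and>
     \<phi>t \<in> borel_measurable (lebesgue_on (QT T)) \<and>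
     continuous_curve H10 H1_norm T \<phi> \<and>
     continuous_curve (L2 Omega) (L2_norm Omega) T \<phi>t \<and>
     L2_curve_deriv T \<phi> \<phi>t \<and>
     (\<forall>\<psi>\<in>test_functions (QT T).
        (LINT p|lebesgue_on (QT T).
           \<phi> p * (dir_deriv (0, 1) (dir_deriv (0, 1) \<psi>) p
                  - dir_deriv (1, 0) (dir_deriv (1, 0) \<psi>) p)) = 0) \<and>
     (AE x in lebesgue_on Omega. \<phi> (x, 0) = \<phi>0 x) \<and>
     (AE x in lebesgue_on Omega. \<phi>t (x, 0) = \<phi>1 x))"

text \<open>The trajectory of a point on the line is folded into \<open>[0,1]\<close>, which realises the
  reflections at \<open>0\<close> and \<open>1\<close>.\<close>

definition fold_unit :: "real \<Rightarrow> real" where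
  "fold_unit s = infdist s (range (\<lambda>k::int. 2 * of_int k))"

definition geometric_optics :: "real \<Rightarrow> (real \<times> real) set \<Rightarrow> bool" where
  "geometric_optics T q \<longleftrightarrow>
     (\<forall>x0\<in>{0..1}. \<forall>\<sigma>\<in>{1, -1}. \<exists>t\<in>{0..T}. (fold_unit (x0 + \<sigma> * t), t) \<in> q)"

text \<open>\<^const>\<open>infdist\<close> to the empty set is \<open>0\<close>; for \<open>q \<subseteq> QT T\<close> the frontier
  is empty only if \<open>q\<close> is empty, so this convention has no effect.\<close>

definition eps_interior :: "real \<Rightarrow> (real \<times> real) set \<Rightarrow> (real \<times> real) set" where
  "eps_interior \<epsilon> q = {p \<in> q. infdist p (frontier q) > \<epsilon>}"

definition Q_ad :: "real \<Rightarrow> real \<Rightarrow> (real \<times> real) set set" where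
  "Q_ad T \<epsilon> = {q. q \<subseteq> QT T \<and> open q \<and> geometric_optics T (eps_interior \<epsilon> q)}"

end

theory Submission
  imports Defs
begin

text \<open>By d'Alembert's formula \<open>\<phi>t (x, t) = f (t + x) - f (t - x)\<close> for a function \<open>f\<close> of period 2 with mean
  zero, and the squared energy norm of the data is twice the integral of \<open>f\<^sup>2\<close> over a period. For weak
  solutions the formula is obtained by comparing sine coefficients in \<open>x\<close>, which solve an oscillator
  equation in \<open>t\<close>.

  By geometric optics, every real \<open>a\<close> is congruent modulo 2 to \<open>t + x\<close> or to \<open>t - x\<close> for some point
  \<open>(x, t)\<close> whose \<open>\<epsilon>\<close>-ball lies in \<open>q\<close>. In the coordinates \<open>t + x\<close> and \<open>t - x\<close> this ball contains a
  square, and the integral of \<open>(f \<xi> - f \<eta>)\<^sup>2\<close> over the square is at most twice the observed quantity.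
  Averaging over one variable bounds the oscillation of \<open>f\<close> on the interval of radius \<open>\<epsilon>\<close> around \<open>a\<close>.
  A chain of \<open>2 / \<epsilon>\<close> overlapping intervals bounds the oscillation over a whole period, which controls
  the integral of \<open>f\<^sup>2\<close> since the mean is zero. The constant depends only on \<open>\<epsilon>\<close>.\<close>

section \<open>Smooth functions and cutoffs\<close>

text \<open>The observation sees \<open>f\<close> only through differences, so constants are
  invisible to it; mean zero is what turns control of the oscillation into control of
  \<open>f\<close>. It encodes the Dirichlet condition: the integral of \<open>f\<close> over a
  period is the integral of the weak derivative of \<open>\<phi>0\<close> over the unit interval.
  Uniformity in \<open>q\<close> comes from using a single ball of radius \<open>\<epsilon>\<close>
  per ray. The second coordinate of the corresponding square may lie anywhere; it is eliminated by
  comparing two values of \<open>f\<close> through a common third one. The main obstacle is low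
  regularity. The equation may be tested only with compactly supported functions, while the sines do
  not have compact support in the open interval and the initial values sit at an endpoint of the
  time interval. Cutoffs in \<open>x\<close> are harmless because the sines vanish at both endpoints
  and one of the two space derivatives can be moved to \<open>\<phi>\<close>; time 0 is reached by
  continuity. Joint integrals in \<open>(x, t)\<close> are treated through Borel
  representatives.\<close>

lemma smooth_differentiable: "smooth f \<Longrightarrow> f differentiable (at p)"
  by (auto elim: smooth.cases)

lemma smooth_dir_deriv: "smooth f \<Longrightarrow> smooth (dir_deriv v f)"
  by (auto elim: smooth.cases)

lemma dir_deriv_eq: "(f has_derivative D) (at p) \<Longrightarrow> dir_deriv v f p = D v"
  unfolding dir_deriv_def using frechet_derivative_at by fastforce

lemma smooth_has_derivative: "smooth f \<Longrightarrow> (f has_derivative (\<lambda>v. dir_deriv v f p)) (at p)"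
  unfolding dir_deriv_def using smooth_differentiable frechet_derivative_works by auto

text \<open>The derivative along \<open>v\<close> of such a composite is the derivative of
  \<open>f\<close> along \<open>L v\<close>, composed with the same affine map. Hence the family of
  all these composites is a coinduction invariant.\<close>

lemma smooth_compose_affine:
  fixes L :: "'a::euclidean_space \<Rightarrow> 'b::euclidean_space"
  assumes L: "bounded_linear L" and f: "smooth f"
  shows "smooth (\<lambda>x. f (L x + c))"
proof -
  define X where "X = (\<lambda>g::'a\<Rightarrow>real. \<exists>f. smooth f \<and> g = (\<lambda>x. f (L x + c)))"
  have "X (\<lambda>x. f (L x + c))" using f unfolding X_def by blast
  then show ?thesis
  proof (coinduct rule: smooth.coinduct[of X])
    case (smooth g)
    then obtain f where f: "smooth f" and g: "g = (\<lambda>x. f (L x + c))" unfolding X_def by blast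
    have D: "(g has_derivative (\<lambda>v. dir_deriv (L v) f (L p + c))) (at p)" for p
      unfolding g
      by (rule has_derivative_compose[OF _ smooth_has_derivative[OF f]])
        (auto intro!: derivative_eq_intros bounded_linear.has_derivative[OF L])
    have "X (dir_deriv v g)" for v
      unfolding X_def using smooth_dir_deriv[OF f, of "L v"] dir_deriv_eq[OF D] by blast
    then show ?case using D unfolding differentiable_def by blast
  qed
qed

text \<open>Products alone are no coinduction invariant, because the product rule produces a sum.
  Closing under both operations gives a class that is stable under directional derivatives.\<close>

inductive smooth_closure :: "('a::euclidean_space \<Rightarrow> real) \<Rightarrow> bool" where
  base: "smooth f \<Longrightarrow> smooth_closure f"
| add: "smooth_closure f \<Longrightarrow> smooth_closure g \<Longrightarrow> smooth_closure (\<lambda>x. f x + g x)"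
| mult: "smooth_closure f \<Longrightarrow> smooth_closure g \<Longrightarrow> smooth_closure (\<lambda>x. f x * g x)"

lemma smooth_closure_deriv:
  assumes "smooth_closure f"
  shows "(\<forall>p. f differentiable (at p)) \<and> (\<forall>v. smooth_closure (dir_deriv v f))"
  using assms
proof induction
  case (base f)
  then show ?case using smooth_differentiable smooth_dir_deriv smooth_closure.base by blast
next
  case (add f g)
  have D: "((\<lambda>x. f x + g x) has_derivative (\<lambda>v. dir_deriv v f p + dir_deriv v g p)) (at p)" for p
    unfolding dir_deriv_def using add.IH
    by (intro has_derivative_add) (auto simp: frechet_derivative_works[symmetric])
  have "dir_deriv v (\<lambda>x. f x + g x) = (\<lambda>x. dir_deriv v f x + dir_deriv v g x)" for v
    using dir_deriv_eq[OF D] by blast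
  then show ?case using D add.IH smooth_closure.add[of "dir_deriv _ f" "dir_deriv _ g"]
    unfolding differentiable_def by metis
next
  case (mult f g)
  have D: "((\<lambda>x. f x * g x) has_derivative (\<lambda>v. f p * dir_deriv v g p + dir_deriv v f p * g p)) (at p)" for p
    unfolding dir_deriv_def using mult.IH
    by (intro has_derivative_mult) (auto simp: frechet_derivative_works[symmetric])
  have "dir_deriv v (\<lambda>x. f x * g x) = (\<lambda>x. f x * dir_deriv v g x + dir_deriv v f x * g x)" for v
    using dir_deriv_eq[OF D] by blast
  moreover have "smooth_closure (\<lambda>x. f x * dir_deriv v g x + dir_deriv v f x * g x)" for v
    using mult by (intro smooth_closure.add smooth_closure.mult) auto
  ultimately show ?case using D unfolding differentiable_def by metis
qed

lemma smooth_closure_smooth: "smooth_closure f \<Longrightarrow> smooth f"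
  by (coinduct f rule: smooth.coinduct[of smooth_closure]) (use smooth_closure_deriv in blast)+

lemma smooth_mult: "smooth f \<Longrightarrow> smooth g \<Longrightarrow> smooth (\<lambda>x. f x * g x)"
  by (auto intro!: smooth_closure_smooth intro: smooth_closure.intros)

section \<open>Smooth functions of one real variable\<close>

lemma dir_deriv_real:
  fixes f :: "real \<Rightarrow> real"
  assumes "(f has_real_derivative d) (at x)"
  shows "dir_deriv v f x = v * d"
  using dir_deriv_eq[OF assms[unfolded has_field_derivative_def], of v] by (simp add: mult.commute)

lemma smooth_has_real_derivative:
  fixes f :: "real \<Rightarrow> real"
  assumes "smooth f"
  shows "(f has_real_derivative deriv f x) (at x)"
  using smooth_differentiable[OF assms]
  by (simp add: DERIV_deriv_iff_real_differentiable)

lemma smooth_deriv: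
  fixes f :: "real \<Rightarrow> real"
  assumes "smooth f"
  shows "smooth (deriv f)"
proof -
  have "deriv f = dir_deriv 1 f"
    using dir_deriv_real[OF smooth_has_real_derivative[OF assms], where v=1] by auto
  then show ?thesis using smooth_dir_deriv[OF assms] by metis
qed

lemma smooth_continuous_on: "smooth f \<Longrightarrow> continuous_on S f"
  by (meson continuous_at_imp_continuous_on differentiable_imp_continuous_within smooth_differentiable)

text \<open>On the line a derivative along \<open>v\<close> is \<open>v\<close> times the ordinary
  one, so the coinduction invariant consists of all scalar multiples of members of
  \<open>S\<close>.\<close>

lemma smooth_family:
  fixes S :: "(real \<Rightarrow> real) set"
  assumes S: "\<And>f. f \<in> S \<Longrightarrow> \<exists>g\<in>S. \<forall>x. (f has_real_derivative g x) (at x)" and f: "f \<in> S"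
  shows "smooth f"
proof -
  define X where "X = (\<lambda>F::real\<Rightarrow>real. \<exists>c. \<exists>f\<in>S. F = (\<lambda>x. c * f x))"
  have "X f" unfolding X_def using f by (intro exI[of _ 1]) auto
  then show ?thesis
  proof (coinduct rule: smooth.coinduct[of X])
    case (smooth F)
    then obtain c f where f: "f \<in> S" and F: "F = (\<lambda>x. c * f x)" unfolding X_def by blast
    obtain g where g: "g \<in> S" "\<And>x. (f has_real_derivative g x) (at x)" using S f by blast
    have D: "(F has_real_derivative c * g x) (at x)" for x
      unfolding F by (auto intro!: derivative_eq_intros g)
    have "dir_deriv v F = (\<lambda>x. (v * c) * g x)" for v
      using dir_deriv_real[OF D] by auto
    then have "X (dir_deriv v F)" for v unfolding X_def using g by blast
    then show ?case using D unfolding has_field_derivative_def differentiable_def by blast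
  qed
qed

text \<open>Differentiation multiplies the amplitude by \<open>k\<close> and shifts the phase by
  \<open>pi/2\<close>; sines of fixed frequency with free amplitude and phase are therefore a family
  closed under derivatives.\<close>

lemma smooth_sin: "smooth (\<lambda>x::real. sin (k * x + d))"
proof (rule smooth_family[of "{\<lambda>x. c * sin (k * x + d) |c d. True}"])
  fix f assume "f \<in> {\<lambda>x. c * sin (k * x + d) |c d. True}"
  then obtain c d where f: "f = (\<lambda>x. c * sin (k * x + d))" by blast
  have "(f has_real_derivative (c * k) * sin (k * x + (d + pi/2))) (at x)" for x
    unfolding f by (auto intro!: derivative_eq_intros simp: sin_add cos_add algebra_simps)
  then show "\<exists>g\<in>{\<lambda>x. c * sin (k * x + d) |c d. True}. \<forall>x. (f has_real_derivative g x) (at x)"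
    by (intro bexI[of _ "\<lambda>x. (c * k) * sin (k * x + (d + pi/2))"]) auto
qed (use mult_1[symmetric] in \<open>blast\<close>)

lemma smooth_cos: "smooth (\<lambda>x::real. cos (k * x + d))"
proof -
  have "(\<lambda>x::real. cos (k * x + d)) = (\<lambda>x. sin (k * x + (d + pi/2)))"
    by (simp add: sin_add cos_add algebra_simps)
  then show ?thesis using smooth_sin by metis
qed

text \<open>The derivatives of \<open>exp (-1/x)\<close> all have this form.\<close>

definition flat_fun :: "real poly \<Rightarrow> real \<Rightarrow> real" where
  "flat_fun P x = (if x > 0 then poly P (1/x) * exp (-1/x) else 0)"

lemma poly_exp_tendsto_0: "((\<lambda>y::real. poly P y * exp (-y)) \<longlongrightarrow> 0) at_top"
proof -
  have "((\<lambda>y. \<Sum>i\<le>degree P. coeff P i * (y^i / exp y)) \<longlongrightarrow> (\<Sum>i\<le>degree P. coeff P i * 0)) at_top"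
    by (intro tendsto_sum tendsto_mult tendsto_const tendsto_power_div_exp_0)
  then show ?thesis
    by (simp add: poly_altdef sum_distrib_right exp_minus divide_inverse mult.assoc)
qed

lemma flat_fun_tendsto_0: "((\<lambda>x. poly P (1/x) * exp (-1/x)) \<longlongrightarrow> 0) (at_right (0::real))"
proof -
  have "filterlim (\<lambda>x::real. inverse x) at_top (at_right 0)"
    by (rule filterlim_inverse_at_top_right)
  from filterlim_compose[OF poly_exp_tendsto_0 this] show ?thesis
    by (simp add: inverse_eq_divide)
qed

text \<open>With \<open>y = 1/x\<close> the derivative in \<open>x\<close> is \<open>-y^2\<close>
  times the derivative in \<open>y\<close>, and that of \<open>P(y) exp(-y)\<close> is
  \<open>(P' - P)(y) exp(-y)\<close>. The factor \<open>[:0,0,1:]\<close> is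
  \<open>y^2\<close>.\<close>

lemma flat_fun_deriv:
  "(flat_fun P has_real_derivative flat_fun ([:0,0,1:] * (P - pderiv P)) x) (at x)"
proof -
  consider "x > 0" | "x < 0" | "x = 0" by linarith
  then show ?thesis
  proof cases
    case 1
    have "((\<lambda>x. poly P (1/x) * exp (-1/x)) has_real_derivative
        flat_fun ([:0,0,1:] * (P - pderiv P)) x) (at x)"
      using 1 by (auto intro!: derivative_eq_intros DERIV_chain'[OF _ poly_DERIV]
          simp: flat_fun_def power2_eq_square field_simps)
    moreover have ev: "\<forall>\<^sub>F y in nhds x. flat_fun P y = poly P (1/y) * exp (-1/y)"
      using eventually_nhds_in_open[of "{0<..}" x] 1
      by (auto elim!: eventually_mono simp: flat_fun_def)
    ultimately show ?thesis using DERIV_cong_ev[OF refl ev refl] by simp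
  next
    case 2
    have "\<forall>\<^sub>F y in nhds x. flat_fun P y = 0"
      using eventually_nhds_in_open[of "{..<0}" x] 2
      by (auto elim!: eventually_mono simp: flat_fun_def)
    moreover have "((\<lambda>x::real. 0::real) has_real_derivative 0) (at x)" by simp
    ultimately show ?thesis using 2 DERIV_cong_ev[of x x "flat_fun P" "\<lambda>x. 0" 0 0]
      by (simp add: flat_fun_def)
  next
    case 3
    \<comment> \<open>At 0 the difference quotient from the right is again of this shape: dividing
      by \<open>y\<close> amounts to replacing \<open>P\<close> by \<open>[:0,1:] * P\<close>, and
      flatness applies.\<close>
    have R: "((\<lambda>y. (flat_fun P y - flat_fun P 0) / (y - 0)) \<longlongrightarrow> 0) (at_right 0)"
    proof (rule Lim_transform_eventually[OF flat_fun_tendsto_0[of "[:0,1:] * P"]])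
      show "\<forall>\<^sub>F y in at_right 0. poly ([:0, 1:] * P) (1 / y) * exp (- 1 / y) = (flat_fun P y - flat_fun P 0) / (y - 0)"
        by (auto simp: eventually_at_right_less flat_fun_def intro: eventually_mono[OF eventually_at_right_less])
    qed
    have L: "((\<lambda>y. (flat_fun P y - flat_fun P 0) / (y - 0)) \<longlongrightarrow> 0) (at_left 0)"
      by (rule Lim_transform_eventually[OF tendsto_const])
        (auto simp: flat_fun_def eventually_at_filter)
    have "((\<lambda>y. (flat_fun P y - flat_fun P 0) / (y - 0)) \<longlongrightarrow> 0) (at 0)"
      using L R by (simp add: filterlim_split_at)
    then show ?thesis using 3 by (simp add: has_field_derivative_iff flat_fun_def)
  qed
qed

lemma smooth_flat_fun: "smooth (flat_fun P)"
  by (rule smooth_family[of "range flat_fun"]) (use flat_fun_deriv in blast)+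

text \<open>Despite the name this is a smooth step: it is 0 for \<open>x \<le> 0\<close> and
  increases to 1 at infinity. Its derivative \<open>bump'\<close> is therefore a smooth probability
  density on the positive half line; both properties are used.\<close>

definition bump :: "real \<Rightarrow> real" where "bump = flat_fun 1"

definition bump' :: "real \<Rightarrow> real" where "bump' = flat_fun [:0,0,1:]"

lemma bump_alt: "bump x = (if x > 0 then exp (-1/x) else 0)"
  by (simp add: bump_def flat_fun_def)

lemma bump'_alt: "bump' x = (if x > 0 then exp (-1/x) / x\<^sup>2 else 0)"
  by (simp add: bump'_def flat_fun_def power2_eq_square field_simps)

lemma bump_deriv: "(bump has_real_derivative bump' x) (at x)"
  using flat_fun_deriv[of 1 x] by (simp add: bump_def bump'_def)

lemma smooth_bump: "smooth bump"
  by (simp add: bump_def smooth_flat_fun)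

lemma bump_range: "0 \<le> bump x" "bump x \<le> 1"
  by (auto simp: bump_alt)

lemma bump'_nonneg: "0 \<le> bump' x"
  by (auto simp: bump'_alt)

text \<open>For \<open>x > 0\<close>, with \<open>u = 1/x\<close>, \<open>bump' x\<close> is
  \<open>u^2 exp(-u)\<close> and \<open>x * bump' x\<close> is \<open>u exp(-u)\<close>. The factor
  \<open>x + 1\<close> prepares for arguments \<open>m * y - 1\<close>, where it becomes
  \<open>m * y\<close>.\<close>

lemma bump'_bound: "bump' x \<le> 2"  "(x + 1) * bump' x \<le> 3"
proof -
  have e: "1 + u + u\<^sup>2/2 \<le> exp u" if "u \<ge> 0" for u :: real
    using exp_lower_Taylor_quadratic[OF that] .
  have k: "u\<^sup>2 * exp (-u) \<le> 2" "u * exp (-u) \<le> 1" if "u \<ge> 0" for u :: real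
    using e[OF that] that by (auto simp: exp_minus field_simps)
      (use zero_le_power2[of u] that in \<open>linarith+\<close>)?
  show "bump' x \<le> 2"
    using k(1)[of "1/x"] by (auto simp: bump'_alt power2_eq_square field_simps)
  have "(x + 1) * bump' x = 1/x * exp (-(1/x)) + (1/x)\<^sup>2 * exp (-(1/x))" if "x > 0"
    using that by (simp add: bump'_alt power2_eq_square field_simps)
  then show "(x + 1) * bump' x \<le> 3"
    using k(1)[of "1/x"] k(2)[of "1/x"]
    by (cases "x > 0") (auto simp: bump'_alt simp del: times_divide_eq_left)
qed

lemma bump_tendsto_1: "(bump \<longlongrightarrow> 1) at_top"
proof -
  have "((\<lambda>x. exp (- inverse x)) \<longlongrightarrow> exp (-0)) (at_top::real filter)"
    by (intro tendsto_intros tendsto_inverse_0_at_top filterlim_ident)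
  then have "((\<lambda>x. exp (- inverse x)) \<longlongrightarrow> 1) (at_top::real filter)" by simp
  then show ?thesis
    by (rule Lim_transform_eventually)
      (use eventually_gt_at_top[of 0] in \<open>auto elim!: eventually_mono simp: bump_alt inverse_eq_divide\<close>)
qed

text \<open>The quadratic decay of \<open>bump'\<close> beats the factor \<open>n\<close>: once
  \<open>n * x > 2\<close>, the argument is at least \<open>n * x / 2\<close>, which gives the bound
  \<open>4 / (n * x^2)\<close>.\<close>

lemma mult_bump'_tendsto_0:
  assumes "x > 0"
  shows "(\<lambda>n. real n * bump' (real n * x - 1)) \<longlonglongrightarrow> 0"
proof (rule Lim_null_comparison)
  have "(\<lambda>n. 4 / (real n * x\<^sup>2)) \<longlonglongrightarrow> 0"
  proof -
    have "(\<lambda>n. 4 / x\<^sup>2 * inverse (real n)) \<longlonglongrightarrow> 4 / x\<^sup>2 * 0"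
      by (intro tendsto_intros lim_inverse_n)
    then show ?thesis by (simp add: field_simps)
  qed
  then show "(\<lambda>n. 4 / (real n * x\<^sup>2)) \<longlonglongrightarrow> 0" .
  obtain N where N: "real N > 2 / x" using reals_Archimedean2 by blast
  show "\<forall>\<^sub>F n in sequentially. norm (real n * bump' (real n * x - 1)) \<le> 4 / (real n * x\<^sup>2)"
    using eventually_ge_at_top[of "max N 1"]
  proof eventually_elim
    case (elim n)
    have "real n > 2/x" using N elim by auto
    then have nx: "real n * x > 2" using assms by (simp add: field_simps)
    have n: "real n > 0" using elim by simp
    have "(real n * x / 2)\<^sup>2 \<le> (real n * x - 1)\<^sup>2" using nx by (intro power_mono) linarith+
    then have "1 / (real n * x - 1)\<^sup>2 \<le> 1 / (real n * x / 2)\<^sup>2"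
      using nx n assms by (intro divide_left_mono mult_pos_pos) auto
    moreover have "exp (-1 / (real n * x - 1)) \<le> 1" using nx by simp
    ultimately have "bump' (real n * x - 1) \<le> 1 * (1 / (real n * x / 2)\<^sup>2)"
      unfolding bump'_alt using nx
      by (smt (verit) divide_nonneg_nonneg divide_right_mono zero_le_power2)
    then have "real n * bump' (real n * x - 1) \<le> real n * (1 * (1 / (real n * x / 2)\<^sup>2))"
      using n by (intro mult_left_mono) auto
    also have "\<dots> = 4 / (real n * x\<^sup>2)" using n by (simp add: power2_eq_square field_simps)
    finally show ?case using bump'_nonneg n by (simp add: abs_mult)
  qed
qed

text \<open>The shift by 1 makes the function vanish within distance \<open>1/m\<close> of either
  endpoint (for \<open>m > 0\<close>), so its support is compact in the open interval; for fixed
  \<open>x\<close> both arguments still tend to infinity.\<close>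

definition cutoff :: "nat \<Rightarrow> real \<Rightarrow> real" where
  "cutoff m x = bump (real m * x - 1) * bump (real m * (1 - x) - 1)"

definition cutoff' :: "nat \<Rightarrow> real \<Rightarrow> real" where
  "cutoff' m x = real m * bump' (real m * x - 1) * bump (real m * (1 - x) - 1)
     - bump (real m * x - 1) * (real m * bump' (real m * (1 - x) - 1))"

lemma cutoff_deriv: "(cutoff m has_real_derivative cutoff' m x) (at x)"
  unfolding cutoff_def[abs_def] cutoff'_def
  by (auto intro!: derivative_eq_intros DERIV_chain'[OF _ bump_deriv] simp: algebra_simps)

lemma smooth_bump_affine: "smooth (\<lambda>x. bump (a * x + b))"
  by (rule smooth_compose_affine[OF bounded_linear_mult_right smooth_bump])

lemma smooth_cutoff: "smooth (cutoff m)"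
  unfolding cutoff_def[abs_def]
  using smooth_mult[OF smooth_bump_affine[of m "-1"] smooth_bump_affine[of "- real m" "real m -1"]]
  by (simp add: algebra_simps)

lemma cutoff_range: "0 \<le> cutoff m x" "cutoff m x \<le> 1"
  using bump_range by (auto simp: cutoff_def intro: mult_le_one)

lemma cutoff_tendsto_1:
  assumes "x \<in> {0<..<1}"
  shows "(\<lambda>m. cutoff m x) \<longlonglongrightarrow> 1"
proof -
  have "(\<lambda>m. bump (real m * y - 1)) \<longlonglongrightarrow> 1" if "y > 0" for y
  proof -
    have "filterlim (\<lambda>m. y * real m) at_top sequentially"
      by (rule filterlim_tendsto_pos_mult_at_top[OF tendsto_const that filterlim_real_sequentially])
    then have "filterlim (\<lambda>m. -1 + real m * y) at_top sequentially"
      by (intro filterlim_tendsto_add_at_top[OF tendsto_const]) (simp add: mult.commute)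
    then show ?thesis using filterlim_compose[OF bump_tendsto_1] by fastforce
  qed
  from tendsto_mult[OF this this, of x "1 - x"] show ?thesis
    using assms by (simp add: cutoff_def)
qed

lemma cutoff'_tendsto_0:
  assumes "x \<in> {0<..<1}"
  shows "(\<lambda>m. cutoff' m x) \<longlonglongrightarrow> 0"
proof (rule Lim_null_comparison)
  show "(\<lambda>m. real m * bump' (real m * x - 1) + real m * bump' (real m * (1 - x) - 1)) \<longlonglongrightarrow> 0"
    using tendsto_add[OF mult_bump'_tendsto_0[of x] mult_bump'_tendsto_0[of "1 - x"]] assms by simp
  show "\<forall>\<^sub>F m in sequentially. norm (cutoff' m x)
          \<le> real m * bump' (real m * x - 1) + real m * bump' (real m * (1 - x) - 1)"
  proof (intro always_eventually allI)
    fix m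
    have "norm (cutoff' m x) \<le> norm (real m * bump' (real m * x - 1) * bump (real m * (1 - x) - 1))
      + norm (bump (real m * x - 1) * (real m * bump' (real m * (1 - x) - 1)))"
      unfolding cutoff'_def by (rule norm_triangle_ineq4)
    also have "\<dots> \<le> real m * bump' (real m * x - 1) + real m * bump' (real m * (1 - x) - 1)"
      using bump_range bump'_nonneg
      by (intro add_mono) (auto simp: abs_mult intro!: mult_left_le mult_left_le_one_le)
    finally show "norm (cutoff' m x)
          \<le> real m * bump' (real m * x - 1) + real m * bump' (real m * (1 - x) - 1)" .
  qed
qed

text \<open>\<open>cutoff' m\<close> is of order \<open>m\<close> near the endpoints; a factor that vanishes there compensates it.\<close>

lemma cutoff'_bound:
  assumes "\<bar>s\<bar> \<le> c * x" "\<bar>s\<bar> \<le> c * (1 - x)" "c \<ge> 0"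
  shows "\<bar>cutoff' m x * s\<bar> \<le> 6 * c"
proof -
  have b: "\<bar>real m * bump' (real m * y - 1) * s\<bar> \<le> 3 * c" if "\<bar>s\<bar> \<le> c * y" for y
  proof -
    have "\<bar>real m * bump' (real m * y - 1) * s\<bar> = real m * bump' (real m * y - 1) * \<bar>s\<bar>"
      using bump'_nonneg by (simp add: abs_mult)
    also have "\<dots> \<le> real m * bump' (real m * y - 1) * (c * y)"
      using bump'_nonneg that by (intro mult_left_mono) auto
    also have "\<dots> = c * ((real m * y - 1 + 1) * bump' (real m * y - 1))" by (simp add: algebra_simps)
    also have "\<dots> \<le> c * 3" using assms(3) bump'_bound(2) by (intro mult_left_mono)
    finally show ?thesis by simp
  qed
  have "\<bar>cutoff' m x * s\<bar> \<le> \<bar>(real m * bump' (real m * x - 1) * s) * bump (real m * (1 - x) - 1)\<bar>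
      + \<bar>bump (real m * x - 1) * (real m * bump' (real m * (1 - x) - 1) * s)\<bar>"
    unfolding cutoff'_def by (simp add: algebra_simps)
  also have "\<dots> \<le> \<bar>real m * bump' (real m * x - 1) * s\<bar> + \<bar>real m * bump' (real m * (1 - x) - 1) * s\<bar>"
    using bump_range by (intro add_mono) (auto simp: abs_mult[of _ "bump _"] abs_mult[of "bump _"] intro!: mult_left_le mult_left_le_one_le)
  also have "\<dots> \<le> 3 * c + 3 * c" using b[of x] b[of "1-x"] assms by (intro add_mono) auto
  finally show ?thesis by simp
qed

section \<open>Test functions\<close>

lemma test_functionI:
  assumes "smooth w" "compact K" "K \<subseteq> S" "\<And>p. p \<notin> K \<Longrightarrow> w p = 0"
  shows "w \<in> test_functions S"
proof -
  have "closure {p. w p \<noteq> 0} \<subseteq> K"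
    using assms by (intro closure_minimal) (auto simp: compact_imp_closed)
  then show ?thesis
    unfolding test_functions_def using assms
    by (auto simp: compact_eq_bounded_closed intro: bounded_subset)
qed

lemma test_functionD:
  assumes "w \<in> test_functions S"
  shows "smooth w" "compact (closure {p. w p \<noteq> 0})" "closure {p. w p \<noteq> 0} \<subseteq> S"
    "p \<notin> closure {p. w p \<noteq> 0} \<Longrightarrow> w p = 0" "p \<notin> S \<Longrightarrow> w p = 0"
  using assms closure_subset[of "{p. w p \<noteq> 0}"] unfolding test_functions_def by auto

lemma test_function_mult:
  assumes "w \<in> test_functions S" "smooth g"
  shows "(\<lambda>x. w x * g x) \<in> test_functions S"
proof (rule test_functionI)
  note w = test_functionD[OF assms(1)]
  show "smooth (\<lambda>x. w x * g x)" by (rule smooth_mult[OF w(1) assms(2)])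
  show "compact (closure {p. w p \<noteq> 0})" "closure {p. w p \<noteq> 0} \<subseteq> S" by (fact w)+
  show "w p * g p = 0" if "p \<notin> closure {p. w p \<noteq> 0}" for p using w(4)[OF that] by simp
qed

lemma test_function_deriv:
  fixes w :: "real \<Rightarrow> real"
  assumes "w \<in> test_functions S"
  shows "deriv w \<in> test_functions S"
proof (rule test_functionI[of _ "closure {p. w p \<noteq> 0}"])
  note w = test_functionD[OF assms]
  show "smooth (deriv w)" using w smooth_deriv by blast
  show "compact (closure {p. w p \<noteq> 0})" "closure {p. w p \<noteq> 0} \<subseteq> S" using w by blast+
  fix p assume p: "p \<notin> closure {p. w p \<noteq> 0}"
  have "\<forall>\<^sub>F y in nhds p. w y = 0"
  proof (rule eventually_mono)
    show "\<forall>\<^sub>F y in nhds p. y \<in> - closure {p. w p \<noteq> 0}"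
      by (rule eventually_nhds_in_open) (use p in auto)
    show "w y = 0" if "y \<in> - closure {p. w p \<noteq> 0}" for y using w(4) that by blast
  qed
  then have "deriv w p = deriv (\<lambda>x. 0) p" by (rule deriv_cong_ev) simp
  then show "deriv w p = 0" by simp
qed

lemma cutoff_test_function: "cutoff m \<in> test_functions {0<..<1}"
proof (cases "m = 0")
  case True
  then show ?thesis using smooth_cutoff
    by (intro test_functionI[of _ "{}"]) (auto simp: cutoff_def bump_alt)
next
  case False
  have "x > 1 / real m" "x < 1 - 1 / real m" if "cutoff m x \<noteq> 0" for x
  proof -
    have "real m * x - 1 > 0" "real m * (1 - x) - 1 > 0"
      using that by (auto simp: cutoff_def bump_alt split: if_splits)
    then have "x > 1 / real m" "1 - x > 1 / real m" using False by (simp_all add: field_simps)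
    then show "x > 1 / real m" "x < 1 - 1 / real m" by linarith+
  qed
  then have "cutoff m x = 0" if "x \<notin> {1/real m..1 - 1 / real m}" for x
    using that by fastforce
  moreover have "{1/real m..1 - 1 / real m} \<subseteq> {0<..<1}"
  proof
    fix x assume "x \<in> {1/real m..1 - 1 / real m}"
    moreover have "1 / real m > 0" using False by simp
    ultimately show "x \<in> {0<..<1}"
      unfolding greaterThanLessThan_iff atLeastAtMost_iff by linarith
  qed
  ultimately show ?thesis using smooth_cutoff by (intro test_functionI) auto
qed

text \<open>As \<open>n\<close> grows this approximates the indicator of the interval from
  \<open>a\<close> to \<open>b\<close>, and its derivative approximates a unit mass at
  \<open>a\<close> minus a unit mass at \<open>b\<close>. Testing with it compares the values of a
  function at the two points.\<close>

definition hat :: "real \<Rightarrow> real \<Rightarrow> nat \<Rightarrow> real \<Rightarrow> real" where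
  "hat a b n t = bump (real n * (t - a)) * bump (real n * (b - t))"

lemma hat_deriv: "(hat a b n has_real_derivative
    real n * bump' (real n * (t - a)) * bump (real n * (b - t))
    - real n * bump' (real n * (b - t)) * bump (real n * (t - a))) (at t)"
  unfolding hat_def[abs_def]
  by (auto intro!: derivative_eq_intros DERIV_chain'[OF _ bump_deriv] simp: algebra_simps)

lemma hat_test_function:
  assumes "0 < a" "b < T"
  shows "hat a b n \<in> test_functions {0<..<T}"
proof (rule test_functionI[of _ "{a..b}"])
  show "smooth (hat a b n)" unfolding hat_def[abs_def]
    using smooth_mult[OF smooth_bump_affine[of n "- (n * a)"] smooth_bump_affine[of "- real n" "n * b"]]
    by (simp add: algebra_simps)
qed (use assms in \<open>auto simp: hat_def bump_alt zero_less_mult_iff\<close>)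

lemma tensor_test_function:
  fixes w \<theta> :: "real \<Rightarrow> real"
  assumes w: "w \<in> test_functions S" and \<theta>: "\<theta> \<in> test_functions R"
  shows "(\<lambda>p. w (fst p) * \<theta> (snd p)) \<in> test_functions (S \<times> R)"
    and "dir_deriv (0, 1) (dir_deriv (0, 1) (\<lambda>p. w (fst p) * \<theta> (snd p))) p = w (fst p) * deriv (deriv \<theta>) (snd p)"
    and "dir_deriv (1, 0) (dir_deriv (1, 0) (\<lambda>p. w (fst p) * \<theta> (snd p))) p = deriv (deriv w) (fst p) * \<theta> (snd p)"
proof -
  note W = test_functionD[OF w] and TH = test_functionD[OF \<theta>]
  show "(\<lambda>p. w (fst p) * \<theta> (snd p)) \<in> test_functions (S \<times> R)"
  proof (rule test_functionI)
    show "smooth (\<lambda>p. w (fst p) * \<theta> (snd p))"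
      using smooth_mult[OF smooth_compose_affine[OF bounded_linear_fst W(1), of 0]
          smooth_compose_affine[OF bounded_linear_snd TH(1), of 0]] by simp
    show "compact (closure {p. w p \<noteq> 0} \<times> closure {p. \<theta> p \<noteq> 0})"
      by (rule compact_Times[OF W(2) TH(2)])
    show "closure {p. w p \<noteq> 0} \<times> closure {p. \<theta> p \<noteq> 0} \<subseteq> S \<times> R"
      by (rule Sigma_mono[OF W(3) TH(3)])
    show "w (fst p) * \<theta> (snd p) = 0" if "p \<notin> closure {p. w p \<noteq> 0} \<times> closure {p. \<theta> p \<noteq> 0}" for p
      using that W(4)[of "fst p"] TH(4)[of "snd p"] by (auto simp: mem_Times_iff)
  qed
  have D: "((\<lambda>p. w (fst p) * \<theta> (snd p)) has_derivative
      (\<lambda>v. w (fst p) * (snd v * deriv \<theta> (snd p)) + fst v * deriv w (fst p) * \<theta> (snd p))) (at p)"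
    if "smooth w" "smooth \<theta>" for w \<theta> :: "real \<Rightarrow> real" and p
  proof -
    have 1: "((\<lambda>p. w (fst p)) has_derivative (\<lambda>v. fst v * deriv w (fst p))) (at p)"
      by (rule has_derivative_compose[OF bounded_linear.has_derivative[OF bounded_linear_fst has_derivative_ident]])
        (use smooth_has_real_derivative[OF that(1)] in \<open>simp add: has_field_derivative_def mult_commute_abs\<close>)
    have 2: "((\<lambda>p. \<theta> (snd p)) has_derivative (\<lambda>v. snd v * deriv \<theta> (snd p))) (at p)"
      by (rule has_derivative_compose[OF bounded_linear.has_derivative[OF bounded_linear_snd has_derivative_ident]])
        (use smooth_has_real_derivative[OF that(2)] in \<open>simp add: has_field_derivative_def mult_commute_abs\<close>)
    show ?thesis using has_derivative_mult[OF 1 2] .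
  qed
  have t: "dir_deriv (0, 1) (\<lambda>p. w (fst p) * \<theta> (snd p)) = (\<lambda>p. w (fst p) * deriv \<theta> (snd p))"
    and x: "dir_deriv (1, 0) (\<lambda>p. w (fst p) * \<theta> (snd p)) = (\<lambda>p. deriv w (fst p) * \<theta> (snd p))"
    if "smooth w" "smooth \<theta>" for w \<theta> :: "real \<Rightarrow> real"
    using dir_deriv_eq[OF D[OF that]] by auto
  show "dir_deriv (0, 1) (dir_deriv (0, 1) (\<lambda>p. w (fst p) * \<theta> (snd p))) p = w (fst p) * deriv (deriv \<theta>) (snd p)"
    "dir_deriv (1, 0) (dir_deriv (1, 0) (\<lambda>p. w (fst p) * \<theta> (snd p))) p = deriv (deriv w) (fst p) * \<theta> (snd p)"
    using W(1) TH(1) smooth_deriv[OF W(1)] smooth_deriv[OF TH(1)] by (simp_all add: t x)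
qed

section \<open>Square integrable functions and sine series\<close>

lemma L2_measurable: "f \<in> L2 S \<Longrightarrow> f \<in> borel_measurable (lebesgue_on S)"
  and L2_square: "f \<in> L2 S \<Longrightarrow> integrable (lebesgue_on S) (\<lambda>x. (f x)\<^sup>2)"
  by (auto simp: L2_def)

lemma L2_mult_integrable:
  assumes "f \<in> L2 S" "g \<in> L2 S"
  shows "integrable (lebesgue_on S) (\<lambda>x. f x * g x)"
proof (rule Bochner_Integration.integrable_bound)
  show "integrable (lebesgue_on S) (\<lambda>x. (f x)\<^sup>2 + (g x)\<^sup>2)"
    using assms by (auto dest: L2_square)
  show "(\<lambda>x. f x * g x) \<in> borel_measurable (lebesgue_on S)"
    by (intro borel_measurable_times L2_measurable assms)
  have "norm (a * b) \<le> norm (a\<^sup>2 + b\<^sup>2)" for a b :: real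
  proof -
    have "0 \<le> (\<bar>a\<bar> - \<bar>b\<bar>)\<^sup>2" "0 \<le> a\<^sup>2" "0 \<le> b\<^sup>2" by simp_all
    then have "2 * (\<bar>a\<bar> * \<bar>b\<bar>) \<le> a\<^sup>2 + b\<^sup>2" by (simp add: power2_diff)
    moreover have "0 \<le> \<bar>a\<bar> * \<bar>b\<bar>" by simp
    ultimately have "\<bar>a\<bar> * \<bar>b\<bar> \<le> a\<^sup>2 + b\<^sup>2" by linarith
    then show ?thesis by (simp add: abs_mult)
  qed
  then show "AE x in lebesgue_on S. norm (f x * g x) \<le> norm ((f x)\<^sup>2 + (g x)\<^sup>2)" by blast
qed

lemma L2_add: 
  assumes "f \<in> L2 S" "g \<in> L2 S"
  shows "(\<lambda>x. f x + g x) \<in> L2 S"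
proof -
  have "integrable (lebesgue_on S) (\<lambda>x. (f x)\<^sup>2 + (g x)\<^sup>2 + 2 * (f x * g x))"
    by (intro Bochner_Integration.integrable_add integrable_mult_right L2_mult_integrable L2_square assms)
  moreover have "(\<lambda>x. f x + g x) \<in> borel_measurable (lebesgue_on S)"
    by (intro borel_measurable_add L2_measurable assms)
  ultimately show ?thesis
    by (simp add: L2_def power2_sum mult.assoc)
qed

lemma L2_cmult: 
  assumes "f \<in> L2 S"
  shows "(\<lambda>x. c * f x) \<in> L2 S"
  using assms by (auto simp: L2_def power_mult_distrib)

lemma L2_diff: 
  assumes "f \<in> L2 S" "g \<in> L2 S"
  shows "(\<lambda>x. f x - g x) \<in> L2 S"
  using L2_add[OF assms(1) L2_cmult[OF assms(2), of "-1"]] by simp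

lemma L2_bounded_mult:
  assumes f: "f \<in> L2 S" and g: "g \<in> borel_measurable (lebesgue_on S)" and b: "\<And>x. x \<in> S \<Longrightarrow> \<bar>g x\<bar> \<le> C"
  shows "(\<lambda>x. f x * g x) \<in> L2 S"
proof -
  have "integrable (lebesgue_on S) (\<lambda>x. (f x * g x)\<^sup>2)"
  proof (rule Bochner_Integration.integrable_bound)
    show "integrable (lebesgue_on S) (\<lambda>x. C\<^sup>2 * (f x)\<^sup>2)"
      using f by (auto dest: L2_square)
    show "(\<lambda>x. (f x * g x)\<^sup>2) \<in> borel_measurable (lebesgue_on S)"
      using f g by (auto dest: L2_measurable)
    show "AE x in lebesgue_on S. norm ((f x * g x)\<^sup>2) \<le> norm (C\<^sup>2 * (f x)\<^sup>2)"
    proof (rule AE_I2)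
      fix x assume "x \<in> space (lebesgue_on S)"
      then have "\<bar>g x\<bar>\<^sup>2 \<le> C\<^sup>2" using b by (intro power_mono) auto
      then show "norm ((f x * g x)\<^sup>2) \<le> norm (C\<^sup>2 * (f x)\<^sup>2)"
        by (simp add: power_mult_distrib mult.commute[of "C\<^sup>2"] mult_left_mono)
    qed
  qed
  then show ?thesis using f g by (auto simp: L2_def)
qed

lemma L2_norm_nonneg: "L2_norm S f \<ge> 0"
  by (simp add: L2_norm_def)

lemma L2_norm_power2: "(L2_norm S f)\<^sup>2 = (LINT x|lebesgue_on S. (f x)\<^sup>2)"
  by (simp add: L2_norm_def)

lemma L2_norm_minus: "L2_norm S (\<lambda>x. f x - g x) = L2_norm S (\<lambda>x. g x - f x)"
  by (simp add: L2_norm_def power2_commute)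

lemma L2_norm_cong_AE:
  assumes "AE x in lebesgue_on S. f x = g x" 
    "f \<in> borel_measurable (lebesgue_on S)" "g \<in> borel_measurable (lebesgue_on S)"
  shows "L2_norm S f = L2_norm S g"
  unfolding L2_norm_def using assms by (intro arg_cong[of _ _ sqrt] integral_cong_AE) auto

lemma L2_Cauchy_Schwarz:
  assumes f: "f \<in> L2 S" and g: "g \<in> L2 S"
  shows "\<bar>LINT x|lebesgue_on S. f x * g x\<bar> \<le> L2_norm S f * L2_norm S g"
proof -
  define a b c where "a = (LINT x|lebesgue_on S. (f x)\<^sup>2)" and "b = (LINT x|lebesgue_on S. (g x)\<^sup>2)"
    and "c = (LINT x|lebesgue_on S. f x * g x)"
  note I = L2_square[OF f] L2_square[OF g] L2_mult_integrable[OF f g]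
  have q: "0 \<le> s\<^sup>2 * a + r\<^sup>2 * b + 2 * s * r * c" for s r
  proof -
    have "0 \<le> (LINT x|lebesgue_on S. (s * f x + r * g x)\<^sup>2)" by simp
    also have "\<dots> = (LINT x|lebesgue_on S. s\<^sup>2 * (f x)\<^sup>2 + r\<^sup>2 * (g x)\<^sup>2 + 2 * s * r * (f x * g x))"
      by (intro Bochner_Integration.integral_cong) (auto simp: power2_eq_square algebra_simps)
    also have "\<dots> = s\<^sup>2 * a + r\<^sup>2 * b + 2 * s * r * c"
      unfolding a_def b_def c_def using I by simp
    finally show ?thesis .
  qed
  have ab: "a \<ge> 0" "b \<ge> 0" by (simp_all add: a_def b_def)
  have "c\<^sup>2 \<le> a * b"
  proof (cases "b = 0")
    case True
    have "c = 0"
    proof (rule ccontr)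
      assume "c \<noteq> 0"
      \<comment> \<open>For \<open>b = 0\<close> the quadratic form is affine in \<open>r\<close>;
        this value of \<open>r\<close> makes it equal to -1.\<close>
      then show False using q[of 1 "- (a + 1) / (2 * c)"] True by (simp add: field_simps)
    qed
    then show ?thesis using ab by simp
  next
    case False
    \<comment> \<open>Up to the scaling by \<open>b\<close>, this is the value of the form at its
      minimizer in \<open>r\<close>.\<close>
    have "0 \<le> b * (a * b - c\<^sup>2)" using q[of b "-c"] by (simp add: power2_eq_square algebra_simps)
    then show ?thesis using False ab by (simp add: zero_le_mult_iff)
  qed
  then have "sqrt (c\<^sup>2) \<le> sqrt (a * b)" by (rule real_sqrt_le_mono)
  then show ?thesis unfolding L2_norm_def a_def b_def c_def by (simp add: real_sqrt_mult)
qed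

lemma L2_triangle:
  assumes f: "f \<in> L2 S" and g: "g \<in> L2 S"
  shows "L2_norm S (\<lambda>x. f x + g x) \<le> L2_norm S f + L2_norm S g"
proof (rule power2_le_imp_le)
  have "(L2_norm S (\<lambda>x. f x + g x))\<^sup>2 = (LINT x|lebesgue_on S. (f x)\<^sup>2 + (g x)\<^sup>2 + 2 * (f x * g x))"
    unfolding L2_norm_power2
    by (intro Bochner_Integration.integral_cong) (auto simp: power2_eq_square algebra_simps)
  also have "\<dots> = (L2_norm S f)\<^sup>2 + (L2_norm S g)\<^sup>2 + 2 * (LINT x|lebesgue_on S. f x * g x)"
    unfolding L2_norm_power2 using L2_square[OF f] L2_square[OF g] L2_mult_integrable[OF f g] by simp
  also have "\<dots> \<le> (L2_norm S f + L2_norm S g)\<^sup>2"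
    using L2_Cauchy_Schwarz[OF f g] by (simp add: power2_sum)
  finally show "(L2_norm S (\<lambda>x. f x + g x))\<^sup>2 \<le> (L2_norm S f + L2_norm S g)\<^sup>2" .
qed (simp add: L2_norm_nonneg)

lemma L2_norm_diff_le:
  assumes f: "f \<in> L2 S" and g: "g \<in> L2 S"
  shows "\<bar>L2_norm S f - L2_norm S g\<bar> \<le> L2_norm S (\<lambda>x. f x - g x)"
  using L2_triangle[OF L2_diff[OF f g] g] L2_triangle[OF L2_diff[OF g f] f] L2_norm_minus[of S f g]
  by simp

lemma finite_measure_Omega: "finite_measure (lebesgue_on Omega)"
  by (rule finite_measure_lebesgue_on) simp

lemma bounded_L2_Omega:
  assumes "g \<in> borel_measurable (lebesgue_on Omega)" "\<And>x. x \<in> Omega \<Longrightarrow> \<bar>g x\<bar> \<le> C"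
  shows "g \<in> L2 Omega"
proof -
  have "(\<lambda>x. 1) \<in> L2 Omega"
    using finite_measure.integrable_const[OF finite_measure_Omega] by (auto simp: L2_def)
  from L2_bounded_mult[OF this assms] show ?thesis by simp
qed

lemma L2_Omega_integrable: "f \<in> L2 Omega \<Longrightarrow> integrable (lebesgue_on Omega) f"
  using L2_mult_integrable[of f Omega "\<lambda>x. 1"] bounded_L2_Omega[of "\<lambda>x. 1" 1] by simp

lemma continuous_measurable_Omega:
  "continuous_on UNIV g \<Longrightarrow> g \<in> borel_measurable (lebesgue_on Omega)" for g :: "real \<Rightarrow> real"
  by (rule continuous_imp_measurable_on_sets_lebesgue[OF continuous_on_subset]) auto

lemma continuous_L2_Omega:
  fixes g :: "real \<Rightarrow> real"
  assumes "continuous_on UNIV g"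
  shows "g \<in> L2 Omega"
proof -
  have "compact (g ` {0..1})" using assms by (intro compact_continuous_image continuous_on_subset[OF assms]) auto
  then obtain C where C: "\<And>x. x \<in> {0..1} \<Longrightarrow> \<bar>g x\<bar> \<le> C"
    using compact_imp_bounded bounded_iff by (metis image_eqI real_norm_def)
  show ?thesis using C by (intro bounded_L2_Omega[of _ C] continuous_measurable_Omega assms) auto
qed

section \<open>Completeness of the sine system\<close>

lemma integrable_mult_bounded:
  fixes f g :: "'a \<Rightarrow> real"
  assumes "integrable M f" "g \<in> borel_measurable M" "\<And>x. x \<in> space M \<Longrightarrow> \<bar>g x\<bar> \<le> C"
  shows "integrable M (\<lambda>x. f x * g x)"
proof (rule Bochner_Integration.integrable_bound[where f="\<lambda>x. C * f x"])
  show "AE x in M. norm (f x * g x) \<le> norm (C * f x)"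
  proof (rule AE_I2)
    fix x assume "x \<in> space M"
    then have "\<bar>g x\<bar> \<le> \<bar>C\<bar>" using assms(3) by fastforce
    then show "norm (f x * g x) \<le> norm (C * f x)"
      by (simp add: abs_mult mult.commute[of "\<bar>C\<bar>"] mult_left_mono)
  qed
qed (use assms in auto)

text \<open>Multiplying \<open>sin (k \<theta>)\<close> by \<open>cos \<theta>\<close> gives half
  the sum of the sines of frequencies \<open>k + 1\<close> and \<open>k - 1\<close>. Each power of
  the cosine moves \<open>k\<close>, so the induction on \<open>j\<close> keeps \<open>k\<close>
  arbitrary.\<close>

lemma sine_cosine_power_orthogonal:
  assumes r: "integrable (lebesgue_on Omega) r"
    and z: "\<And>k. (LINT x|lebesgue_on Omega. r x * sin (real k * pi * x)) = 0"
  shows "(LINT x|lebesgue_on Omega. r x * (sin (real k * pi * x) * cos (pi * x) ^ j)) = 0"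
proof (induction j arbitrary: k)
  case 0
  then show ?case using z by simp
next
  case (Suc j)
  show ?case
  \<comment> \<open>For \<open>k = 0\<close> the sine is identically 0; the case is separated
    because \<open>k - 1\<close> is truncated subtraction.\<close>
  proof (cases "k = 0")
    case False
    have int: "integrable (lebesgue_on Omega) (\<lambda>x. r x * (sin (real k * pi * x) * cos (pi * x) ^ j))" for k
      by (rule integrable_mult_bounded[OF r, where C=1])
        (auto simp: abs_mult power_abs intro!: mult_le_one power_le_one continuous_measurable_Omega continuous_intros)
    have "r x * (sin (real k * pi * x) * cos (pi * x) ^ Suc j)
        = r x * (sin (real (k + 1) * pi * x) * cos (pi * x) ^ j) / 2
        + r x * (sin (real (k - 1) * pi * x) * cos (pi * x) ^ j) / 2" for x
    proof -
      have "real (k - 1) = real k - 1" using False by simp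
      then have "sin (real k * pi * x) * cos (pi * x) = (sin (real (k + 1) * pi * x) + sin (real (k - 1) * pi * x)) / 2"
        by (simp add: algebra_simps sin_add sin_diff)
      then have "r x * cos (pi * x) ^ j * (sin (real k * pi * x) * cos (pi * x))
          = r x * cos (pi * x) ^ j * ((sin (real (k + 1) * pi * x) + sin (real (k - 1) * pi * x)) / 2)"
        by simp
      then show ?thesis by (simp add: add_divide_distrib distrib_left mult_ac)
    qed
    then have "(LINT x|lebesgue_on Omega. r x * (sin (real k * pi * x) * cos (pi * x) ^ Suc j))
        = (LINT x|lebesgue_on Omega. r x * (sin (real (k + 1) * pi * x) * cos (pi * x) ^ j) / 2
          + r x * (sin (real (k - 1) * pi * x) * cos (pi * x) ^ j) / 2)"
      by (simp only:)
    also have "\<dots> = 0"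
      using int[of "k+1"] int[of "k-1"] Suc[of "k+1"] Suc[of "k-1"]
      by (subst Bochner_Integration.integral_add) (auto simp del: of_nat_add)
    finally show ?thesis .
  qed simp
qed

text \<open>On \<open>[0,1]\<close> a continuous function is a continuous function of \<open>cos (pi * x)\<close>, hence a uniform
  limit of polynomials in \<open>cos (pi * x)\<close>.\<close>

lemma sine_times_continuous_orthogonal:
  assumes r: "integrable (lebesgue_on Omega) r"
    and z: "\<And>k. (LINT x|lebesgue_on Omega. r x * sin (real k * pi * x)) = 0"
    and G: "continuous_on UNIV (G::real\<Rightarrow>real)" and b: "\<And>x. \<bar>G x\<bar> \<le> 1"
  shows "(LINT x|lebesgue_on Omega. r x * sin (pi * x) * G x) = 0"
proof -
  define R where "R = (LINT x|lebesgue_on Omega. \<bar>r x\<bar>)"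
  have R: "R \<ge> 0" by (simp add: R_def)
  have rs: "integrable (lebesgue_on Omega) (\<lambda>x. r x * sin (pi * x))"
    by (rule integrable_mult_bounded[OF r, where C=1]) (auto intro!: continuous_measurable_Omega continuous_intros)
  have le: "\<bar>LINT x|lebesgue_on Omega. r x * sin (pi * x) * G x\<bar> \<le> e * R" if e: "e > 0" for e
  proof -
    have "continuous_on {-1..1} (\<lambda>y. G (arccos y / pi))"
      by (intro continuous_on_compose2[OF G] continuous_intros) auto
    then obtain g where g: "real_polynomial_function g" 
      and ge: "\<And>y. y \<in> {-1..1} \<Longrightarrow> \<bar>G (arccos y / pi) - g y\<bar> < e"
      using Stone_Weierstrass_real_polynomial_function[of "{-1..1}" "\<lambda>y. G (arccos y / pi)" e] e by auto
    obtain a n where gan: "g = (\<lambda>y. \<Sum>i\<le>n. a i * y ^ i)"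
      using g real_polynomial_function_iff_sum by blast
    have "integrable (lebesgue_on Omega) (\<lambda>x. a i * (r x * (sin (real 1 * pi * x) * cos (pi * x) ^ i)))" for i
      by (intro integrable_mult_right integrable_mult_bounded[OF r, where C=1])
        (auto simp: abs_mult power_abs intro!: mult_le_one power_le_one continuous_measurable_Omega continuous_intros)
    then have "(LINT x|lebesgue_on Omega. (\<Sum>i\<le>n. a i * (r x * (sin (real 1 * pi * x) * cos (pi * x) ^ i)))) = 0"
      using sine_cosine_power_orthogonal[OF r z, of 1] by simp
    then have z0: "(LINT x|lebesgue_on Omega. r x * sin (pi * x) * g (cos (pi * x))) = 0"
      by (simp add: gan sum_distrib_left mult.assoc mult.left_commute)
    have close: "\<bar>G x - g (cos (pi * x))\<bar> \<le> e" if "x \<in> Omega" for x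
    proof -
      have "arccos (cos (pi * x)) = pi * x" using that by (intro arccos_cos) auto
      then show ?thesis using ge[of "cos (pi * x)"] by simp
    qed
    have gm: "(\<lambda>x. g (cos (pi * x))) \<in> borel_measurable (lebesgue_on Omega)"
      unfolding gan by (intro continuous_measurable_Omega continuous_intros)
    have gb: "\<bar>g (cos (pi * x))\<bar> \<le> 1 + e" if "x \<in> Omega" for x
      using close[OF that] b[of x] by linarith
    have i1: "integrable (lebesgue_on Omega) (\<lambda>x. r x * sin (pi * x) * G x)"
      by (rule integrable_mult_bounded[OF rs, where C=1]) (auto intro!: continuous_measurable_Omega G b)
    have i2: "integrable (lebesgue_on Omega) (\<lambda>x. r x * sin (pi * x) * g (cos (pi * x)))"
      by (rule integrable_mult_bounded[OF rs gm, where C="1+e"]) (use gb in auto)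
    have eq: "(LINT x|lebesgue_on Omega. r x * sin (pi * x) * G x) 
        = (LINT x|lebesgue_on Omega. r x * sin (pi * x) * G x - r x * sin (pi * x) * g (cos (pi * x)))"
      using i1 i2 z0 by simp
    have "\<bar>LINT x|lebesgue_on Omega. r x * sin (pi * x) * G x\<bar> \<le> (LINT x|lebesgue_on Omega. \<bar>r x * sin (pi * x) * G x - r x * sin (pi * x) * g (cos (pi * x))\<bar>)"
      unfolding eq by (rule integral_abs_bound)
    also have "\<dots> \<le> (LINT x|lebesgue_on Omega. e * \<bar>r x\<bar>)"
    proof (rule integral_mono)
      fix x assume x: "x \<in> space (lebesgue_on Omega)"
      have "\<bar>r x * sin (pi * x) * G x - r x * sin (pi * x) * g (cos (pi * x))\<bar>
         = \<bar>r x\<bar> * (\<bar>sin (pi * x)\<bar> * \<bar>G x - g (cos (pi * x))\<bar>)"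
        by (simp add: abs_mult[symmetric] algebra_simps)
      also have "\<dots> \<le> \<bar>r x\<bar> * (1 * e)" using close x by (intro mult_left_mono mult_mono) auto
      finally show "\<bar>r x * sin (pi * x) * G x - r x * sin (pi * x) * g (cos (pi * x))\<bar> \<le> e * \<bar>r x\<bar>"
        by (simp add: mult.commute)
    qed (use i1 i2 r in auto)
    also have "\<dots> = e * R" by (simp add: R_def)
    finally show ?thesis .
  qed
  have "\<bar>LINT x|lebesgue_on Omega. r x * sin (pi * x) * G x\<bar> \<le> e" if "e > 0" for e
  proof -
    \<comment> \<open>Dividing by \<open>R + 1\<close> instead of \<open>R\<close> covers the case
      \<open>R = 0\<close>.\<close>
    have "\<bar>LINT x|lebesgue_on Omega. r x * sin (pi * x) * G x\<bar> \<le> e / (R + 1) * R"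
      using that R by (intro le) auto
    also have "\<dots> \<le> e" using that R by (simp add: field_simps)
    finally show ?thesis .
  qed
  from field_le_epsilon[of "\<bar>LINT x|lebesgue_on Omega. r x * sin (pi * x) * G x\<bar>" 0] this
  show ?thesis by simp
qed

text \<open>The extra factor \<open>sin (pi * x)\<close> is positive on the interval, and against
  the product \<open>\<rho>\<close> all bounded continuous functions integrate to 0. Approximating
  the sign of \<open>\<rho>\<close> by them yields a zero integral of
  \<open>\<bar>\<rho>\<bar>\<close>.\<close>

lemma sine_uniqueness:
  assumes r: "integrable (lebesgue_on Omega) r"
    and z: "\<And>k. (LINT x|lebesgue_on Omega. r x * sin (real k * pi * x)) = 0"
  shows "AE x in lebesgue_on Omega. r x = 0"
proof -
  define \<rho> where "\<rho> x = r x * sin (pi * x)" for x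
  have \<rho>: "integrable (lebesgue_on Omega) \<rho>" unfolding \<rho>_def
    by (rule integrable_mult_bounded[OF r, where C=1]) (auto intro!: continuous_measurable_Omega continuous_intros)
  define u where "u x = (if x \<in> Omega then sgn (\<rho> x) else 0)" for x
  have "u \<in> borel_measurable lebesgue"
  proof -
    have "(\<lambda>x. sgn (\<rho> x)) \<in> borel_measurable (lebesgue_on Omega)"
      using borel_measurable_integrable[OF \<rho>] by measurable
    then show ?thesis unfolding u_def[abs_def] by (subst borel_measurable_if) auto
  qed
  then have "u measurable_on UNIV" by (rule lebesgue_measurable_imp_measurable_on_real) simp
  then obtain N g where N: "negligible N" and g: "\<And>n. continuous_on UNIV (g n)"
     and lim: "\<And>x. x \<notin> N \<Longrightarrow> (\<lambda>n. g n x) \<longlonglongrightarrow> u x"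
    unfolding measurable_on_def by auto
  \<comment> \<open>Clipping to the range of the sign function keeps the limit and supplies the
    bound \<open>\<bar>\<rho>\<bar>\<close> for dominated convergence.\<close>
  define G where "G n x = max (-1) (min 1 (g n x))" for n x
  have Gc: "continuous_on UNIV (G n)" for n
    unfolding G_def[abs_def] by (intro continuous_intros g)
  have Gb: "\<bar>G n x\<bar> \<le> 1" for n x by (auto simp: G_def)
  have Glim: "(\<lambda>n. G n x) \<longlonglongrightarrow> u x" if "x \<notin> N" for x
  proof -
    have "(\<lambda>n. G n x) \<longlonglongrightarrow> max (-1) (min 1 (u x))"
      unfolding G_def by (intro tendsto_intros lim that)
    moreover have "max (-1) (min 1 (u x)) = u x" by (auto simp: u_def sgn_if)
    ultimately show ?thesis by simp
  qed
  have "AE x in lebesgue_on Omega. x \<notin> N"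
    using N AE_not_in[of N lebesgue] by (auto simp: AE_restrict_space_iff negligible_iff_null_sets elim: eventually_mono)
  then have ae: "AE x in lebesgue_on Omega. (\<lambda>n. \<rho> x * G n x) \<longlonglongrightarrow> \<rho> x * u x"
    by eventually_elim (intro tendsto_intros Glim)
  have um: "u \<in> borel_measurable (lebesgue_on Omega)"
    using \<open>u \<in> borel_measurable lebesgue\<close> by (rule measurable_restrict_space1)
  have "(\<lambda>n. LINT x|lebesgue_on Omega. \<rho> x * G n x) \<longlonglongrightarrow> (LINT x|lebesgue_on Omega. \<rho> x * u x)"
  proof (rule integral_dominated_convergence[where w="\<lambda>x. \<bar>\<rho> x\<bar>"])
    show "AE x in lebesgue_on Omega. norm (\<rho> x * G n x) \<le> \<bar>\<rho> x\<bar>" for n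
      using Gb by (intro AE_I2) (auto simp: abs_mult intro: mult_left_le)
  qed (use \<rho> um ae Gc continuous_measurable_Omega in \<open>auto intro!: borel_measurable_times\<close>)
  moreover have "(LINT x|lebesgue_on Omega. \<rho> x * G n x) = 0" for n
    unfolding \<rho>_def by (rule sine_times_continuous_orthogonal[OF r z Gc Gb])
  ultimately have "(LINT x|lebesgue_on Omega. \<rho> x * u x) = 0"
    using LIMSEQ_unique[OF _ tendsto_const] by simp
  moreover have "(LINT x|lebesgue_on Omega. \<rho> x * u x) = (LINT x|lebesgue_on Omega. \<bar>\<rho> x\<bar>)"
    by (intro Bochner_Integration.integral_cong) (auto simp: u_def abs_sgn)
  ultimately have "AE x in lebesgue_on Omega. \<bar>\<rho> x\<bar> = 0"
    using \<rho> integral_nonneg_eq_0_iff_AE[of "lebesgue_on Omega" "\<lambda>x. \<bar>\<rho> x\<bar>"] by simp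
  moreover have "AE x in lebesgue_on Omega. sin (pi * x) > 0"
    by (rule AE_I2) (auto intro!: sin_gt_zero)
  ultimately show ?thesis by eventually_elim (simp add: \<rho>_def)
qed

section \<open>Weak derivatives and curves of functions\<close>

lemma integral_FTC_Ioo:
  fixes F f :: "real \<Rightarrow> real"
  assumes "a \<le> b" and F: "\<And>x. x \<in> {a..b} \<Longrightarrow> (F has_real_derivative f x) (at x within {a..b})"
    and f: "continuous_on {a..b} f"
  shows "integrable (lebesgue_on {a<..<b}) f" "(LINT x|lebesgue_on {a<..<b}. f x) = F b - F a"
proof -
  have "set_integrable lebesgue {a..b} f"
    using f by (intro absolutely_integrable_continuous_real) auto
  then have "set_integrable lebesgue {a<..<b} f"
    by (rule set_integrable_subset) auto
  then show i: "integrable (lebesgue_on {a<..<b}) f"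
    by (simp add: integrable_restrict_space set_integrable_def)
  have "(f has_integral (F b - F a)) {a..b}"
    using F assms(1) by (intro fundamental_theorem_of_calculus)
      (auto simp: has_real_derivative_iff_has_vector_derivative)
  then have "integral {a<..<b} f = F b - F a"
    by (metis integral_open_interval_real integral_unique)
  then show "(LINT x|lebesgue_on {a<..<b}. f x) = F b - F a"
    using lebesgue_integral_eq_integral[OF i] by simp
qed

lemma continuous_integrable_Ioo:
  fixes f :: "real \<Rightarrow> real"
  assumes "continuous_on {a..b} f"
  shows "integrable (lebesgue_on {a<..<b}) f"
proof -
  have "set_integrable lebesgue {a<..<b} f"
    using assms by (intro set_integrable_subset[OF absolutely_integrable_continuous_real]) auto
  then show ?thesis by (simp add: integrable_restrict_space set_integrable_def)
qed

lemma smooth_L2_Omega: "smooth f \<Longrightarrow> f \<in> L2 Omega" for f :: "real \<Rightarrow> real"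
  by (intro continuous_L2_Omega smooth_continuous_on)

lemma test_function_L2: "w \<in> test_functions S \<Longrightarrow> w \<in> L2 Omega" for w :: "real \<Rightarrow> real"
  by (intro smooth_L2_Omega test_functionD(1))

lemma test_function_boundary: "w \<in> test_functions {a<..<b} \<Longrightarrow> w a = 0 \<and> w b = 0" for w :: "real \<Rightarrow> real"
  by (auto intro: test_functionD(5))

lemma test_function_by_parts:
  fixes w s :: "real \<Rightarrow> real"
  assumes w: "w \<in> test_functions Omega" and s: "smooth s"
  shows "(LINT x|lebesgue_on Omega. deriv w x * s x) = - (LINT x|lebesgue_on Omega. w x * deriv s x)"
proof -
  note w1 = test_functionD(1)[OF w] 
  note L = smooth_L2_Omega[OF smooth_deriv[OF w1]] smooth_L2_Omega[OF s] smooth_L2_Omega[OF w1]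
    smooth_L2_Omega[OF smooth_deriv[OF s]]
  have "(LINT x|lebesgue_on Omega. deriv w x * s x + w x * deriv s x) = w 1 * s 1 - w 0 * s 0"
  proof (rule integral_FTC_Ioo)
    show "((\<lambda>x. w x * s x) has_real_derivative deriv w x * s x + w x * deriv s x) (at x within {0..1})" for x
      using DERIV_mult[OF smooth_has_real_derivative[OF w1] smooth_has_real_derivative[OF s], of x]
      by (auto intro: has_field_derivative_at_within simp: algebra_simps)
    show "continuous_on {0..1} (\<lambda>x. deriv w x * s x + w x * deriv s x)"
      by (intro continuous_intros smooth_continuous_on smooth_deriv w1 s)
  qed simp
  then show ?thesis
    using test_function_boundary[OF w] L2_mult_integrable[OF L(1,2)] L2_mult_integrable[OF L(3,4)]
    by simp
qed

lemma cutoff_integral_limit: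
  assumes r: "integrable (lebesgue_on Omega) r"
  shows "(\<lambda>m. LINT x|lebesgue_on Omega. r x * cutoff m x) \<longlonglongrightarrow> (LINT x|lebesgue_on Omega. r x)"
proof (rule integral_dominated_convergence[where w="\<lambda>x. \<bar>r x\<bar>"])
  show "AE x in lebesgue_on Omega. (\<lambda>m. r x * cutoff m x) \<longlonglongrightarrow> r x"
  proof (rule AE_I2)
    fix x assume "x \<in> space (lebesgue_on Omega)"
    then show "(\<lambda>m. r x * cutoff m x) \<longlonglongrightarrow> r x"
      using tendsto_mult[OF tendsto_const cutoff_tendsto_1, of x "r x"] by simp
  qed
  show "AE x in lebesgue_on Omega. norm (r x * cutoff m x) \<le> \<bar>r x\<bar>" for m
    using cutoff_range by (intro AE_I2) (auto simp: abs_mult intro!: mult_left_le)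
  show "(\<lambda>x. r x * cutoff m x) \<in> borel_measurable (lebesgue_on Omega)" for m
    by (intro borel_measurable_times borel_measurable_integrable[OF r] continuous_measurable_Omega smooth_continuous_on smooth_cutoff)
qed (use r in auto)

text \<open>A sine times \<open>cutoff m\<close> is a test function, and dominated convergence
  removes the cutoff. So orthogonality to test functions passes to the sines, whose completeness
  finishes.\<close>

lemma orthogonal_test_functions_imp_zero:
  assumes r: "r \<in> L2 Omega"
    and z: "\<And>w. w \<in> test_functions Omega \<Longrightarrow> (LINT x|lebesgue_on Omega. r x * w x) = 0"
  shows "AE x in lebesgue_on Omega. r x = 0"
proof (rule sine_uniqueness)
  show "integrable (lebesgue_on Omega) r" by (rule L2_Omega_integrable[OF r])
  fix k
  have s: "smooth (\<lambda>x. sin (real k * pi * x))" using smooth_sin[of "real k * pi" 0] by simp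
  have "integrable (lebesgue_on Omega) (\<lambda>x. r x * sin (real k * pi * x))"
    by (intro L2_mult_integrable r smooth_L2_Omega s)
  from cutoff_integral_limit[OF this]
  have "(\<lambda>m. LINT x|lebesgue_on Omega. r x * (cutoff m x * sin (real k * pi * x)))
     \<longlonglongrightarrow> (LINT x|lebesgue_on Omega. r x * sin (real k * pi * x))"
    by (simp add: mult_ac)
  moreover have "(LINT x|lebesgue_on Omega. r x * (cutoff m x * sin (real k * pi * x))) = 0" for m
    by (intro z test_function_mult cutoff_test_function s)
  ultimately show "(LINT x|lebesgue_on Omega. r x * sin (real k * pi * x)) = 0"
    by (simp add: LIMSEQ_const_iff)
qed

lemma weak_deriv:
  assumes "f \<in> H1"
  shows "weak_deriv f \<in> L2 Omega" "has_weak_deriv f (weak_deriv f)"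
proof -
  have "\<exists>g. g \<in> L2 Omega \<and> has_weak_deriv f g" using assms by (auto simp: H1_def)
  from someI_ex[OF this] show "weak_deriv f \<in> L2 Omega" "has_weak_deriv f (weak_deriv f)"
    by (auto simp: weak_deriv_def)
qed

lemma H1_L2: "f \<in> H1 \<Longrightarrow> f \<in> L2 Omega" and H10_H1: "f \<in> H10 \<Longrightarrow> f \<in> H1"
  by (auto simp: H1_def H10_def)

lemma weak_deriv_unique:
  assumes "g \<in> L2 Omega" "h \<in> L2 Omega" "has_weak_deriv f g" "has_weak_deriv f h"
  shows "AE x in lebesgue_on Omega. g x = h x"
proof -
  have "AE x in lebesgue_on Omega. g x - h x = 0"
  proof (rule orthogonal_test_functions_imp_zero)
    show "(\<lambda>x. g x - h x) \<in> L2 Omega" by (rule L2_diff[OF assms(1,2)])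
    fix w :: "real \<Rightarrow> real" assume w: "w \<in> test_functions Omega"
    then have "(LINT x|lebesgue_on Omega. g x * w x) = (LINT x|lebesgue_on Omega. h x * w x)"
      using assms(3,4) by (auto simp: has_weak_deriv_def)
    moreover have "integrable (lebesgue_on Omega) (\<lambda>x. g x * w x)" "integrable (lebesgue_on Omega) (\<lambda>x. h x * w x)"
      by (intro L2_mult_integrable assms test_function_L2[OF w])+
    ultimately show "(LINT x|lebesgue_on Omega. (g x - h x) * w x) = 0"
      by (simp add: left_diff_distrib)
  qed
  then show ?thesis by simp
qed

lemma has_weak_deriv_diff:
  assumes "f \<in> L2 Omega" "g \<in> L2 Omega" "f' \<in> L2 Omega" "g' \<in> L2 Omega"
    "has_weak_deriv f f'" "has_weak_deriv g g'"
  shows "has_weak_deriv (\<lambda>x. f x - g x) (\<lambda>x. f' x - g' x)"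
  unfolding has_weak_deriv_def
proof
  fix w :: "real \<Rightarrow> real" assume w: "w \<in> test_functions Omega"
  have "integrable (lebesgue_on Omega) (\<lambda>x. f x * deriv w x)" "integrable (lebesgue_on Omega) (\<lambda>x. g x * deriv w x)"
    "integrable (lebesgue_on Omega) (\<lambda>x. f' x * w x)" "integrable (lebesgue_on Omega) (\<lambda>x. g' x * w x)"
    by (intro L2_mult_integrable assms test_function_L2[OF w] test_function_L2[OF test_function_deriv[OF w]])+
  then show "(LINT x|lebesgue_on Omega. (f x - g x) * deriv w x) = - (LINT x|lebesgue_on Omega. (f' x - g' x) * w x)"
    using assms(5,6) w by (simp add: has_weak_deriv_def left_diff_distrib)
qed

text \<open>The chosen representative \<open>weak_deriv\<close> is not linear as a function; only
  its class is. Uniqueness up to a null set makes the norm behave as if it were.\<close>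

lemma weak_deriv_diff_norm:
  assumes f: "f \<in> L2 Omega" "f' \<in> L2 Omega" "has_weak_deriv f f'" 
    and g: "g \<in> L2 Omega" "g' \<in> L2 Omega" "has_weak_deriv g g'"
  shows "L2_norm Omega (weak_deriv (\<lambda>x. f x - g x)) = L2_norm Omega (\<lambda>x. f' x - g' x)"
proof -
  have D: "has_weak_deriv (\<lambda>x. f x - g x) (\<lambda>x. f' x - g' x)" "(\<lambda>x. f' x - g' x) \<in> L2 Omega"
    using has_weak_deriv_diff L2_diff assms by blast+
  then have h: "(\<lambda>x. f x - g x) \<in> H1" using L2_diff[OF f(1) g(1)] by (auto simp: H1_def)
  show ?thesis
    by (intro L2_norm_cong_AE weak_deriv_unique[OF weak_deriv(1)[OF h] D(2) weak_deriv(2)[OF h] D(1)]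
      L2_measurable weak_deriv(1)[OF h] D(2))
qed

lemma L2_le_H1_norm: "L2_norm Omega f \<le> H1_norm f"
  and weak_deriv_le_H1_norm: "L2_norm Omega (weak_deriv f) \<le> H1_norm f"
  unfolding H1_norm_def by (auto intro: real_le_rsqrt)

lemma test_function_weak_deriv:
  assumes "w \<in> test_functions Omega"
  shows "has_weak_deriv w (deriv w)"
  unfolding has_weak_deriv_def
  using test_function_by_parts[OF _ test_functionD(1)[OF assms]] by (simp add: mult.commute)

lemma L2_limit_integral:
  assumes u: "\<And>n. u n \<in> L2 S" and v: "v \<in> L2 S" and g: "g \<in> L2 S"
    and lim: "((\<lambda>n. L2_norm S (\<lambda>x. u n x - v x)) \<longlongrightarrow> 0) F"
  shows "((\<lambda>n. LINT x|lebesgue_on S. u n x * g x) \<longlongrightarrow> (LINT x|lebesgue_on S. v x * g x)) F"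
proof -
  have "((\<lambda>n. (LINT x|lebesgue_on S. u n x * g x) - (LINT x|lebesgue_on S. v x * g x)) \<longlongrightarrow> 0) F"
  proof (rule Lim_null_comparison)
    show "((\<lambda>n. L2_norm S (\<lambda>x. u n x - v x) * L2_norm S g) \<longlongrightarrow> 0) F"
      using tendsto_mult[OF lim tendsto_const] by simp
    have "(LINT x|lebesgue_on S. u n x * g x) - (LINT x|lebesgue_on S. v x * g x)
        = (LINT x|lebesgue_on S. (u n x - v x) * g x)" for n
      using L2_mult_integrable[OF u g] L2_mult_integrable[OF v g] by (simp add: left_diff_distrib)
    then show "\<forall>\<^sub>F n in F. norm ((LINT x|lebesgue_on S. u n x * g x) - (LINT x|lebesgue_on S. v x * g x))
       \<le> L2_norm S (\<lambda>x. u n x - v x) * L2_norm S g"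
      using L2_Cauchy_Schwarz[OF L2_diff[OF u v] g] by simp
  qed
  then show ?thesis by (simp add: LIM_zero_iff)
qed

text \<open>Here \<open>s\<close> need not vanish at the endpoints. The boundary terms disappear
  because \<open>f\<close> is a limit of test functions in the H1 norm, for which the identity is
  classical; this is how the Dirichlet condition is used.\<close>

lemma H10_by_parts:
  assumes f: "f \<in> H10" and s: "smooth s"
  shows "(LINT x|lebesgue_on Omega. weak_deriv f x * s x) = - (LINT x|lebesgue_on Omega. f x * deriv s x)"
proof -
  obtain w where w: "\<And>n. w n \<in> test_functions Omega" and lim: "(\<lambda>n. H1_norm (\<lambda>x. w n x - f x)) \<longlonglongrightarrow> 0"
    using f by (auto simp: H10_def)
  have h: "f \<in> H1" using f by (rule H10_H1)
  have 1: "(\<lambda>n. L2_norm Omega (\<lambda>x. w n x - f x)) \<longlonglongrightarrow> 0"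
    by (rule Lim_null_comparison[OF _ lim]) (auto simp: L2_norm_nonneg L2_le_H1_norm)
  have "L2_norm Omega (\<lambda>x. deriv (w n) x - weak_deriv f x) \<le> H1_norm (\<lambda>x. w n x - f x)" for n
    using weak_deriv_le_H1_norm[of "\<lambda>x. w n x - f x"]
      weak_deriv_diff_norm[OF test_function_L2[OF w] test_function_L2[OF test_function_deriv[OF w]]
         test_function_weak_deriv[OF w] H1_L2[OF h] weak_deriv[OF h]] by metis
  then have 2: "(\<lambda>n. L2_norm Omega (\<lambda>x. deriv (w n) x - weak_deriv f x)) \<longlonglongrightarrow> 0"
    by (intro Lim_null_comparison[OF _ lim]) (auto simp: L2_norm_nonneg)
  have A: "(\<lambda>n. LINT x|lebesgue_on Omega. deriv (w n) x * s x) \<longlonglongrightarrow> (LINT x|lebesgue_on Omega. weak_deriv f x * s x)"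
    by (intro L2_limit_integral 2 weak_deriv[OF h] smooth_L2_Omega s test_function_L2[OF test_function_deriv[OF w]])
  have B: "(\<lambda>n. - (LINT x|lebesgue_on Omega. w n x * deriv s x)) \<longlonglongrightarrow> - (LINT x|lebesgue_on Omega. f x * deriv s x)"
    by (intro tendsto_minus L2_limit_integral 1 H1_L2[OF h] smooth_L2_Omega smooth_deriv s test_function_L2[OF w])
  show ?thesis
    by (rule LIMSEQ_unique[OF A[unfolded test_function_by_parts[OF w s]] B])
qed

text \<open>It turns sine coefficients of the position into cosine coefficients of its derivative.
  The case \<open>k = 0\<close> says that the weak derivative has mean zero.\<close>

lemma H10_sine_coefficient:
  assumes "f \<in> H10"
  shows "(LINT x|lebesgue_on Omega. weak_deriv f x * cos (k * x)) = k * (LINT x|lebesgue_on Omega. f x * sin (k * x))"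
proof -
  have "deriv (\<lambda>x. cos (k * x)) = (\<lambda>x. - k * sin (k * x))"
    by (rule ext, rule DERIV_imp_deriv) (auto intro!: derivative_eq_intros)
  then show ?thesis
    using H10_by_parts[OF assms smooth_cos[of k 0]] by (simp add: mult_ac)
qed

section \<open>Continuous curves of functions and their coefficients\<close>

lemma real_continuous_onI_bound:
  fixes N :: "real \<Rightarrow> real"
  assumes "\<And>s. s \<in> S \<Longrightarrow> ((\<lambda>t. D t s) \<longlongrightarrow> 0) (at s within S)"
    and "\<And>s t. s \<in> S \<Longrightarrow> t \<in> S \<Longrightarrow> \<bar>N t - N s\<bar> \<le> D t s"
  shows "continuous_on S N"
  unfolding continuous_on_def
proof
  fix s assume s: "s \<in> S"
  have "((\<lambda>t. N t - N s) \<longlongrightarrow> 0) (at s within S)"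
    by (rule Lim_null_comparison[OF _ assms(1)[OF s]])
      (use assms(2)[OF s] in \<open>auto simp: eventually_at_filter\<close>)
  then show "(N \<longlongrightarrow> N s) (at s within S)" by (simp add: LIM_zero_iff)
qed

lemma continuous_on_Icc_bounded:
  fixes N :: "real \<Rightarrow> real"
  assumes "continuous_on {a..b} N"
  shows "\<exists>B\<ge>0. \<forall>t\<in>{a..b}. \<bar>N t\<bar> \<le> B"
proof -
  have "bounded (N ` {a..b})" by (intro compact_imp_bounded compact_continuous_image assms) simp
  then obtain B where "\<forall>t\<in>{a..b}. \<bar>N t\<bar> \<le> B" by (auto simp: bounded_iff)
  then show ?thesis by (intro exI[of _ "\<bar>B\<bar>"]) force
qed

lemma continuous_curve_L2:
  assumes "continuous_curve H10 H1_norm T u"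
  shows "continuous_curve (L2 Omega) (L2_norm Omega) T u"
  unfolding continuous_curve_def
proof
  fix s assume "s \<in> {0..T}"
  then have h: "(\<lambda>x. u (x, s)) \<in> H10" 
    and l: "((\<lambda>t. H1_norm (\<lambda>x. u (x, t) - u (x, s))) \<longlongrightarrow> 0) (at s within {0..T})"
    using assms by (auto simp: continuous_curve_def)
  have "((\<lambda>t. L2_norm Omega (\<lambda>x. u (x, t) - u (x, s))) \<longlongrightarrow> 0) (at s within {0..T})"
    by (rule Lim_null_comparison[OF _ l]) (auto simp: L2_norm_nonneg L2_le_H1_norm)
  then show "(\<lambda>x. u (x, s)) \<in> L2 Omega \<and>
       ((\<lambda>t. L2_norm Omega (\<lambda>x. u (x, t) - u (x, s))) \<longlongrightarrow> 0) (at s within {0..T})"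
    using h H1_L2 H10_H1 by blast
qed

lemma L2_curve:
  assumes c: "continuous_curve (L2 Omega) (L2_norm Omega) T u"
  shows "\<exists>B\<ge>0. \<forall>t\<in>{0..T}. L2_norm Omega (\<lambda>x. u (x, t)) \<le> B"
    and "g \<in> L2 Omega \<Longrightarrow> continuous_on {0..T} (\<lambda>t. LINT x|lebesgue_on Omega. u (x, t) * g x)"
proof -
  have L: "(\<lambda>x. u (x, t)) \<in> L2 Omega" if "t \<in> {0..T}" for t
    using c that by (auto simp: continuous_curve_def)
  have "continuous_on {0..T} (\<lambda>t. L2_norm Omega (\<lambda>x. u (x, t)))"
  proof (rule real_continuous_onI_bound)
    show "((\<lambda>t. L2_norm Omega (\<lambda>x. u (x, t) - u (x, s))) \<longlongrightarrow> 0) (at s within {0..T})" if "s \<in> {0..T}" for s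
      using c that by (auto simp: continuous_curve_def)
  qed (intro L2_norm_diff_le L)
  from continuous_on_Icc_bounded[OF this] 
  show "\<exists>B\<ge>0. \<forall>t\<in>{0..T}. L2_norm Omega (\<lambda>x. u (x, t)) \<le> B" by force
  assume g: "g \<in> L2 Omega"
  show "continuous_on {0..T} (\<lambda>t. LINT x|lebesgue_on Omega. u (x, t) * g x)"
  proof (rule real_continuous_onI_bound)
    show "((\<lambda>t. L2_norm Omega (\<lambda>x. u (x, t) - u (x, s)) * L2_norm Omega g) \<longlongrightarrow> 0) (at s within {0..T})" 
      if "s \<in> {0..T}" for s
      using c that by (auto simp: continuous_curve_def intro: tendsto_mult_left_zero)
    fix s t assume st: "s \<in> {0..T}" "t \<in> {0..T}"
    have "(LINT x|lebesgue_on Omega. u (x, t) * g x) - (LINT x|lebesgue_on Omega. u (x, s) * g x)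
      = (LINT x|lebesgue_on Omega. (u (x, t) - u (x, s)) * g x)"
      using L2_mult_integrable[OF L[OF st(1)] g] L2_mult_integrable[OF L[OF st(2)] g] by (simp add: left_diff_distrib)
    then show "\<bar>(LINT x|lebesgue_on Omega. u (x, t) * g x) - (LINT x|lebesgue_on Omega. u (x, s) * g x)\<bar>
      \<le> L2_norm Omega (\<lambda>x. u (x, t) - u (x, s)) * L2_norm Omega g"
      using L2_Cauchy_Schwarz[OF L2_diff[OF L[OF st(2)] L[OF st(1)]] g] by simp
  qed
qed

text \<open>Uniformity in \<open>t\<close> later dominates the space integrals when the cutoffs are
  removed under the time integral.\<close>

lemma H10_curve_weak_deriv_bound:
  assumes c: "continuous_curve H10 H1_norm T u"
  shows "\<exists>B\<ge>0. \<forall>t\<in>{0..T}. L2_norm Omega (weak_deriv (\<lambda>x. u (x, t))) \<le> B"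
proof -
  have L: "(\<lambda>x. u (x, t)) \<in> H1" if "t \<in> {0..T}" for t
    using c that H10_H1 by (auto simp: continuous_curve_def)
  have "continuous_on {0..T} (\<lambda>t. L2_norm Omega (weak_deriv (\<lambda>x. u (x, t))))"
  proof (rule real_continuous_onI_bound)
    show "((\<lambda>t. H1_norm (\<lambda>x. u (x, t) - u (x, s))) \<longlongrightarrow> 0) (at s within {0..T})" if "s \<in> {0..T}" for s
      using c that by (auto simp: continuous_curve_def)
    fix s t assume st: "s \<in> {0..T}" "t \<in> {0..T}"
    note Ls = L[OF st(1)] and Lt = L[OF st(2)]
    show "\<bar>L2_norm Omega (weak_deriv (\<lambda>x. u (x, t))) - L2_norm Omega (weak_deriv (\<lambda>x. u (x, s)))\<bar>
      \<le> H1_norm (\<lambda>x. u (x, t) - u (x, s))"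
      using L2_norm_diff_le[OF weak_deriv(1)[OF Lt] weak_deriv(1)[OF Ls]]
        weak_deriv_le_H1_norm[of "\<lambda>x. u (x, t) - u (x, s)"]
        weak_deriv_diff_norm[OF H1_L2[OF Lt] weak_deriv[OF Lt] H1_L2[OF Ls] weak_deriv[OF Ls]]
      by linarith
  qed
  from continuous_on_Icc_bounded[OF this] show ?thesis by force
qed

lemma L2_curve_deriv_coefficient:
  assumes c: "continuous_curve (L2 Omega) (L2_norm Omega) T u" "continuous_curve (L2 Omega) (L2_norm Omega) T v"
    and d: "L2_curve_deriv T u v" and g: "g \<in> L2 Omega" and s: "s \<in> {0..T}"
  shows "((\<lambda>t. LINT x|lebesgue_on Omega. u (x, t) * g x) has_real_derivative
      (LINT x|lebesgue_on Omega. v (x, s) * g x)) (at s within {0..T})"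
proof -
  have L: "(\<lambda>x. u (x, t)) \<in> L2 Omega" "(\<lambda>x. v (x, t)) \<in> L2 Omega" if "t \<in> {0..T}" for t
    using c that by (auto simp: continuous_curve_def)
  have lim: "((\<lambda>t. L2_norm Omega (\<lambda>x. (u (x, t) - u (x, s)) / (t - s) - v (x, s)) * L2_norm Omega g) \<longlongrightarrow> 0)
      (at s within {0..T})"
    using d s by (auto simp: L2_curve_deriv_def intro: tendsto_mult_left_zero)
  have "((\<lambda>t. ((LINT x|lebesgue_on Omega. u (x, t) * g x) - (LINT x|lebesgue_on Omega. u (x, s) * g x)) / (t - s)
      - (LINT x|lebesgue_on Omega. v (x, s) * g x)) \<longlongrightarrow> 0) (at s within {0..T})"
  proof (rule Lim_null_comparison[OF _ lim])
    have "norm (((LINT x|lebesgue_on Omega. u (x, t) * g x) - (LINT x|lebesgue_on Omega. u (x, s) * g x)) / (t - s)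
      - (LINT x|lebesgue_on Omega. v (x, s) * g x))
      \<le> L2_norm Omega (\<lambda>x. (u (x, t) - u (x, s)) / (t - s) - v (x, s)) * L2_norm Omega g"
      if t: "t \<in> {0..T}" for t
    proof -
      note i = L2_mult_integrable[OF L(1)[OF s] g] L2_mult_integrable[OF L(1)[OF t] g] L2_mult_integrable[OF L(2)[OF s] g]
      have q: "(\<lambda>x. (u (x, t) - u (x, s)) / (t - s) - v (x, s)) \<in> L2 Omega"
        using L2_diff[OF L2_cmult[OF L2_diff[OF L(1)[OF t] L(1)[OF s]], of "1 / (t - s)"] L(2)[OF s]] by simp
      have "(LINT x|lebesgue_on Omega. ((u (x, t) - u (x, s)) / (t - s) - v (x, s)) * g x)
        = (LINT x|lebesgue_on Omega. (u (x, t) * g x - u (x, s) * g x) / (t - s) - v (x, s) * g x)"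
        by (intro Bochner_Integration.integral_cong) (auto simp: diff_divide_distrib algebra_simps)
      also have "\<dots> = ((LINT x|lebesgue_on Omega. u (x, t) * g x) - (LINT x|lebesgue_on Omega. u (x, s) * g x)) / (t - s)
        - (LINT x|lebesgue_on Omega. v (x, s) * g x)"
        using i by simp
      finally show ?thesis using L2_Cauchy_Schwarz[OF q g] by simp
    qed
    then show "\<forall>\<^sub>F t in at s within {0..T}. norm (((LINT x|lebesgue_on Omega. u (x, t) * g x) - (LINT x|lebesgue_on Omega. u (x, s) * g x)) / (t - s)
      - (LINT x|lebesgue_on Omega. v (x, s) * g x))
      \<le> L2_norm Omega (\<lambda>x. (u (x, t) - u (x, s)) / (t - s) - v (x, s)) * L2_norm Omega g"
      by (auto simp: eventually_at_filter)
  qed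
  then show ?thesis by (simp add: has_field_derivative_iff LIM_zero_iff)
qed

section \<open>Weak differential equations in time\<close>

lemma bump'_has_integral: "has_bochner_integral lborel bump' 1"
proof (rule has_bochner_integral_nn_integral)
  have m: "bump' \<in> borel_measurable borel"
    unfolding bump'_def using smooth_continuous_on[OF smooth_flat_fun] by (rule borel_measurable_continuous_onI)
  then show "bump' \<in> borel_measurable lborel" by simp
  have "(\<integral>\<^sup>+x. ennreal (bump' x) * indicator {0..} x \<partial>lborel) = ennreal (1 - bump 0)"
    by (rule nn_integral_FTC_atLeast[OF m bump_deriv bump'_nonneg bump_tendsto_1])
  moreover have "ennreal (bump' x) * indicator {0..} x = ennreal (bump' x)" for x
    by (auto simp: indicator_def bump'_alt)
  ultimately show "(\<integral>\<^sup>+x. ennreal (bump' x) \<partial>lborel) = ennreal 1"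
    by (simp add: bump_alt)
qed (use bump'_nonneg in auto)

text \<open>This is a one-sided approximate identity after rescaling time by \<open>n\<close>. The
  factor \<open>bump (real n * d - u)\<close> stems from the opposite edge of a hat and tends to 1;
  \<open>c\<close> is 1 for the left edge and -1 for the right one.\<close>

lemma bump'_approximate_identity:
  fixes W :: "real \<Rightarrow> real"
  assumes W: "continuous_on UNIV W" and B: "\<And>t. \<bar>W t\<bar> \<le> B" and d: "d > 0"
  shows "(\<lambda>n. LINT u|lborel. W (a + c * u / real n) * (bump' u * bump (real n * d - u))) \<longlonglongrightarrow> W a"
proof -
  have i: "integrable lborel bump'" and i1: "integral\<^sup>L lborel bump' = 1"
    using bump'_has_integral by (auto simp: has_bochner_integral_iff)
  have "(\<lambda>n. LINT u|lborel. W (a + c * u / real n) * (bump' u * bump (real n * d - u)))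
     \<longlonglongrightarrow> (LINT u|lborel. W a * (bump' u * 1))"
  proof (rule integral_dominated_convergence[where w="\<lambda>u. B * bump' u"])
    show "AE u in lborel. (\<lambda>n. W (a + c * u / real n) * (bump' u * bump (real n * d - u))) \<longlonglongrightarrow> W a * (bump' u * 1)"
    proof (rule AE_I2)
      fix u :: real
      have "(\<lambda>n. a + c * u * inverse (real n)) \<longlonglongrightarrow> a + c * u * 0"
        by (intro tendsto_intros lim_inverse_n)
      then have "(\<lambda>n. a + c * u / real n) \<longlonglongrightarrow> a" by (simp add: divide_inverse)
      moreover have "isCont W a" using W by (simp add: continuous_on_eq_continuous_at)
      ultimately have 1: "(\<lambda>n. W (a + c * u / real n)) \<longlonglongrightarrow> W a"
        by (rule isCont_tendsto_compose[rotated])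
      have "filterlim (\<lambda>n. -u + d * real n) at_top sequentially"
        by (intro filterlim_tendsto_add_at_top[OF tendsto_const]
            filterlim_tendsto_pos_mult_at_top[OF tendsto_const d filterlim_real_sequentially])
      then have "(\<lambda>n. bump (-u + d * real n)) \<longlonglongrightarrow> 1" by (rule filterlim_compose[OF bump_tendsto_1])
      then have 2: "(\<lambda>n. bump (real n * d - u)) \<longlonglongrightarrow> 1" by (simp add: mult.commute)
      show "(\<lambda>n. W (a + c * u / real n) * (bump' u * bump (real n * d - u))) \<longlonglongrightarrow> W a * (bump' u * 1)"
        by (intro tendsto_intros 1 2)
    qed
    show "AE u in lborel. norm (W (a + c * u / real n) * (bump' u * bump (real n * d - u))) \<le> B * bump' u" for n
    proof (rule AE_I2)
      fix u :: real
      have "\<bar>W (a + c * u / real n)\<bar> * (bump' u * bump (real n * d - u)) \<le> B * (bump' u * 1)"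
        using B[of a] by (intro mult_mono B mult_left_mono bump_range bump'_nonneg mult_nonneg_nonneg) auto
      then show "norm (W (a + c * u / real n) * (bump' u * bump (real n * d - u))) \<le> B * bump' u"
        using bump_range bump'_nonneg by (simp add: abs_mult)
    qed
    have b: "continuous_on UNIV bump" "continuous_on UNIV bump'"
      using smooth_continuous_on[OF smooth_flat_fun] smooth_continuous_on[OF smooth_bump] by (auto simp: bump'_def)
    have "continuous_on UNIV (\<lambda>u. W (a + c * u / real n) * (bump' u * bump (real n * d - u)))" for n
      unfolding divide_inverse
      by (intro continuous_intros continuous_on_compose2[OF W] continuous_on_compose2[OF b(1)] b(2)) auto
    then show "(\<lambda>u. W (a + c * u / real n) * (bump' u * bump (real n * d - u))) \<in> borel_measurable lborel" for n
      by (simp add: borel_measurable_continuous_onI)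
    show "(\<lambda>u. W a * (bump' u * 1)) \<in> borel_measurable lborel" using i by auto
    show "integrable lborel (\<lambda>u. B * bump' u)" using i by auto
  qed
  then show ?thesis using i1 by simp
qed

lemma lebesgue_on_eq_lborel:
  fixes g :: "'a::euclidean_space \<Rightarrow> real"
  assumes g: "g \<in> borel_measurable borel" and z: "\<And>x. x \<notin> S \<Longrightarrow> g x = 0" and S: "S \<in> sets lebesgue"
  shows "(LINT x|lebesgue_on S. g x) = (LINT x|lborel. g x)"
proof -
  have "(LINT x|lebesgue_on S. g x) = (LINT x|lebesgue. indicator S x *\<^sub>R g x)"
    by (rule integral_restrict_space) (use S in auto)
  also have "\<dots> = (LINT x|lebesgue. g x)"
    by (intro Bochner_Integration.integral_cong) (auto simp: indicator_def z)
  also have "\<dots> = (LINT x|lborel. g x)" using g by (intro integral_completion) simp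
  finally show ?thesis .
qed

text \<open>Testing with \<open>hat a b n\<close> equates an average of \<open>W\<close> just to the
  right of \<open>a\<close> with one just to the left of \<open>b\<close>; both averages converge to
  the point values.\<close>

lemma du_Bois_Reymond_interior:
  fixes W :: "real \<Rightarrow> real"
  assumes W: "continuous_on {0..T} W"
    and z: "\<And>\<theta>. \<theta> \<in> test_functions {0<..<T} \<Longrightarrow> (LINT t|lebesgue_on {0<..<T}. W t * deriv \<theta> t) = 0"
    and ab: "0 < a" "a < b" "b < T"
  shows "W a = W b"
proof -
  \<comment> \<open>Extending \<open>W\<close> constantly beyond the endpoints makes it bounded and
    continuous on the line, so that the substitutions below take place over the whole line.\<close>
  define V where "V t = W (max 0 (min T t))" for t
  have V: "continuous_on UNIV V" unfolding V_def[abs_def]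
    by (rule continuous_on_compose2[OF W]) (use ab in \<open>auto intro!: continuous_intros\<close>)
  obtain B where "\<forall>t\<in>{0..T}. \<bar>W t\<bar> \<le> B" using continuous_on_Icc_bounded[OF W] by blast
  then have B: "\<bar>V t\<bar> \<le> B" for t using ab by (auto simp: V_def)
  define L where "L n t = V t * (real n * bump' (real n * (t - a)) * bump (real n * (b - t)))" for n t
  define R where "R n t = V t * (real n * bump' (real n * (b - t)) * bump (real n * (t - a)))" for n t
  have b: "continuous_on UNIV bump" "continuous_on UNIV bump'"
    using smooth_continuous_on[OF smooth_flat_fun] smooth_continuous_on[OF smooth_bump] by (auto simp: bump'_def)
  have c: "continuous_on UNIV (L n)" "continuous_on UNIV (R n)" for n
    unfolding L_def R_def
    by (intro continuous_intros V continuous_on_compose2[OF b(1)] continuous_on_compose2[OF b(2)]; force intro: continuous_intros)+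
  have eq: "(LINT t|lborel. L n t) = (LINT t|lborel. R n t)" for n
  proof -
    have D: "deriv (hat a b n) t = real n * bump' (real n * (t - a)) * bump (real n * (b - t))
      - real n * bump' (real n * (b - t)) * bump (real n * (t - a))" for t
      by (rule DERIV_imp_deriv[OF hat_deriv])
    have "0 = (LINT t|lebesgue_on {0<..<T}. W t * deriv (hat a b n) t)"
      using z hat_test_function ab by simp
    also have "\<dots> = (LINT t|lebesgue_on {0<..<T}. L n t - R n t)"
      by (intro Bochner_Integration.integral_cong) (auto simp: D L_def R_def V_def algebra_simps)
    also have "\<dots> = (LINT t|lebesgue_on {0<..<T}. L n t) - (LINT t|lebesgue_on {0<..<T}. R n t)"
      by (intro Bochner_Integration.integral_diff continuous_integrable_Ioo continuous_on_subset[OF c(1)]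
          continuous_on_subset[OF c(2)]) auto
    also have "(LINT t|lebesgue_on {0<..<T}. L n t) = (LINT t|lborel. L n t)"
      using c ab by (intro lebesgue_on_eq_lborel borel_measurable_continuous_onI)
        (auto simp: L_def bump'_alt bump_alt zero_less_mult_iff)
    also have "(LINT t|lebesgue_on {0<..<T}. R n t) = (LINT t|lborel. R n t)"
      using c ab by (intro lebesgue_on_eq_lborel borel_measurable_continuous_onI)
        (auto simp: R_def bump'_alt bump_alt zero_less_mult_iff)
    finally show ?thesis by simp
  qed
  \<comment> \<open>Substituting \<open>t = a + u / n\<close> makes the Jacobian absorb the factor
    \<open>n\<close> of the hat's derivative.\<close>
  have eqL: "(LINT t|lborel. L n t) = (LINT u|lborel. V (a + 1 * u / real n) * (bump' u * bump (real n * (b - a) - u)))"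
    if "n > 0" for n
  proof -
    have "real n * (a + 1 / real n * u - a) = u" "real n * (b - (a + 1 / real n * u)) = real n * (b - a) - u" for u
      using that by (simp_all add: field_simps)
    then have "L n (a + 1 / real n * u) = real n * (V (a + 1 * u / real n) * (bump' u * bump (real n * (b - a) - u)))" for u
      by (simp add: L_def)
    then show ?thesis
      using that by (subst lborel_integral_real_affine[of "1 / real n" _ a]) simp_all
  qed
  have 1: "(\<lambda>n. LINT t|lborel. L n t) \<longlonglongrightarrow> V a"
    by (rule Lim_transform_eventually[OF bump'_approximate_identity[OF V B, of "b - a" a 1]])
      (use ab in simp, rule eventually_mono[OF eventually_gt_at_top[of "0::nat"]], simp add: eqL)
  have eqR: "(LINT t|lborel. R n t) = (LINT u|lborel. V (b + (-1) * u / real n) * (bump' u * bump (real n * (b - a) - u)))"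
    if "n > 0" for n
  proof -
    have "real n * (b - (b + - (1 / real n) * u)) = u" "real n * (b + - (1 / real n) * u - a) = real n * (b - a) - u" for u
      using that by (simp_all add: field_simps)
    then have "R n (b + - (1 / real n) * u) = real n * (V (b + (-1) * u / real n) * (bump' u * bump (real n * (b - a) - u)))" for u
      by (simp add: R_def)
    then show ?thesis
      using that by (subst lborel_integral_real_affine[of "- (1 / real n)" _ b]) simp_all
  qed
  have 2: "(\<lambda>n. LINT t|lborel. R n t) \<longlonglongrightarrow> V b"
    by (rule Lim_transform_eventually[OF bump'_approximate_identity[OF V B, of "b - a" b "-1"]])
      (use ab in simp, rule eventually_mono[OF eventually_gt_at_top[of "0::nat"]], simp add: eqR)
  have "V a = V b" using LIMSEQ_unique[OF 1[unfolded eq] 2] .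
  then show ?thesis using ab by (simp add: V_def)
qed

text \<open>Test functions vanish near time 0, where the initial data live, so the left endpoint is
  reached as a limit of interior points.\<close>

lemma du_Bois_Reymond:
  fixes W :: "real \<Rightarrow> real"
  assumes W: "continuous_on {0..T} W"
    and z: "\<And>\<theta>. \<theta> \<in> test_functions {0<..<T} \<Longrightarrow> (LINT t|lebesgue_on {0<..<T}. W t * deriv \<theta> t) = 0"
    and b: "0 < b" "b < T"
  shows "W 0 = W b"
proof -
  \<comment> \<open>The offset 2 keeps every point strictly below \<open>b\<close>, also for
    \<open>n = 0\<close>.\<close>
  have l: "(\<lambda>n. b * inverse (real (n + 2))) \<longlonglongrightarrow> 0"
    using tendsto_mult[OF tendsto_const LIMSEQ_ignore_initial_segment[OF lim_inverse_n, of 2]] by simp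
  have r: "0 < b * inverse (real (n + 2))" "b * inverse (real (n + 2)) < b" for n
    using b by (auto simp: field_simps add_pos_nonneg)
  have "(\<lambda>n. W (b * inverse (real (n + 2)))) \<longlonglongrightarrow> W 0"
  proof (rule continuous_on_tendsto_compose[OF W l])
    show "\<forall>\<^sub>F n in sequentially. b * inverse (real (n + 2)) \<in> {0..T}"
    proof (intro always_eventually allI)
      show "b * inverse (real (n + 2)) \<in> {0..T}" for n
        unfolding atLeastAtMost_iff using r(1)[of n] r(2)[of n] b by linarith
    qed
  qed (use b in auto)
  moreover have "W (b * inverse (real (n + 2))) = W b" for n
    by (rule du_Bois_Reymond_interior[OF W z r b(2)])
  ultimately show ?thesis by (simp add: LIMSEQ_const_iff)
qed

text \<open>Testing with \<open>\<theta> t * cos (k * (\<tau> - t))\<close>, which solves the adjoint equation up to derivatives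
  of \<open>\<theta>\<close>, shows that the Wronskian \<open>W\<close> of \<open>a\<close> and the cosine is constant.\<close>

lemma weak_oscillator:
  fixes a b :: "real \<Rightarrow> real"
  assumes a: "\<And>t. t \<in> {0..T} \<Longrightarrow> (a has_real_derivative b t) (at t within {0..T})"
    and b: "continuous_on {0..T} b"
    and eq: "\<And>\<theta>. \<theta> \<in> test_functions {0<..<T} \<Longrightarrow>
       (LINT t|lebesgue_on {0<..<T}. a t * deriv (deriv \<theta>) t) = - k\<^sup>2 * (LINT t|lebesgue_on {0<..<T}. a t * \<theta> t)"
    and \<tau>: "0 < \<tau>" "\<tau> < T"
  shows "b \<tau> = b 0 * cos (k * \<tau>) - k * a 0 * sin (k * \<tau>)"
proof -
  \<comment> \<open>At \<open>t = \<tau>\<close> the cosine equals 1 and its derivative 0, so the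
    quantity \<open>W\<close> below is \<open>- b \<tau>\<close> there, while \<open>W 0\<close>
    contains only initial values. Constancy of \<open>W\<close> is then exactly the claim.\<close>
  define s where "s t = cos (- k * t + k * \<tau>)" for t
  define s' where "s' t = - k * sin (- k * t + k * \<tau>) * (-1)" for t
  have s: "smooth s" unfolding s_def[abs_def] by (rule smooth_cos)
  have s1: "(s has_real_derivative s' t) (at t)" for t
    unfolding s_def s'_def by (auto intro!: derivative_eq_intros)
  have s2: "(s' has_real_derivative - k\<^sup>2 * s t) (at t)" for t
    unfolding s_def s'_def by (auto intro!: derivative_eq_intros simp: power2_eq_square)
  have sc: "continuous_on S s" "continuous_on S s'" for S
    unfolding s_def[abs_def] s'_def[abs_def] by (intro continuous_intros)+
  have ac: "continuous_on {0..T} a"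
    using a by (meson DERIV_continuous continuous_on_eq_continuous_within)
  define W where "W t = a t * s' t - b t * s t" for t
  have Wc: "continuous_on {0..T} W" unfolding W_def[abs_def] by (intro continuous_intros ac b sc)
  have "W 0 = W \<tau>"
  proof (rule du_Bois_Reymond[OF Wc _ \<tau>])
    fix \<theta> :: "real \<Rightarrow> real" assume \<theta>: "\<theta> \<in> test_functions {0<..<T}"
    define p q where "p = deriv \<theta>" and "q = deriv p"
    have pt: "p \<in> test_functions {0<..<T}" and qt: "q \<in> test_functions {0<..<T}"
      unfolding p_def q_def using \<theta> test_function_deriv by blast+
    note sm = test_functionD(1)[OF \<theta>] test_functionD(1)[OF pt] test_functionD(1)[OF qt]
    have th1: "(\<theta> has_real_derivative p t) (at t)" and p1: "(p has_real_derivative q t) (at t)" for t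
      unfolding q_def using smooth_has_real_derivative sm p_def by auto
    have d1: "deriv (\<lambda>t. \<theta> t * s t) = (\<lambda>t. p t * s t + \<theta> t * s' t)"
      by (rule ext, rule DERIV_imp_deriv) (auto intro!: derivative_eq_intros th1 s1)
    have d2: "deriv (\<lambda>t. p t * s t + \<theta> t * s' t) = (\<lambda>t. q t * s t + 2 * p t * s' t - k\<^sup>2 * (\<theta> t * s t))"
      by (rule ext, rule DERIV_imp_deriv) (auto intro!: derivative_eq_intros th1 s1 s2 p1)
    have int: "integrable (lebesgue_on {0<..<T}) f" if "continuous_on {0..T} f" for f :: "real \<Rightarrow> real"
      by (rule continuous_integrable_Ioo[OF that])
    have c: "continuous_on S \<theta>" "continuous_on S p" "continuous_on S q" for S
      using smooth_continuous_on sm by blast+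
    have i1: "integrable (lebesgue_on {0<..<T}) (\<lambda>t. a t * (q t * s t + 2 * p t * s' t))"
      and i2: "integrable (lebesgue_on {0<..<T}) (\<lambda>t. a t * (\<theta> t * s t))"
      by (intro int continuous_intros ac sc c)+
    \<comment> \<open>Since the second derivative of \<open>s\<close> is \<open>-k^2 s\<close>, the
      terms with undifferentiated \<open>\<theta>\<close> cancel and only those with
      \<open>p\<close> and \<open>q\<close> remain.\<close>
    have "(LINT t|lebesgue_on {0<..<T}. a t * deriv (deriv (\<lambda>t. \<theta> t * s t)) t)
        = - k\<^sup>2 * (LINT t|lebesgue_on {0<..<T}. a t * (\<theta> t * s t))"
      by (rule eq[OF test_function_mult[OF \<theta> s]])
    moreover have "(LINT t|lebesgue_on {0<..<T}. a t * deriv (deriv (\<lambda>t. \<theta> t * s t)) t)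
       = (LINT t|lebesgue_on {0<..<T}. a t * (q t * s t + 2 * p t * s' t) - k\<^sup>2 * (a t * (\<theta> t * s t)))"
      unfolding d1 d2 by (intro Bochner_Integration.integral_cong) (auto simp: algebra_simps)
    moreover have "\<dots> = (LINT t|lebesgue_on {0<..<T}. a t * (q t * s t + 2 * p t * s' t))
       - k\<^sup>2 * (LINT t|lebesgue_on {0<..<T}. a t * (\<theta> t * s t))"
      using i1 i2 by simp
    ultimately have z1: "(LINT t|lebesgue_on {0<..<T}. a t * (q t * s t + 2 * p t * s' t)) = 0" by simp
    have i3: "integrable (lebesgue_on {0<..<T}) (\<lambda>t. b t * s t * p t + a t * s' t * p t + a t * s t * q t)"
      by (intro int continuous_intros ac b sc c)
    \<comment> \<open>The integrand is the derivative of \<open>a * s * p\<close>, which vanishes at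
      both ends. Subtracting it from the previous identity eliminates \<open>q\<close> and leaves
      \<open>W * p\<close>.\<close>
    have "(LINT t|lebesgue_on {0<..<T}. b t * s t * p t + a t * s' t * p t + a t * s t * q t)
       = a T * s T * p T - a 0 * s 0 * p 0"
    proof (rule integral_FTC_Ioo)
      fix t assume t: "t \<in> {0..T}"
      show "((\<lambda>t. a t * s t * p t) has_real_derivative b t * s t * p t + a t * s' t * p t + a t * s t * q t) (at t within {0..T})"
        using a[OF t] s1[of t] p1[of t]
        by (auto intro!: derivative_eq_intros intro: has_field_derivative_at_within simp: algebra_simps)
    qed (use \<tau> in \<open>auto intro!: continuous_intros ac b sc c\<close>)
    also have "\<dots> = 0" using test_function_boundary[OF pt] by simp
    finally have z2: "(LINT t|lebesgue_on {0<..<T}. b t * s t * p t + a t * s' t * p t + a t * s t * q t) = 0" .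
    have "(LINT t|lebesgue_on {0<..<T}. W t * p t)
       = (LINT t|lebesgue_on {0<..<T}. a t * (q t * s t + 2 * p t * s' t)
          - (b t * s t * p t + a t * s' t * p t + a t * s t * q t))"
      unfolding W_def by (intro Bochner_Integration.integral_cong) (auto simp: algebra_simps)
    also have "\<dots> = 0" using i1 i3 z1 z2 by simp
    finally show "(LINT t|lebesgue_on {0<..<T}. W t * deriv \<theta> t) = 0" by (simp add: p_def)
  qed
  then show ?thesis by (simp add: W_def s_def s'_def algebra_simps)
qed

section \<open>Sine coefficients of weak solutions\<close>

lemma L2_norm_bounded:
  assumes "g \<in> borel_measurable (lebesgue_on Omega)" "\<And>x. x \<in> Omega \<Longrightarrow> \<bar>g x\<bar> \<le> C" "C \<ge> 0"
  shows "L2_norm Omega g \<le> C"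
proof -
  have "(LINT x|lebesgue_on Omega. (g x)\<^sup>2) \<le> (LINT x|lebesgue_on Omega. C\<^sup>2)"
  proof (rule integral_mono)
    show "integrable (lebesgue_on Omega) (\<lambda>x. (g x)\<^sup>2)" using L2_square[OF bounded_L2_Omega[OF assms(1,2)]] .
    show "integrable (lebesgue_on Omega) (\<lambda>x. C\<^sup>2)" using finite_measure.integrable_const[OF finite_measure_Omega] .
    show "(g x)\<^sup>2 \<le> C\<^sup>2" if "x \<in> space (lebesgue_on Omega)" for x
      using assms(2)[of x] that assms(3) by (simp add: abs_le_square_iff[symmetric])
  qed
  also have "\<dots> = C\<^sup>2" by (simp add: measure_restrict_space)
  finally show ?thesis using assms(3) by (simp add: L2_norm_def real_le_lsqrt)
qed

lemma L2_integral_bounded: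
  assumes f: "f \<in> L2 Omega" and g: "g \<in> borel_measurable (lebesgue_on Omega)" "\<And>x. x \<in> Omega \<Longrightarrow> \<bar>g x\<bar> \<le> C" "C \<ge> 0"
  shows "\<bar>LINT x|lebesgue_on Omega. f x * g x\<bar> \<le> L2_norm Omega f * C"
proof -
  have "\<bar>LINT x|lebesgue_on Omega. f x * g x\<bar> \<le> L2_norm Omega f * L2_norm Omega g"
    by (intro L2_Cauchy_Schwarz f bounded_L2_Omega[of g C] g)
  also have "\<dots> \<le> L2_norm Omega f * C"
    by (intro mult_left_mono L2_norm_bounded L2_norm_nonneg g)
  finally show ?thesis .
qed

lemma QT_sets: "QT T \<in> sets borel"
  unfolding QT_def by (intro borel_open open_Times) auto

lemma QT_sets_lebesgue: "QT T \<in> sets lebesgue"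
  using QT_sets by (simp add: sets_completionI_sets)

section \<open>Integration over space-time by time slices\<close>

lemma lborel_AE_swap:
  assumes N: "N \<in> null_sets (lborel :: (real \<times> real) measure)"
  shows "AE t in lborel. AE x in lborel. (x, t) \<notin> N"
proof -
  have N': "N \<in> null_sets (lborel \<Otimes>\<^sub>M lborel)" using N by (simp add: lborel_prod)
  then have "AE p in lborel \<Otimes>\<^sub>M lborel. p \<notin> N" by (rule AE_not_in)
  then have "AE x in lborel. AE t in lborel. (x, t) \<notin> N" by (rule lborel_pair.AE_pair)
  moreover have "{p \<in> space (lborel \<Otimes>\<^sub>M lborel). (fst p, snd p) \<notin> N} \<in> sets (lborel \<Otimes>\<^sub>M lborel)"
  proof -
    have "{p \<in> space (lborel \<Otimes>\<^sub>M lborel). (fst p, snd p) \<notin> N} = space (lborel \<Otimes>\<^sub>M lborel) - N" by auto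
    then show ?thesis using null_setsD2[OF N'] sets.compl_sets by metis
  qed
  ultimately show ?thesis using lborel_pair.AE_commute[of "\<lambda>x t. (x, t) \<notin> N"] by simp
qed

text \<open>Fubini is applied on the product of Borel measures, whereas \<open>u\<close> is only
  Lebesgue measurable and its slices matter individually. The Borel version agrees with
  \<open>u\<close> on the whole domain up to a null set and also on almost every slice.\<close>

lemma QT_borel_version:
  fixes u :: "real \<times> real \<Rightarrow> real"
  assumes "u \<in> borel_measurable (lebesgue_on (QT T))"
  obtains v where "v \<in> borel_measurable borel" "\<And>p. p \<notin> QT T \<Longrightarrow> v p = 0"
    "AE p in lebesgue_on (QT T). u p = v p"
    "AE t in lborel. t \<in> {0<..<T} \<longrightarrow> (AE x in lebesgue_on Omega. u (x, t) = v (x, t))"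
proof -
  have "(\<lambda>p. if p \<in> QT T then u p else 0) \<in> borel_measurable lebesgue"
    by (rule borel_measurable_if_I[OF assms QT_sets_lebesgue])
  then obtain v0 where v0: "v0 \<in> borel_measurable lborel"
    and ae: "AE p in lborel. (if p \<in> QT T then u p else 0) = v0 p"
    using completion_ex_borel_measurable_real by blast
  define v where "v p = indicator (QT T) p * v0 p" for p
  from ae have "AE p in lborel. p \<in> QT T \<longrightarrow> u p = v p"
    by eventually_elim (auto simp: v_def)
  then obtain N where N: "N \<in> null_sets lborel" "{p. \<not> (p \<in> QT T \<longrightarrow> u p = v p)} \<subseteq> N"
    by (auto simp: eventually_ae_filter)
  show ?thesis
  proof (rule that)
    show "v \<in> borel_measurable borel" unfolding v_def[abs_def] using v0 QT_sets by simp
    show "v p = 0" if "p \<notin> QT T" for p using that by (simp add: v_def)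
    show "AE p in lebesgue_on (QT T). u p = v p"
      using AE_completion[OF \<open>AE p in lborel. p \<in> QT T \<longrightarrow> u p = v p\<close>] QT_sets_lebesgue
      by (simp add: AE_restrict_space_iff)
    show "AE t in lborel. t \<in> {0<..<T} \<longrightarrow> (AE x in lebesgue_on Omega. u (x, t) = v (x, t))"
      using lborel_AE_swap[OF N(1)]
    proof eventually_elim
      case (elim t)
      show ?case
      proof
        assume "t \<in> {0<..<T}"
        then have "AE x in lborel. x \<in> Omega \<longrightarrow> u (x, t) = v (x, t)"
          using elim
        proof eventually_elim
          case (elim x)
          then show ?case using N(2) \<open>t \<in> {0<..<T}\<close> unfolding QT_def by blast
        qed
        from AE_completion[OF this] show "AE x in lebesgue_on Omega. u (x, t) = v (x, t)"
          by (simp add: AE_restrict_space_iff)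
      qed
    qed
  qed
qed

lemma nn_integral_lebesgue_on:
  fixes g :: "'a::euclidean_space \<Rightarrow> ennreal"
  assumes z: "\<And>x. x \<notin> S \<Longrightarrow> g x = 0" and S: "S \<in> sets lebesgue"
  shows "(\<integral>\<^sup>+x. g x \<partial>lebesgue_on S) = (\<integral>\<^sup>+x. g x \<partial>lborel)"
proof -
  have "(\<integral>\<^sup>+x. g x \<partial>lebesgue_on S) = (\<integral>\<^sup>+x. g x * indicator S x \<partial>lebesgue)"
    using S by (intro nn_integral_restrict_space) auto
  also have "\<dots> = (\<integral>\<^sup>+x. g x \<partial>lebesgue)"
    by (intro nn_integral_cong) (auto simp: indicator_def z)
  finally show ?thesis by (simp add: nn_integral_completion)
qed

text \<open>Continuity of the curve bounds the norms of the slices uniformly on the compact time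
  interval; Tonelli turns this into joint integrability, after which Fubini applies.\<close>

lemma QT_integral:
  assumes u: "u \<in> borel_measurable (lebesgue_on (QT T))" 
    and c: "continuous_curve (L2 Omega) (L2_norm Omega) T u"
    and w: "continuous_on UNIV w" and \<theta>: "continuous_on UNIV \<theta>"
  shows "integrable (lebesgue_on (QT T)) (\<lambda>p. u p * (w (fst p) * \<theta> (snd p)))"
    and "(LINT p|lebesgue_on (QT T). u p * (w (fst p) * \<theta> (snd p)))
       = (LINT t|lebesgue_on {0<..<T}. (LINT x|lebesgue_on Omega. u (x, t) * w x) * \<theta> t)"
proof -
  obtain v where v: "v \<in> borel_measurable borel" "\<And>p. p \<notin> QT T \<Longrightarrow> v p = 0"
    "AE p in lebesgue_on (QT T). u p = v p"
    "AE t in lborel. t \<in> {0<..<T} \<longrightarrow> (AE x in lebesgue_on Omega. u (x, t) = v (x, t))"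
    by (rule QT_borel_version[OF u], rule that)
  have L: "(\<lambda>x. u (x, t)) \<in> L2 Omega" if "t \<in> {0..T}" for t
    using c that by (auto simp: continuous_curve_def)
  obtain B where B: "\<And>t. t \<in> {0..T} \<Longrightarrow> L2_norm Omega (\<lambda>x. u (x, t)) \<le> B" and B0: "B \<ge> 0"
    using L2_curve(1)[OF c] by blast
  obtain Cw where Cw: "\<And>x. x \<in> {0..1} \<Longrightarrow> \<bar>w x\<bar> \<le> Cw" "Cw \<ge> 0"
    using continuous_on_Icc_bounded[OF continuous_on_subset[OF w subset_UNIV], of 0 1] by metis
  obtain Ct where Ct: "\<And>x. x \<in> {0..T} \<Longrightarrow> \<bar>\<theta> x\<bar> \<le> Ct" "Ct \<ge> 0"
    using continuous_on_Icc_bounded[OF continuous_on_subset[OF \<theta> subset_UNIV], of 0 T] by metis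
  have wm[measurable]: "w \<in> borel_measurable borel" and tm[measurable]: "\<theta> \<in> borel_measurable borel"
    using w \<theta> borel_measurable_continuous_onI by auto
  note v(1)[measurable]
  define g where "g = (\<lambda>p. v p * (w (fst p) * \<theta> (snd p)))"
  have g[measurable]: "g \<in> borel_measurable borel"
    unfolding g_def by (intro borel_measurable_times v(1) measurable_compose[OF _ wm] measurable_compose[OF _ tm]
      borel_measurable_continuous_onI continuous_on_fst continuous_on_snd continuous_on_id)
  have g0: "g p = 0" if "p \<notin> QT T" for p using v(2) that by (simp add: g_def)
  have gpair[measurable]: "g \<in> borel_measurable (lborel \<Otimes>\<^sub>M lborel)" using g by (simp add: lborel_prod)
  have slice[measurable]: "(\<lambda>x. g (x, t)) \<in> borel_measurable borel" for t
    by (intro measurable_compose[OF _ g] borel_measurable_continuous_onI continuous_intros)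
  have um: "(\<lambda>x. u (x, t) * (w x * \<theta> t)) \<in> borel_measurable (lebesgue_on Omega)" if "t \<in> {0<..<T}" for t
    using L[of t] that by (intro borel_measurable_times L2_measurable continuous_measurable_Omega w continuous_intros) auto
  have nn: "(\<integral>\<^sup>+x. ennreal \<bar>g (x, t)\<bar> \<partial>lborel) \<le> ennreal (B * (Cw * Ct))"
    and val: "(LINT x|lborel. g (x, t)) = (LINT x|lebesgue_on Omega. u (x, t) * w x) * \<theta> t"
    if t: "t \<in> {0<..<T}" and e: "AE x in lebesgue_on Omega. u (x, t) = v (x, t)" for t
  proof -
    have t': "t \<in> {0..T}" using t by auto
    have s0: "g (x, t) = 0" if "x \<notin> Omega" for x using that by (intro g0) (auto simp: QT_def)
    have eq: "AE x in lebesgue_on Omega. g (x, t) = u (x, t) * (w x * \<theta> t)"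
      using e by eventually_elim (simp add: g_def)
    have sm: "(\<lambda>x. g (x, t)) \<in> borel_measurable (lebesgue_on Omega)"
      using measurable_completion[of "\<lambda>x. g (x, t)" lborel borel] by (intro measurable_restrict_space1) simp
    have ab: "(\<lambda>x. \<bar>u (x, t)\<bar>) \<in> L2 Omega" using L[OF t'] by (auto simp: L2_def)
    have wt: "(\<lambda>x. \<bar>w x * \<theta> t\<bar>) \<in> borel_measurable (lebesgue_on Omega)"
      by (intro continuous_measurable_Omega continuous_intros w)
    have wtb: "\<bar>\<bar>w x * \<theta> t\<bar>\<bar> \<le> Cw * Ct" if "x \<in> Omega" for x
      using that t Cw Ct by (auto simp: abs_mult intro!: mult_mono)
    have "(\<integral>\<^sup>+x. ennreal \<bar>g (x, t)\<bar> \<partial>lborel) = (\<integral>\<^sup>+x. ennreal \<bar>g (x, t)\<bar> \<partial>lebesgue_on Omega)"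
      by (rule nn_integral_lebesgue_on[symmetric]) (auto simp: s0)
    also have "\<dots> = (\<integral>\<^sup>+x. ennreal (\<bar>u (x, t)\<bar> * \<bar>w x * \<theta> t\<bar>) \<partial>lebesgue_on Omega)"
      by (rule nn_integral_cong_AE) (use eq in \<open>eventually_elim, simp add: abs_mult\<close>)
    also have "\<dots> = ennreal (LINT x|lebesgue_on Omega. \<bar>u (x, t)\<bar> * \<bar>w x * \<theta> t\<bar>)"
      by (intro nn_integral_eq_integral L2_mult_integrable ab bounded_L2_Omega[OF wt wtb]) auto
    also have "\<dots> \<le> ennreal (B * (Cw * Ct))"
    proof (rule ennreal_leI)
      have "L2_norm Omega (\<lambda>x. \<bar>u (x, t)\<bar>) \<le> B" using B[OF t'] by (simp add: L2_norm_def)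
      then show "(LINT x|lebesgue_on Omega. \<bar>u (x, t)\<bar> * \<bar>w x * \<theta> t\<bar>) \<le> B * (Cw * Ct)"
        using L2_integral_bounded[OF ab wt, of "Cw * Ct"] wtb Cw(2) Ct(2) mult_right_mono[of _ B "Cw * Ct"]
        by (smt (verit, best) mult_nonneg_nonneg)
    qed
    finally show "(\<integral>\<^sup>+x. ennreal \<bar>g (x, t)\<bar> \<partial>lborel) \<le> ennreal (B * (Cw * Ct))" .
    have "(LINT x|lborel. g (x, t)) = (LINT x|lebesgue_on Omega. g (x, t))"
      by (rule lebesgue_on_eq_lborel[symmetric]) (auto simp: s0)
    also have "\<dots> = (LINT x|lebesgue_on Omega. u (x, t) * (w x * \<theta> t))"
      by (rule integral_cong_AE[OF sm um[OF t] eq])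
    finally show "(LINT x|lborel. g (x, t)) = (LINT x|lebesgue_on Omega. u (x, t) * w x) * \<theta> t"
      by (simp add: mult.assoc[symmetric])
  qed
  have out: "g (x, t) = 0" if "t \<notin> {0<..<T}" for x t using that by (intro g0) (auto simp: QT_def)
  have gi: "integrable (lborel \<Otimes>\<^sub>M lborel) g"
  proof (rule integrableI_bounded[OF gpair])
    have "(\<integral>\<^sup>+p. ennreal (norm (g p)) \<partial>(lborel \<Otimes>\<^sub>M lborel)) = (\<integral>\<^sup>+t. \<integral>\<^sup>+x. ennreal (norm (g (x, t))) \<partial>lborel \<partial>lborel)"
      by (rule lborel_pair.nn_integral_snd[symmetric]) measurable
    also have "\<dots> \<le> (\<integral>\<^sup>+t. ennreal (B * (Cw * Ct)) * indicator {0<..<T} t \<partial>lborel)"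
    proof (rule nn_integral_mono_AE)
      show "AE t in lborel. (\<integral>\<^sup>+x. ennreal (norm (g (x, t))) \<partial>lborel) \<le> ennreal (B * (Cw * Ct)) * indicator {0<..<T} t"
        using v(4)
      proof eventually_elim
        case (elim t)
        then show ?case using nn[of t] out[of t] by (cases "t \<in> {0<..<T}") auto
      qed
    qed
    also have "\<dots> < \<infinity>" using emeasure_bounded_finite[of "{0<..<T}"] by (simp add: nn_integral_cmult_indicator ennreal_mult_less_top)
    finally show "(\<integral>\<^sup>+p. ennreal (norm (g p)) \<partial>(lborel \<Otimes>\<^sub>M lborel)) < \<infinity>" .
  qed
  then have gl: "integrable lborel g" by (simp add: lborel_prod)
  have gm: "g \<in> borel_measurable (lebesgue_on (QT T))"
    using measurable_completion[of g lborel borel] by (intro measurable_restrict_space1) simp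
  have ueq: "AE p in lebesgue_on (QT T). g p = u p * (w (fst p) * \<theta> (snd p))"
    using v(3) by eventually_elim (simp add: g_def)
  have "(\<lambda>p. w (fst p) * \<theta> (snd p)) \<in> borel_measurable borel"
    by (intro borel_measurable_continuous_onI continuous_intros continuous_on_compose2[OF w] continuous_on_compose2[OF \<theta>]) auto
  then have "(\<lambda>p. w (fst p) * \<theta> (snd p)) \<in> borel_measurable (lebesgue_on (QT T))"
    using measurable_completion[of _ lborel borel] by (intro measurable_restrict_space1) simp
  then have upm: "(\<lambda>p. u p * (w (fst p) * \<theta> (snd p))) \<in> borel_measurable (lebesgue_on (QT T))"
    by (rule borel_measurable_times[OF u])
  have "integrable lebesgue (\<lambda>p. indicator (QT T) p *\<^sub>R g p)"
    using gl integrable_completion[of g lborel] g by (intro integrable_mult_indicator QT_sets_lebesgue) simp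
  then have "integrable (lebesgue_on (QT T)) g"
    using QT_sets_lebesgue by (simp add: integrable_restrict_space)
  then show "integrable (lebesgue_on (QT T)) (\<lambda>p. u p * (w (fst p) * \<theta> (snd p)))"
    using integrable_cong_AE[OF gm upm ueq] by simp
  have tm2: "(\<lambda>t. LINT x|lborel. g (x, t)) \<in> borel_measurable borel"
    using lborel.borel_measurable_lebesgue_integral[of "\<lambda>t x. g (x, t)" lborel]
    by (simp add: measurable_pair_swap_iff[of g])
  have "(LINT p|lebesgue_on (QT T). u p * (w (fst p) * \<theta> (snd p))) = (LINT p|lebesgue_on (QT T). g p)"
    by (rule integral_cong_AE[OF upm gm]) (use ueq in auto)
  also have "\<dots> = (LINT p|lborel. g p)" by (rule lebesgue_on_eq_lborel[OF g g0 QT_sets_lebesgue])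
  also have "\<dots> = (LINT t|lborel. LINT x|lborel. g (x, t))"
    using lborel_pair.integral_snd[of "\<lambda>x t. g (x, t)"] gi by (simp add: lborel_prod)
  also have "\<dots> = (LINT t|lebesgue_on {0<..<T}. LINT x|lborel. g (x, t))"
    by (rule lebesgue_on_eq_lborel[OF tm2, symmetric]) (auto simp: out)
  also have "\<dots> = (LINT t|lebesgue_on {0<..<T}. (LINT x|lebesgue_on Omega. u (x, t) * w x) * \<theta> t)"
  proof (rule integral_cong_AE)
    show "(\<lambda>t. LINT x|lborel. g (x, t)) \<in> borel_measurable (lebesgue_on {0<..<T})"
      by (intro measurable_restrict_space1 measurable_completion) (use tm2 in simp)
    show "(\<lambda>t. (LINT x|lebesgue_on Omega. u (x, t) * w x) * \<theta> t) \<in> borel_measurable (lebesgue_on {0<..<T})"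
      by (intro borel_measurable_integrable continuous_integrable_Ioo continuous_intros
          L2_curve(2)[OF c] continuous_L2_Omega w continuous_on_subset[OF \<theta>]) auto
    have "AE t in lebesgue_on {0<..<T}. t \<in> {0<..<T} \<and> (AE x in lebesgue_on Omega. u (x, t) = v (x, t))"
      using AE_completion[OF v(4)] by (simp add: AE_restrict_space_iff)
    then show "AE t in lebesgue_on {0<..<T}. (LINT x|lborel. g (x, t)) = (LINT x|lebesgue_on Omega. u (x, t) * w x) * \<theta> t"
      by eventually_elim (use val in blast)
  qed
  finally show "(LINT p|lebesgue_on (QT T). u p * (w (fst p) * \<theta> (snd p)))
       = (LINT t|lebesgue_on {0<..<T}. (LINT x|lebesgue_on Omega. u (x, t) * w x) * \<theta> t)" .
qed

text \<open>The sine is replaced by the test function \<open>w m\<close>, and the equation puts two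
  space derivatives on it. One is moved to \<open>\<phi>\<close>; the remaining
  \<open>deriv (w m)\<close> is bounded uniformly in \<open>m\<close>, because the sine compensates
  the steep slopes of the cutoff. Then \<open>m\<close> tends to infinity.\<close>

lemma wave_weak_coefficient:
  fixes n :: nat
  assumes sol: "wave_solution T (\<phi>0, \<phi>1) \<phi> \<phi>t" and \<theta>: "\<theta> \<in> test_functions {0<..<T}"
  defines "k \<equiv> real n * pi"
  defines "a \<equiv> \<lambda>t. LINT x|lebesgue_on Omega. \<phi> (x, t) * sin (k * x)"
  shows "(LINT t|lebesgue_on {0<..<T}. a t * deriv (deriv \<theta>) t) = - k\<^sup>2 * (LINT t|lebesgue_on {0<..<T}. a t * \<theta> t)"
proof -
  have meas: "\<phi> \<in> borel_measurable (lebesgue_on (QT T))" and curve: "continuous_curve H10 H1_norm T \<phi>"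
    and eq: "\<And>\<psi>. \<psi> \<in> test_functions (QT T) \<Longrightarrow> (LINT p|lebesgue_on (QT T).
           \<phi> p * (dir_deriv (0, 1) (dir_deriv (0, 1) \<psi>) p - dir_deriv (1, 0) (dir_deriv (1, 0) \<psi>) p)) = 0"
    using sol by (auto simp: wave_solution_def)
  note L2c = continuous_curve_L2[OF curve]
  have k0: "k \<ge> 0" by (simp add: k_def)
  have H: "(\<lambda>x. \<phi> (x, t)) \<in> H10" if "t \<in> {0..T}" for t
    using curve that by (auto simp: continuous_curve_def)
  obtain B where B: "B \<ge> 0" "\<forall>t\<in>{0..T}. L2_norm Omega (\<lambda>x. \<phi> (x, t)) \<le> B" using L2_curve(1)[OF L2c] by blast
  obtain B' where B': "B' \<ge> 0" "\<forall>t\<in>{0..T}. L2_norm Omega (weak_deriv (\<lambda>x. \<phi> (x, t))) \<le> B'"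
    using H10_curve_weak_deriv_bound[OF curve] by blast
  have ss: "smooth (\<lambda>x. sin (k * x))" "smooth (\<lambda>x. cos (k * x))" using smooth_sin[of k 0] smooth_cos[of k 0] by simp_all
  define w where "w m x = cutoff m x * sin (k * x)" for m x
  have w: "w m \<in> test_functions Omega" for m
    unfolding w_def by (rule test_function_mult[OF cutoff_test_function ss(1)])
  note w' = test_function_deriv[OF w] and w'' = test_function_deriv[OF test_function_deriv[OF w]]
  note \<theta>' = test_function_deriv[OF \<theta>] and \<theta>'' = test_function_deriv[OF test_function_deriv[OF \<theta>]]
  have cont: "continuous_on UNIV f" if "f \<in> test_functions S" for f :: "real \<Rightarrow> real" and S
    using that by (intro smooth_continuous_on test_functionD(1))
  define A where "A m t = (LINT x|lebesgue_on Omega. \<phi> (x, t) * w m x)" for m t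
  define C where "C m t = (LINT x|lebesgue_on Omega. \<phi> (x, t) * deriv (deriv (w m)) x)" for m t
  have Ac: "continuous_on {0..T} (A m)" and Cc: "continuous_on {0..T} (C m)" for m
    unfolding A_def C_def by (intro L2_curve(2)[OF L2c] test_function_L2[OF w] test_function_L2[OF w''])+
  have ac: "continuous_on {0..T} a"
    unfolding a_def by (intro L2_curve(2)[OF L2c] smooth_L2_Omega ss)
  have AC: "(LINT t|lebesgue_on {0<..<T}. A m t * deriv (deriv \<theta>) t) = (LINT t|lebesgue_on {0<..<T}. C m t * \<theta> t)" for m
  proof -
    let ?M = "lebesgue_on (QT T)"
    note i1 = QT_integral[OF meas L2c cont[OF w] cont[OF \<theta>''], of m]
    note i2 = QT_integral[OF meas L2c cont[OF w''] cont[OF \<theta>], of m]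
    have "0 = (LINT p|?M. \<phi> p * (w m (fst p) * deriv (deriv \<theta>) (snd p) - deriv (deriv (w m)) (fst p) * \<theta> (snd p)))"
      using eq[unfolded QT_def, OF tensor_test_function(1)[OF w \<theta>]]
      by (simp add: tensor_test_function(2,3)[OF w \<theta>] QT_def)
    also have "\<dots> = (LINT p|?M. \<phi> p * (w m (fst p) * deriv (deriv \<theta>) (snd p)) - \<phi> p * (deriv (deriv (w m)) (fst p) * \<theta> (snd p)))"
      by (simp add: right_diff_distrib)
    also have "\<dots> = (LINT t|lebesgue_on {0<..<T}. A m t * deriv (deriv \<theta>) t) - (LINT t|lebesgue_on {0<..<T}. C m t * \<theta> t)"
      using i1 i2 by (simp add: A_def C_def)
    finally show ?thesis by simp
  qed
  have Alim: "(\<lambda>m. A m t) \<longlonglongrightarrow> a t" if t: "t \<in> {0..T}" for t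
  proof -
    have "integrable (lebesgue_on Omega) (\<lambda>x. \<phi> (x, t) * sin (k * x))"
      by (intro L2_mult_integrable smooth_L2_Omega ss H1_L2 H10_H1 H t)
    from cutoff_integral_limit[OF this] show ?thesis
      by (simp add: A_def a_def w_def mult_ac)
  qed
  have Ab: "\<bar>A m t\<bar> \<le> B" if t: "t \<in> {0..T}" for m t
  proof -
    have "\<bar>A m t\<bar> \<le> L2_norm Omega (\<lambda>x. \<phi> (x, t)) * 1"
      unfolding A_def
    proof (rule L2_integral_bounded)
      show "\<bar>w m x\<bar> \<le> 1" for x
        using cutoff_range[of m x] by (auto simp: w_def abs_mult intro!: mult_le_one)
    qed (auto intro!: H1_L2 H10_H1 H t continuous_measurable_Omega cont[OF w])
    then show ?thesis using B t by force
  qed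
  have dw: "deriv (w m) x = cutoff' m x * sin (k * x) + cutoff m x * (k * cos (k * x))" for m x
    unfolding w_def by (rule DERIV_imp_deriv) (auto intro!: derivative_eq_intros cutoff_deriv)
  \<comment> \<open>The bound splits into \<open>6 * k\<close> from the slope of the cutoff and
    \<open>k\<close> from the derivative of the sine.\<close>
  have dwb: "\<bar>deriv (w m) x\<bar> \<le> 7 * k" if x: "x \<in> Omega" for m x
  proof -
    have s1: "\<bar>sin (k * x)\<bar> \<le> k * x" using abs_sin_x_le_abs_x[of "k * x"] k0 x by simp
    \<comment> \<open>As \<open>k\<close> is an integer multiple of \<open>pi\<close>, reflecting
      \<open>x\<close> to \<open>1 - x\<close> changes at most the sign; the sine is thus also small
      near the right endpoint.\<close>
    have "sin (k * x) = - (cos (real n * pi) * sin (k * (1 - x)))"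
      by (simp add: right_diff_distrib sin_diff k_def[symmetric]) (simp add: k_def cos_npi power2_eq_square[symmetric] power_mult[symmetric])
    then have "\<bar>sin (k * x)\<bar> = \<bar>sin (k * (1 - x))\<bar>" by (simp add: cos_npi abs_mult power_abs)
    also have "\<dots> \<le> k * (1 - x)" using abs_sin_x_le_abs_x[of "k * (1 - x)"] k0 x by simp
    finally have "\<bar>cutoff' m x * sin (k * x)\<bar> \<le> 6 * k" by (intro cutoff'_bound s1 k0)
    moreover have "\<bar>cutoff m x * (k * cos (k * x))\<bar> \<le> 1 * (k * 1)"
      unfolding abs_mult using cutoff_range[of m x] k0 by (intro mult_mono) auto
    ultimately show ?thesis unfolding dw by linarith
  qed
  have Ceq: "C m t = - (LINT x|lebesgue_on Omega. weak_deriv (\<lambda>x. \<phi> (x, t)) x * deriv (w m) x)" if t: "t \<in> {0..T}" for m t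
    using weak_deriv(2)[OF H10_H1[OF H[OF t]]] w'[of m] by (simp add: has_weak_deriv_def C_def)
  have Cb: "\<bar>C m t\<bar> \<le> B' * (7 * k)" if t: "t \<in> {0..T}" for m t
  proof -
    have "\<bar>C m t\<bar> \<le> L2_norm Omega (weak_deriv (\<lambda>x. \<phi> (x, t))) * (7 * k)"
      unfolding Ceq[OF t] abs_minus_cancel
      by (rule L2_integral_bounded) (auto intro!: weak_deriv(1) H10_H1 H t continuous_measurable_Omega cont[OF w'] dwb k0)
    also have "\<dots> \<le> B' * (7 * k)" using B' t k0 by (intro mult_right_mono) auto
    finally show ?thesis .
  qed
  \<comment> \<open>In the limit the weak derivative is paired with \<open>k * cos (k * x)\<close>;
    integrating by parts once more, now without cutoff, produces the second factor
    \<open>k\<close>.\<close>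
  have Clim: "(\<lambda>m. C m t) \<longlonglongrightarrow> - k\<^sup>2 * a t" if t: "t \<in> {0..T}" for t
  proof -
    let ?g = "weak_deriv (\<lambda>x. \<phi> (x, t))"
    have g: "?g \<in> L2 Omega" by (intro weak_deriv(1) H10_H1 H t)
    have "(\<lambda>m. LINT x|lebesgue_on Omega. ?g x * deriv (w m) x) \<longlonglongrightarrow> (LINT x|lebesgue_on Omega. ?g x * (k * cos (k * x)))"
    proof (rule integral_dominated_convergence[where w="\<lambda>x. \<bar>?g x\<bar> * (7 * k)"])
      show "AE x in lebesgue_on Omega. (\<lambda>m. ?g x * deriv (w m) x) \<longlonglongrightarrow> ?g x * (k * cos (k * x))"
      proof (rule AE_I2)
        fix x assume "x \<in> space (lebesgue_on Omega)"
        then have x: "x \<in> {0<..<1}" by simp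
        have "(\<lambda>m. ?g x * (cutoff' m x * sin (k * x) + cutoff m x * (k * cos (k * x))))
          \<longlonglongrightarrow> ?g x * (0 * sin (k * x) + 1 * (k * cos (k * x)))"
          by (intro tendsto_intros cutoff_tendsto_1 cutoff'_tendsto_0 x)
        then show "(\<lambda>m. ?g x * deriv (w m) x) \<longlonglongrightarrow> ?g x * (k * cos (k * x))" by (simp add: dw)
      qed
      show "AE x in lebesgue_on Omega. norm (?g x * deriv (w m) x) \<le> \<bar>?g x\<bar> * (7 * k)" for m
        using dwb by (intro AE_I2) (auto simp: abs_mult intro!: mult_left_mono)
      show "integrable (lebesgue_on Omega) (\<lambda>x. \<bar>?g x\<bar> * (7 * k))"
        using L2_Omega_integrable[OF g] by auto
      show "(\<lambda>x. ?g x * (k * cos (k * x))) \<in> borel_measurable (lebesgue_on Omega)"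
        by (intro borel_measurable_times L2_measurable[OF g] continuous_measurable_Omega continuous_intros)
      show "(\<lambda>x. ?g x * deriv (w m) x) \<in> borel_measurable (lebesgue_on Omega)" for m
        by (intro borel_measurable_times L2_measurable[OF g] continuous_measurable_Omega cont[OF w'])
    qed
    moreover have "(LINT x|lebesgue_on Omega. ?g x * (k * cos (k * x))) = k * (LINT x|lebesgue_on Omega. ?g x * cos (k * x))"
      by (simp add: mult.left_commute)
    moreover have "\<dots> = k\<^sup>2 * a t"
      by (simp add: H10_sine_coefficient[OF H[OF t]] a_def power2_eq_square)
    ultimately show ?thesis by (simp add: Ceq[OF t] tendsto_minus)
  qed
  have int: "integrable (lebesgue_on {0<..<T}) f" if "continuous_on {0..T} f" for f :: "real \<Rightarrow> real"
    by (rule continuous_integrable_Ioo[OF that])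
  have lim: "(\<lambda>m. LINT t|lebesgue_on {0<..<T}. F m t * g t) \<longlonglongrightarrow> (LINT t|lebesgue_on {0<..<T}. f t * g t)"
    if F: "\<And>m. continuous_on {0..T} (F m)" and f: "continuous_on {0..T} f" and g: "continuous_on UNIV g"
      and b: "\<And>m t. t \<in> {0..T} \<Longrightarrow> \<bar>F m t\<bar> \<le> K" and l: "\<And>t. t \<in> {0..T} \<Longrightarrow> (\<lambda>m. F m t) \<longlonglongrightarrow> f t"
    for F f g and K :: real
  proof (rule integral_dominated_convergence[where w="\<lambda>t. K * \<bar>g t\<bar>"])
    have gT: "continuous_on {0..T} g" using g continuous_on_subset by blast
    show "integrable (lebesgue_on {0<..<T}) (\<lambda>t. K * \<bar>g t\<bar>)" by (intro int continuous_intros gT)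
    show "(\<lambda>t. f t * g t) \<in> borel_measurable (lebesgue_on {0<..<T})" 
      by (intro borel_measurable_integrable int continuous_intros gT f)
    show "(\<lambda>t. F m t * g t) \<in> borel_measurable (lebesgue_on {0<..<T})" for m
      by (intro borel_measurable_integrable int continuous_intros gT F)
    show "AE t in lebesgue_on {0<..<T}. (\<lambda>m. F m t * g t) \<longlonglongrightarrow> f t * g t"
      using l by (intro AE_I2 tendsto_mult tendsto_const) auto
    show "AE t in lebesgue_on {0<..<T}. norm (F m t * g t) \<le> K * \<bar>g t\<bar>" for m
      using b by (intro AE_I2) (auto simp: abs_mult intro!: mult_right_mono)
  qed
  have "(\<lambda>m. LINT t|lebesgue_on {0<..<T}. A m t * deriv (deriv \<theta>) t) \<longlonglongrightarrow> (LINT t|lebesgue_on {0<..<T}. a t * deriv (deriv \<theta>) t)"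
    by (rule lim[OF Ac ac cont[OF \<theta>''] Ab Alim])
  moreover have "(\<lambda>m. LINT t|lebesgue_on {0<..<T}. C m t * \<theta> t) \<longlonglongrightarrow> (LINT t|lebesgue_on {0<..<T}. - k\<^sup>2 * a t * \<theta> t)"
    by (rule lim[OF Cc _ cont[OF \<theta>] Cb Clim]) (intro continuous_intros ac)
  ultimately have "(LINT t|lebesgue_on {0<..<T}. a t * deriv (deriv \<theta>) t) = (LINT t|lebesgue_on {0<..<T}. - k\<^sup>2 * a t * \<theta> t)"
    unfolding AC by (rule LIMSEQ_unique)
  also have "\<dots> = - k\<^sup>2 * (LINT t|lebesgue_on {0<..<T}. a t * \<theta> t)" by (simp add: mult.assoc)
  finally show ?thesis .
qed

text \<open>The term \<open>k * a 0\<close> of the oscillator is rewritten as a cosine coefficient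
  of the derivative of \<open>\<phi>0\<close>, the form in which the data enter the d'Alembert
  profile.\<close>

lemma wave_velocity_coefficient:
  fixes n :: nat
  assumes sol: "wave_solution T (\<phi>0, \<phi>1) \<phi> \<phi>t" and \<phi>0: "\<phi>0 \<in> H10" and \<phi>1: "\<phi>1 \<in> L2 Omega"
    and t: "0 < t" "t < T"
  defines "k \<equiv> real n * pi"
  shows "(LINT x|lebesgue_on Omega. \<phi>t (x, t) * sin (k * x))
     = (LINT x|lebesgue_on Omega. \<phi>1 x * sin (k * x)) * cos (k * t)
       - (LINT x|lebesgue_on Omega. weak_deriv \<phi>0 x * cos (k * x)) * sin (k * t)"
proof -
  have curve: "continuous_curve H10 H1_norm T \<phi>" and curve': "continuous_curve (L2 Omega) (L2_norm Omega) T \<phi>t"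
    and d: "L2_curve_deriv T \<phi> \<phi>t" and i0: "AE x in lebesgue_on Omega. \<phi> (x, 0) = \<phi>0 x"
    and i1: "AE x in lebesgue_on Omega. \<phi>t (x, 0) = \<phi>1 x"
    using sol by (auto simp: wave_solution_def)
  have s: "(\<lambda>x. sin (k * x)) \<in> L2 Omega" using smooth_L2_Omega[OF smooth_sin[of k 0]] by simp
  note L2c = continuous_curve_L2[OF curve]
  define a where "a t = (LINT x|lebesgue_on Omega. \<phi> (x, t) * sin (k * x))" for t
  define b where "b t = (LINT x|lebesgue_on Omega. \<phi>t (x, t) * sin (k * x))" for t
  have "b t = b 0 * cos (k * t) - k * a 0 * sin (k * t)"
  proof (rule weak_oscillator[where T=T])
    show "(a has_real_derivative b t) (at t within {0..T})" if "t \<in> {0..T}" for t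
      unfolding a_def b_def by (rule L2_curve_deriv_coefficient[OF L2c curve' d s that])
    show "continuous_on {0..T} b" unfolding b_def by (rule L2_curve(2)[OF curve' s])
    show "(LINT t|lebesgue_on {0<..<T}. a t * deriv (deriv \<theta>) t) = - k\<^sup>2 * (LINT t|lebesgue_on {0<..<T}. a t * \<theta> t)"
      if "\<theta> \<in> test_functions {0<..<T}" for \<theta>
      unfolding a_def k_def by (rule wave_weak_coefficient[OF sol that])
  qed (use t in auto)
  moreover have m: "(\<lambda>x. \<phi> (x, 0)) \<in> L2 Omega" "(\<lambda>x. \<phi>t (x, 0)) \<in> L2 Omega"
    using L2c curve' t by (auto simp: continuous_curve_def)
  have int: "f \<in> L2 Omega \<Longrightarrow> (\<lambda>x. f x * sin (k * x)) \<in> borel_measurable (lebesgue_on Omega)" for f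
    by (intro borel_measurable_times L2_measurable s)
  have "b 0 = (LINT x|lebesgue_on Omega. \<phi>1 x * sin (k * x))"
    unfolding b_def by (rule integral_cong_AE) (use i1 in \<open>auto intro!: int m \<phi>1 elim!: eventually_mono\<close>)
  moreover have "a 0 = (LINT x|lebesgue_on Omega. \<phi>0 x * sin (k * x))"
    unfolding a_def by (rule integral_cong_AE) (use i0 in \<open>auto intro!: int m H1_L2 H10_H1 \<phi>0 elim!: eventually_mono\<close>)
  ultimately show ?thesis using H10_sine_coefficient[OF \<phi>0, of k] by (simp add: b_def)
qed

section \<open>Oscillation and geometric optics\<close>

text \<open>For square integrable \<open>f\<close> and \<open>I = J\<close> of finite measure this
  is twice the measure of \<open>I\<close> times the integral of the squared deviation of
  \<open>f\<close> from its mean on \<open>I\<close>. Extended nonnegative values avoid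
  integrability conditions in the estimates.\<close>

definition osc :: "(real \<Rightarrow> real) \<Rightarrow> real set \<Rightarrow> real set \<Rightarrow> ennreal" where
  "osc f I J = (\<integral>\<^sup>+x. \<integral>\<^sup>+y. ennreal ((f x - f y)\<^sup>2) * indicator I x * indicator J y \<partial>lborel \<partial>lborel)"

text \<open>The recursion records one step of the chain of intervals: 9 multiplies the oscillation
  already controlled, \<open>4 * n + 1\<close> that of the new interval, which is at most 8 times
  the observation.\<close>

primrec chain_const :: "nat \<Rightarrow> nat" where
  "chain_const 0 = 0"
| "chain_const (Suc n) = 9 * chain_const n + (4 * n + 1) * 8"

context
  fixes f :: "real \<Rightarrow> real"
  assumes f[measurable]: "f \<in> borel_measurable borel"
begin

lemma osc_commute:
  assumes [measurable]: "I \<in> sets borel" "J \<in> sets borel"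
  shows "osc f I J = osc f J I"
proof -
  have "osc f I J = (\<integral>\<^sup>+y. \<integral>\<^sup>+x. ennreal ((f x - f y)\<^sup>2) * indicator I x * indicator J y \<partial>lborel \<partial>lborel)"
    unfolding osc_def by (rule lborel_pair.Fubini') measurable
  also have "\<dots> = osc f J I"
    unfolding osc_def by (simp add: power2_commute mult_ac)
  finally show ?thesis .
qed

lemma osc_mono: "I \<subseteq> I' \<Longrightarrow> J \<subseteq> J' \<Longrightarrow> osc f I J \<le> osc f I' J'"
  unfolding osc_def by (intro nn_integral_mono mult_mono) (auto simp: indicator_def)

lemma osc_Un_le:
  assumes [measurable]: "A \<in> sets borel" "B \<in> sets borel"
  shows "osc f (A \<union> B) (A \<union> B) \<le> osc f A A + 2 * osc f A B + osc f B B"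
proof -
  have "osc f (A \<union> B) (A \<union> B) \<le> (\<integral>\<^sup>+x. \<integral>\<^sup>+y. 
      (ennreal ((f x - f y)\<^sup>2) * indicator A x * indicator A y + ennreal ((f x - f y)\<^sup>2) * indicator A x * indicator B y)
    + (ennreal ((f x - f y)\<^sup>2) * indicator B x * indicator A y + ennreal ((f x - f y)\<^sup>2) * indicator B x * indicator B y)
     \<partial>lborel \<partial>lborel)"
    unfolding osc_def by (intro nn_integral_mono) (auto simp: indicator_def)
  also have "\<dots> = (osc f A A + osc f A B) + (osc f B A + osc f B B)"
    unfolding osc_def by (simp add: nn_integral_add)
  also have "\<dots> = osc f A A + 2 * osc f A B + osc f B B"
    using osc_commute[OF assms(2,1)] by (simp add: algebra_simps mult_2)
  finally show ?thesis .
qed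

text \<open>Integrate \<open>(f x - f y)\<^sup>2 \<le> 2 (f x - f z)\<^sup>2 + 2 (f z - f y)\<^sup>2\<close> over \<open>I \<times> J \<times> K\<close>.\<close>

lemma osc_triangle:
  assumes [measurable]: "I \<in> sets borel" "J \<in> sets borel" "K \<in> sets borel"
  shows "emeasure lborel K * osc f I J \<le> 2 * emeasure lborel J * osc f I K + 2 * emeasure lborel I * osc f K J"
proof -
  let ?d = "\<lambda>x y. ennreal ((f x - f y)\<^sup>2)"
  have tri: "?d x y \<le> 2 * ?d x z + 2 * ?d z y" for x y z
  proof -
    have "(f x - f y)\<^sup>2 \<le> 2 * (f x - f z)\<^sup>2 + 2 * (f z - f y)\<^sup>2"
      using zero_le_power2[of "(f x - f z) - (f z - f y)"] by (simp add: power2_eq_square algebra_simps)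
    then have "?d x y \<le> ennreal (2 * (f x - f z)\<^sup>2 + 2 * (f z - f y)\<^sup>2)" by (rule ennreal_leI)
    then show ?thesis by (simp add: ennreal_mult)
  qed
  have "emeasure lborel K * osc f I J
     = (\<integral>\<^sup>+x. \<integral>\<^sup>+y. \<integral>\<^sup>+z. ?d x y * indicator I x * indicator J y * indicator K z \<partial>lborel \<partial>lborel \<partial>lborel)"
    unfolding osc_def by (simp add: nn_integral_cmult nn_integral_multc mult.commute)
  also have "\<dots> \<le> (\<integral>\<^sup>+x. \<integral>\<^sup>+y. \<integral>\<^sup>+z. (2 * indicator J y) * (?d x z * indicator I x * indicator K z) 
      + (2 * indicator I x) * (?d z y * indicator K z * indicator J y) \<partial>lborel \<partial>lborel \<partial>lborel)"
    using tri by (intro nn_integral_mono) (auto simp: indicator_def)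
  also have "\<dots> = (\<integral>\<^sup>+x. \<integral>\<^sup>+y. (2 * indicator J y) * (\<integral>\<^sup>+z. ?d x z * indicator I x * indicator K z \<partial>lborel) 
      + (2 * indicator I x) * (\<integral>\<^sup>+z. ?d z y * indicator K z * indicator J y \<partial>lborel) \<partial>lborel \<partial>lborel)"
    by (simp add: nn_integral_add nn_integral_cmult)
  also have "\<dots> = (\<integral>\<^sup>+x. (\<integral>\<^sup>+y. 2 * indicator J y \<partial>lborel) * (\<integral>\<^sup>+z. ?d x z * indicator I x * indicator K z \<partial>lborel) 
      + (2 * indicator I x) * (\<integral>\<^sup>+y. \<integral>\<^sup>+z. ?d z y * indicator K z * indicator J y \<partial>lborel \<partial>lborel) \<partial>lborel)"
    by (simp add: nn_integral_add nn_integral_cmult nn_integral_multc)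
  also have "\<dots> = (2 * emeasure lborel J) * osc f I K
      + (2 * emeasure lborel I) * (\<integral>\<^sup>+y. \<integral>\<^sup>+z. ?d z y * indicator K z * indicator J y \<partial>lborel \<partial>lborel)"
    unfolding osc_def by (simp add: nn_integral_add nn_integral_cmult nn_integral_multc)
  also have "(\<integral>\<^sup>+y. \<integral>\<^sup>+z. ?d z y * indicator K z * indicator J y \<partial>lborel \<partial>lborel) = osc f K J"
    unfolding osc_def by (rule lborel_pair.Fubini'[symmetric]) measurable
  finally show ?thesis .
qed

text \<open>Each step extends \<open>A\<close> by \<open>\<epsilon>\<close>, using an interval
  \<open>B\<close> centred at the right end of \<open>A\<close>. The left half of \<open>B\<close>
  lies in \<open>A\<close> and carries the comparison. The half-open \<open>A\<close> omits only its
  right end \<open>a\<close>, which \<open>B\<close> contains.\<close>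

lemma osc_chain:
  assumes \<epsilon>: "\<epsilon> > 0" and E: "\<And>a. osc f {a - \<epsilon><..<a + \<epsilon>} {a - \<epsilon><..<a + \<epsilon>} \<le> 8 * E"
  shows "osc f {b..<b + real n * \<epsilon>} {b..<b + real n * \<epsilon>} \<le> of_nat (chain_const n) * E"
proof (induction n)
  case 0
  then show ?case by (simp add: osc_def)
next
  case (Suc n)
  define A where "A = {b..<b + real n * \<epsilon>}"
  define a where "a = b + real n * \<epsilon>"
  define B where "B = {a - \<epsilon><..<a + \<epsilon>}"
  have [measurable]: "A \<in> sets borel" "B \<in> sets borel" by (auto simp: A_def B_def)
  have mA: "emeasure lborel A = ennreal (real n * \<epsilon>)" and mB: "emeasure lborel B = ennreal (2 * \<epsilon>)"
    using \<epsilon> by (auto simp: A_def B_def)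
  have BB: "osc f B B \<le> 8 * E" unfolding B_def by (rule E)
  have AA: "osc f A A \<le> of_nat (chain_const n) * E" using Suc.IH by (simp add: A_def)
  \<comment> \<open>The coefficients are twice the ratios of measures: \<open>B\<close> is twice as
    long as the overlap \<open>K\<close>, and \<open>A\<close> is \<open>n\<close> times as long.
    For \<open>n = 0\<close> there is no overlap, but \<open>A\<close> is empty.\<close>
  have AB: "osc f A B \<le> 4 * osc f A A + 2 * of_nat n * osc f B B"
  proof (cases "n = 0")
    case True
    then show ?thesis by (simp add: A_def osc_def)
  next
    case False
    define K where "K = {a - \<epsilon><..<a}"
    have [measurable]: "K \<in> sets borel" by (simp add: K_def)
    have "real n \<ge> 1" using False by simp
    then have "\<epsilon> \<le> real n * \<epsilon>" using \<epsilon> mult_right_mono[of 1 "real n" \<epsilon>] by simp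
    then have "b \<le> a - \<epsilon>" by (simp add: a_def)
    moreover have "A = {b..<a}" by (simp add: A_def a_def)
    ultimately have K: "K \<subseteq> A" "K \<subseteq> B" using \<epsilon> by (auto simp: K_def B_def)
    have mK: "emeasure lborel K = ennreal \<epsilon>" using \<epsilon> by (simp add: K_def)
    have "ennreal \<epsilon> * osc f A B \<le> 2 * ennreal (2 * \<epsilon>) * osc f A K + 2 * ennreal (real n * \<epsilon>) * osc f K B"
      using osc_triangle[of A B K] by (simp add: mA mB mK)
    also have "\<dots> \<le> 2 * ennreal (2 * \<epsilon>) * osc f A A + 2 * ennreal (real n * \<epsilon>) * osc f B B"
      using K by (intro add_mono mult_left_mono osc_mono) auto
    also have "\<dots> = ennreal \<epsilon> * (4 * osc f A A + 2 * of_nat n * osc f B B)"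
      using \<epsilon> by (simp add: ennreal_mult ennreal_of_nat_eq_real_of_nat algebra_simps)
    finally show ?thesis using \<epsilon> by (simp add: ennreal_mult_le_mult_iff)
  qed
  have "osc f {b..<b + real (Suc n) * \<epsilon>} {b..<b + real (Suc n) * \<epsilon>} \<le> osc f (A \<union> B) (A \<union> B)"
    using \<epsilon> by (intro osc_mono) (auto simp: A_def B_def a_def algebra_simps)
  also have "\<dots> \<le> osc f A A + 2 * osc f A B + osc f B B" by (rule osc_Un_le) measurable
  also have "\<dots> \<le> osc f A A + 2 * (4 * osc f A A + 2 * of_nat n * osc f B B) + osc f B B"
    by (intro add_mono mult_left_mono AB) auto
  also have "\<dots> = 9 * osc f A A + (4 * of_nat n + 1) * osc f B B"
  proof -
    have "(9::ennreal) = 1 + 2 * 4" by simp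
    then have "9 * osc f A A = osc f A A + 2 * (4 * osc f A A)" by (simp only: distrib_right mult.assoc mult_1)
    then show ?thesis by (simp add: algebra_simps)
  qed
  also have "\<dots> \<le> 9 * (of_nat (chain_const n) * E) + (4 * of_nat n + 1) * (8 * E)"
    by (intro add_mono mult_left_mono AA BB) auto
  also have "\<dots> = of_nat (chain_const (Suc n)) * E"
    by (simp add: algebra_simps)
  finally show ?case .
qed

end

section \<open>Rays and boxes in characteristic coordinates\<close>

lemma nn_integral_characteristic_coordinates:
  fixes H :: "real \<times> real \<Rightarrow> ennreal"
  assumes [measurable]: "H \<in> borel_measurable borel"
  shows "2 * (\<integral>\<^sup>+p. H (snd p + fst p, snd p - fst p) \<partial>lborel) = (\<integral>\<^sup>+x. \<integral>\<^sup>+y. H (x, y) \<partial>lborel \<partial>lborel)"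
proof -
  have H[measurable]: "H \<in> borel_measurable (borel \<Otimes>\<^sub>M borel)" using assms by (simp add: borel_prod)
  have "(\<integral>\<^sup>+p. H (snd p + fst p, snd p - fst p) \<partial>lborel) = (\<integral>\<^sup>+p. H (snd p + fst p, snd p - fst p) \<partial>(lborel \<Otimes>\<^sub>M lborel))"
    by (simp add: lborel_prod)
  also have "\<dots> = (\<integral>\<^sup>+x. \<integral>\<^sup>+t. H (t + x, t - x) \<partial>lborel \<partial>lborel)"
    using lborel.nn_integral_fst[of "\<lambda>p. H (snd p + fst p, snd p - fst p)" lborel] by simp
  \<comment> \<open>The plane substitution is split into two one-dimensional ones: first
    \<open>s = t + x\<close> at fixed \<open>x\<close>, then \<open>y = s - 2 * x\<close> at fixed
    \<open>s\<close>. The second one yields the Jacobian 2.\<close>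
  also have "\<dots> = (\<integral>\<^sup>+x. \<integral>\<^sup>+s. H (s, s - 2 * x) \<partial>lborel \<partial>lborel)"
  proof (rule nn_integral_cong)
    fix x :: real
    show "(\<integral>\<^sup>+t. H (t + x, t - x) \<partial>lborel) = (\<integral>\<^sup>+s. H (s, s - 2 * x) \<partial>lborel)"
      by (subst nn_integral_real_affine[of _ 1 "-x"]) (simp_all add: algebra_simps)
  qed
  also have "\<dots> = (\<integral>\<^sup>+s. \<integral>\<^sup>+x. H (s, s - 2 * x) \<partial>lborel \<partial>lborel)"
    by (rule lborel_pair.Fubini'[symmetric]) measurable
  finally have *: "(\<integral>\<^sup>+p. H (snd p + fst p, snd p - fst p) \<partial>lborel) = (\<integral>\<^sup>+s. \<integral>\<^sup>+x. H (s, s - 2 * x) \<partial>lborel \<partial>lborel)" .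
  have "(\<integral>\<^sup>+y. H (s, y) \<partial>lborel) = 2 * (\<integral>\<^sup>+x. H (s, s - 2 * x) \<partial>lborel)" for s
    by (subst nn_integral_real_affine[of _ "-2" s]) (simp_all add: algebra_simps)
  then show ?thesis unfolding * by (simp add: nn_integral_cmult)
qed

text \<open>A ball is connected, so if it met both \<open>q\<close> and its complement it would
  contain a frontier point, at distance less than \<open>\<epsilon>\<close> from its centre.\<close>

lemma ball_subset_of_infdist_frontier:
  fixes q :: "'a::euclidean_space set"
  assumes q: "bounded q" and p: "p \<in> q" "infdist p (frontier q) > \<epsilon>"
  shows "ball p \<epsilon> \<subseteq> q"
proof (rule ccontr)
  assume n: "\<not> ball p \<epsilon> \<subseteq> q"
  then have e: "\<epsilon> > 0" by (metis ball_eq_empty empty_subsetI not_le)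
  have "p \<in> ball p \<epsilon> \<inter> q" using e p by simp
  then have "ball p \<epsilon> \<inter> q \<noteq> {}" by blast
  then obtain y where "y \<in> ball p \<epsilon>" "y \<in> frontier q"
    using connected_Int_frontier[OF connected_ball, of p \<epsilon> q] n by blast
  then have "infdist p (frontier q) \<le> dist p y" by (intro infdist_le)
  with \<open>y \<in> ball p \<epsilon>\<close> p show False by simp
qed

text \<open>The even integers form a closed set, so the distance is attained; the two cases tell on
  which side of the nearest one \<open>s\<close> lies.\<close>

lemma fold_unit_cases:
  obtains k :: int where "s = 2 * of_int k + fold_unit s" | k :: int where "s = 2 * of_int k - fold_unit s"
proof -
  have "range (\<lambda>k::int. 2 * of_int k :: real) = (\<lambda>x. 2 *\<^sub>R x) ` \<int>"
    by (auto simp: Ints_def image_image)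
  moreover have "closed ((\<lambda>x::real. 2 *\<^sub>R x) ` \<int>)" by (rule closed_scaling) (rule closed_Ints)
  ultimately obtain x where "x \<in> range (\<lambda>k::int. 2 * of_int k :: real)" "fold_unit s = dist s x"
    unfolding fold_unit_def using infdist_attains_inf[of "range (\<lambda>k::int. 2 * of_int k :: real)" s] by auto
  then obtain k :: int where "fold_unit s = \<bar>s - 2 * of_int k\<bar>" by (auto simp: dist_real_def)
  then show thesis using that by (cases "s \<ge> 2 * of_int k") force+
qed

text \<open>A ray is a class of \<open>t + x\<close> and \<open>t - x\<close> modulo 2, so a set that meets all rays contains, for each
  real number \<open>a\<close>, a point with a characteristic coordinate congruent to \<open>a\<close>.\<close>

lemma geometric_optics_characteristic:
  assumes "geometric_optics T q"
  obtains x t :: real and k :: int where "(x, t) \<in> q" "a = t + x + 2 * of_int k \<or> a = t - x + 2 * of_int k"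
proof -
  define m where "m = \<lfloor>(a + 1) / 2\<rfloor>"
  define b where "b = a - 2 * of_int m"
  have "of_int m \<le> (a + 1) / 2" "(a + 1) / 2 < of_int m + 1" unfolding m_def by linarith+
  then have b: "-1 \<le> b" "b \<le> 1" by (auto simp: b_def)
  \<comment> \<open>With this sign, \<open>\<bar>b\<bar> + \<sigma> * t\<close> is
    \<open>b - t\<close> up to sign. The folded position is therefore the distance from
    \<open>b - t\<close> to the even integers, which links \<open>b\<close> to \<open>t + x\<close>
    or \<open>t - x\<close> modulo 2.\<close>
  define \<sigma> :: real where "\<sigma> = (if b \<ge> 0 then -1 else 1)"
  have s: "\<sigma> \<in> {1, -1}" "\<bar>b\<bar> = - \<sigma> * b" by (auto simp: \<sigma>_def)
  have "\<bar>b\<bar> \<in> {0..1}" using b by auto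
  then obtain t where "(fold_unit (\<bar>b\<bar> + \<sigma> * t), t) \<in> q"
    using assms s(1) unfolding geometric_optics_def by meson
  moreover have "\<exists>k::int. a = t + fold_unit (\<bar>b\<bar> + \<sigma> * t) + 2 * of_int k \<or> a = t - fold_unit (\<bar>b\<bar> + \<sigma> * t) + 2 * of_int k"
  proof (cases "\<bar>b\<bar> + \<sigma> * t" rule: fold_unit_cases)
    case (1 k)
    then show ?thesis
      by (cases "b \<ge> 0") (auto simp: \<sigma>_def b_def intro: exI[of _ "m + k"] exI[of _ "m - k"])
  next
    case (2 k)
    then show ?thesis
      by (cases "b \<ge> 0") (auto simp: \<sigma>_def b_def intro: exI[of _ "m + k"] exI[of _ "m - k"])
  qed
  ultimately show thesis using that by blast
qed

lemma periodic_int: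
  fixes f :: "real \<Rightarrow> 'a"
  assumes "\<And>s. f (s + 2) = f s"
  shows "f (s + 2 * of_int k) = f s"
proof (induction k rule: int_induct[where k=0])
  case base show ?case by simp
next
  case (step1 i)
  then show ?case using assms[of "s + 2 * of_int i"] by (simp add: algebra_simps)
next
  case (step2 i)
  then show ?case using assms[of "s + 2 * of_int (i - 1)"] by (simp add: algebra_simps)
qed

lemma osc_shift:
  assumes [measurable]: "f \<in> borel_measurable borel" and per: "\<And>s. f (s + 2) = f s"
    and [measurable]: "J \<in> sets borel"
  shows "osc f {a + 2 * of_int k - \<epsilon><..<a + 2 * of_int k + \<epsilon>} J = osc f {a - \<epsilon><..<a + \<epsilon>} J"
proof -
  have "f (2 * of_int k + x) = f x" for x
    using periodic_int[of f x k] per by (simp add: add.commute)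
  moreover have "indicator {a + 2 * of_int k - \<epsilon><..<a + 2 * of_int k + \<epsilon>} (2 * of_int k + x) 
      = (indicator {a - \<epsilon><..<a + \<epsilon>} x :: ennreal)" for x
    by (auto simp: indicator_def)
  ultimately show ?thesis
    unfolding osc_def by (subst nn_integral_real_affine[of _ 1 "2 * of_int k"]) simp_all
qed

text \<open>Characteristic coordinates are a rotation composed with a dilation by the square root of
  2. The preimage of a square of half-side \<open>\<epsilon>\<close> thus fits into the ball of
  radius \<open>\<epsilon>\<close>; the factor 2 is the Jacobian.\<close>

lemma osc_characteristic_box:
  assumes f[measurable]: "f \<in> borel_measurable borel" and q[measurable]: "q \<in> sets borel"
    and b: "ball (x, t) \<epsilon> \<subseteq> q"
  shows "osc f {t + x - \<epsilon><..<t + x + \<epsilon>} {t - x - \<epsilon><..<t - x + \<epsilon>}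
     \<le> 2 * (\<integral>\<^sup>+p. ennreal ((f (snd p + fst p) - f (snd p - fst p))\<^sup>2) * indicator q p \<partial>lborel)"
proof -
  let ?I = "{t + x - \<epsilon><..<t + x + \<epsilon>}" and ?J = "{t - x - \<epsilon><..<t - x + \<epsilon>}"
  define H where "H p = ennreal ((f (fst p) - f (snd p))\<^sup>2) * indicator ?I (fst p) * indicator ?J (snd p)" for p
  have [measurable]: "H \<in> borel_measurable (borel \<Otimes>\<^sub>M borel)" unfolding H_def[abs_def] by measurable
  then have "osc f ?I ?J = 2 * (\<integral>\<^sup>+p. H (snd p + fst p, snd p - fst p) \<partial>lborel)"
    by (subst nn_integral_characteristic_coordinates) (simp_all add: borel_prod osc_def H_def)
  also have "\<dots> \<le> 2 * (\<integral>\<^sup>+p. ennreal ((f (snd p + fst p) - f (snd p - fst p))\<^sup>2) * indicator q p \<partial>lborel)"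
  proof (intro mult_left_mono nn_integral_mono)
    fix p :: "real \<times> real"
    have "p \<in> q" if "snd p + fst p \<in> ?I" "snd p - fst p \<in> ?J"
    proof -
      define u v where "u = snd p + fst p - (t + x)" and "v = snd p - fst p - (t - x)"
      have uv: "\<bar>u\<bar> < \<epsilon>" "\<bar>v\<bar> < \<epsilon>" using that by (auto simp: u_def v_def)
      then have "u\<^sup>2 < \<epsilon>\<^sup>2" "v\<^sup>2 < \<epsilon>\<^sup>2" by (auto simp: abs_square_less_1 power2_strict_mono)
      moreover have "(fst p - x)\<^sup>2 + (snd p - t)\<^sup>2 = (u\<^sup>2 + v\<^sup>2) / 2"
        by (simp add: u_def v_def power2_eq_square field_simps)
      ultimately have "sqrt ((fst p - x)\<^sup>2 + (snd p - t)\<^sup>2) < \<epsilon>"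
        using uv by (intro real_less_lsqrt) auto
      then have "p \<in> ball (x, t) \<epsilon>"
        by (cases p) (simp add: dist_Pair_Pair dist_real_def power2_commute)
      then show ?thesis using b by blast
    qed
    then show "H (snd p + fst p, snd p - fst p) \<le> ennreal ((f (snd p + fst p) - f (snd p - fst p))\<^sup>2) * indicator q p"
      by (auto simp: H_def indicator_def)
  qed simp
  finally show ?thesis .
qed

text \<open>Expanding the square and integrating in \<open>y\<close> over an interval of length 2,
  the cross term vanishes by the zero mean and the integral of \<open>(f y)^2\<close> is
  dropped.\<close>

lemma osc_lower_bound:
  assumes f[measurable]: "f \<in> borel_measurable borel"
    and i1: "set_integrable lborel {-1<..<1} f" and i2: "set_integrable lborel {-1<..<1} (\<lambda>s. (f s)\<^sup>2)"
    and mean: "(LINT s:{-1<..<1}|lborel. f s) = 0"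
  shows "2 * (\<integral>\<^sup>+s. ennreal ((f s)\<^sup>2) * indicator {-1<..<1} s \<partial>lborel) \<le> osc f {-1<..<1} {-1<..<1}"
proof -
  let ?S = "{-1<..<1::real}"
  have "ennreal (2 * (f x)\<^sup>2) \<le> (\<integral>\<^sup>+y. ennreal ((f x - f y)\<^sup>2) * indicator ?S y \<partial>lborel)" for x
  proof -
    have c: "set_integrable lborel ?S (\<lambda>y. (f x)\<^sup>2)" by (simp add: set_integrable_def)
    have d: "set_integrable lborel ?S (\<lambda>y. (f x)\<^sup>2 - 2 * f x * f y + (f y)\<^sup>2)"
      by (intro set_integral_add set_integral_diff c i2 set_integrable_mult_right i1) 
    have "2 * (f x)\<^sup>2 \<le> 2 * (f x)\<^sup>2 - 2 * f x * (LINT y:?S|lborel. f y) + (LINT y:?S|lborel. (f y)\<^sup>2)"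
      unfolding mean by (simp add: set_lebesgue_integral_def)
    also have "\<dots> = (LINT y:?S|lborel. (f x)\<^sup>2 - 2 * f x * f y + (f y)\<^sup>2)"
    proof -
      have "(LINT y:?S|lborel. (f x)\<^sup>2) = 2 * (f x)\<^sup>2" by (simp add: set_lebesgue_integral_def)
      moreover have "(LINT y:?S|lborel. 2 * f x * f y) = 2 * f x * (LINT y:?S|lborel. f y)" by simp
      moreover have "set_integrable lborel ?S (\<lambda>y. 2 * f x * f y)" by (intro set_integrable_mult_right i1)
      ultimately show ?thesis using c i2
        by (simp add: set_integral_add(2) set_integral_diff)
    qed
    finally have "ennreal (2 * (f x)\<^sup>2) \<le> ennreal (LINT y:?S|lborel. (f x)\<^sup>2 - 2 * f x * f y + (f y)\<^sup>2)"
      by (rule ennreal_leI)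
    also have "\<dots> = ennreal (LINT y|lborel. indicator ?S y * (f x - f y)\<^sup>2)"
      by (simp add: set_lebesgue_integral_def power2_diff algebra_simps)
    also have "\<dots> = (\<integral>\<^sup>+y. ennreal (indicator ?S y * (f x - f y)\<^sup>2) \<partial>lborel)"
    proof (rule nn_integral_eq_integral[symmetric])
      show "integrable lborel (\<lambda>y. indicator ?S y * (f x - f y)\<^sup>2)"
        using d by (simp add: set_integrable_def power2_diff algebra_simps)
    qed simp
    also have "\<dots> = (\<integral>\<^sup>+y. ennreal ((f x - f y)\<^sup>2) * indicator ?S y \<partial>lborel)"
      by (intro nn_integral_cong) (auto simp: indicator_def)
    finally show ?thesis .
  qed
  then have "(\<integral>\<^sup>+x. ennreal (2 * (f x)\<^sup>2) * indicator ?S x \<partial>lborel)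
      \<le> (\<integral>\<^sup>+x. (\<integral>\<^sup>+y. ennreal ((f x - f y)\<^sup>2) * indicator ?S y \<partial>lborel) * indicator ?S x \<partial>lborel)"
    by (intro nn_integral_mono mult_right_mono) auto
  also have "\<dots> = osc f ?S ?S"
    unfolding osc_def
  proof (rule nn_integral_cong)
    show "(\<integral>\<^sup>+y. ennreal ((f x - f y)\<^sup>2) * indicator ?S y \<partial>lborel) * indicator ?S x
      = (\<integral>\<^sup>+y. ennreal ((f x - f y)\<^sup>2) * indicator ?S x * indicator ?S y \<partial>lborel)" for x
      by (cases "x \<in> ?S") simp_all
  qed
  finally show ?thesis by (simp add: ennreal_mult nn_integral_cmult mult.assoc)
qed

text \<open>The point of \<open>q\<close> found on the ray of \<open>a\<close> comes with a box in characteristic coordinates, on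
  which \<open>f (t + x) - f (t - x)\<close> is a difference of independent variables; hence it controls the
  oscillation of \<open>f\<close> near \<open>a\<close>.\<close>

lemma observability_characteristic:
  assumes f[measurable]: "f \<in> borel_measurable borel" and per: "\<And>s. f (s + 2) = f s"
    and i1: "set_integrable lborel {-1<..<1} f" and i2: "set_integrable lborel {-1<..<1} (\<lambda>s. (f s)\<^sup>2)"
    and mean: "(LINT s:{-1<..<1}|lborel. f s) = 0"
    and \<epsilon>: "\<epsilon> > 0" and q: "q \<in> Q_ad T \<epsilon>" and n: "2 \<le> real n * \<epsilon>"
  shows "2 * (\<integral>\<^sup>+s. ennreal ((f s)\<^sup>2) * indicator {-1<..<1} s \<partial>lborel)
     \<le> of_nat (chain_const n) * (\<integral>\<^sup>+p. ennreal ((f (snd p + fst p) - f (snd p - fst p))\<^sup>2) * indicator q p \<partial>lborel)"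
proof -
  define E where "E = (\<integral>\<^sup>+p. ennreal ((f (snd p + fst p) - f (snd p - fst p))\<^sup>2) * indicator q p \<partial>lborel)"
  have "q \<subseteq> QT T" and go: "geometric_optics T (eps_interior \<epsilon> q)" and "open q"
    using q by (auto simp: Q_ad_def)
  have qm: "q \<in> sets borel" using \<open>open q\<close> by simp
  have "bounded (QT T)" unfolding QT_def by (intro bounded_Times) auto
  then have bq: "bounded q" using \<open>q \<subseteq> QT T\<close> bounded_subset by blast
  \<comment> \<open>The constant 8 is 4 times 2: the box costs 2 (Jacobian), and comparing
    \<open>I\<close> with itself through the partner interval costs 4, all interval lengths being
    equal.\<close>
  have loc: "osc f {a - \<epsilon><..<a + \<epsilon>} {a - \<epsilon><..<a + \<epsilon>} \<le> 8 * E" for a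
  proof -
    obtain x t and k :: int where xt: "(x, t) \<in> eps_interior \<epsilon> q"
      and a: "a = t + x + 2 * of_int k \<or> a = t - x + 2 * of_int k"
      using geometric_optics_characteristic[OF go] by metis
    have "ball (x, t) \<epsilon> \<subseteq> q"
      using xt ball_subset_of_infdist_frontier[OF bq] by (auto simp: eps_interior_def)
    note box = osc_characteristic_box[OF f qm this, folded E_def]
    define I where "I = {a - \<epsilon><..<a + \<epsilon>}"
    \<comment> \<open>The other characteristic coordinate of the observed point serves as
      \<open>c\<close>. Periodicity moves the coordinate congruent to \<open>a\<close> onto
      \<open>a\<close> itself.\<close>
    obtain c where c: "osc f I {c - \<epsilon><..<c + \<epsilon>} \<le> 2 * E"
      using a
    proof
      assume "a = t + x + 2 * of_int k"
      then have "osc f I {t - x - \<epsilon><..<t - x + \<epsilon>} \<le> 2 * E"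
        using box osc_shift[OF f per, of "{t - x - \<epsilon><..<t - x + \<epsilon>}" "t + x" k \<epsilon>] by (simp add: I_def)
      then show ?thesis by (rule that)
    next
      assume "a = t - x + 2 * of_int k"
      then have "osc f I {t + x - \<epsilon><..<t + x + \<epsilon>} \<le> 2 * E"
        using box osc_shift[OF f per, of "{t + x - \<epsilon><..<t + x + \<epsilon>}" "t - x" k \<epsilon>]
          osc_commute[OF f, of "{t + x - \<epsilon><..<t + x + \<epsilon>}" "{t - x - \<epsilon><..<t - x + \<epsilon>}"] by (simp add: I_def)
      then show ?thesis by (rule that)
    qed
    define J where "J = {c - \<epsilon><..<c + \<epsilon>}"
    have [measurable]: "I \<in> sets borel" "J \<in> sets borel" by (auto simp: I_def J_def)
    have m: "emeasure lborel I = ennreal (2 * \<epsilon>)" "emeasure lborel J = ennreal (2 * \<epsilon>)" using \<epsilon> by (auto simp: I_def J_def)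
    have "ennreal (2 * \<epsilon>) * osc f I I \<le> ennreal (2 * \<epsilon>) * (2 * osc f I J + 2 * osc f J I)"
      using osc_triangle[OF f, of I I J] by (simp add: m algebra_simps)
    then have "osc f I I \<le> 2 * osc f I J + 2 * osc f J I"
      using \<epsilon> by (simp add: ennreal_mult_le_mult_iff)
    also have "\<dots> = 4 * osc f I J" using osc_commute[OF f, of I J] by (simp add: distrib_right[symmetric])
    also have "\<dots> \<le> 4 * (2 * E)" using c by (intro mult_left_mono) (auto simp: J_def)
    finally show ?thesis by (simp add: I_def mult.assoc[symmetric])
  qed
  have "2 * (\<integral>\<^sup>+s. ennreal ((f s)\<^sup>2) * indicator {-1<..<1} s \<partial>lborel) \<le> osc f {-1<..<1} {-1<..<1}"
    by (rule osc_lower_bound[OF f i1 i2 mean])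
  also have "\<dots> \<le> osc f {-1..<-1 + real n * \<epsilon>} {-1..<-1 + real n * \<epsilon>}"
    using n by (intro osc_mono) auto
  also have "\<dots> \<le> of_nat (chain_const n) * E"
    by (rule osc_chain[OF f \<epsilon> loc])
  finally show ?thesis unfolding E_def .
qed

section \<open>D'Alembert's formula\<close>

lemma lborel_set_shift:
  fixes G :: "real \<Rightarrow> real"
  shows "set_integrable lborel {a - c<..<b - c} (\<lambda>s. G (c + s)) \<longleftrightarrow> set_integrable lborel {a<..<b} G"
    and "(LINT s:{a - c<..<b - c}|lborel. G (c + s)) = (LINT s:{a<..<b}|lborel. G s)"
proof -
  have i: "indicator {a<..<b} (c + 1 * s) = (indicator {a - c<..<b - c} s :: real)" for s
    by (auto simp: indicator_def)
  show "set_integrable lborel {a - c<..<b - c} (\<lambda>s. G (c + s)) \<longleftrightarrow> set_integrable lborel {a<..<b} G"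
    using lborel_integrable_real_affine_iff[of 1 "\<lambda>s. indicator {a<..<b} s *\<^sub>R G s" c]
    unfolding set_integrable_def i by simp
  show "(LINT s:{a - c<..<b - c}|lborel. G (c + s)) = (LINT s:{a<..<b}|lborel. G s)"
    using lborel_integral_real_affine[of 1 "\<lambda>s. indicator {a<..<b} s *\<^sub>R G s" c]
    unfolding set_lebesgue_integral_def i by simp
qed

lemma lborel_set_reflect:
  fixes G :: "real \<Rightarrow> real"
  shows "set_integrable lborel {-b<..<-a} (\<lambda>s. G (-s)) \<longleftrightarrow> set_integrable lborel {a<..<b} G"
    and "(LINT s:{-b<..<-a}|lborel. G (-s)) = (LINT s:{a<..<b}|lborel. G s)"
proof -
  have i: "indicator {a<..<b} (0 + (-1) * s) = (indicator {-b<..<-a} s :: real)" for s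
    by (auto simp: indicator_def)
  show "set_integrable lborel {-b<..<-a} (\<lambda>s. G (-s)) \<longleftrightarrow> set_integrable lborel {a<..<b} G"
    using lborel_integrable_real_affine_iff[of "-1" "\<lambda>s. indicator {a<..<b} s *\<^sub>R G s" 0]
    unfolding set_integrable_def i by simp
  show "(LINT s:{-b<..<-a}|lborel. G (-s)) = (LINT s:{a<..<b}|lborel. G s)"
    using lborel_integral_real_affine[of "-1" "\<lambda>s. indicator {a<..<b} s *\<^sub>R G s" 0]
    unfolding set_lebesgue_integral_def i by simp
qed

lemma lborel_set_join:
  fixes G :: "real \<Rightarrow> real"
  assumes [measurable]: "G \<in> borel_measurable borel" and ord: "a \<le> b" "b \<le> c"
    and i: "set_integrable lborel {a<..<b} G" "set_integrable lborel {b<..<c} G"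
  shows "set_integrable lborel {a<..<c} G"
    and "(LINT s:{a<..<c}|lborel. G s) = (LINT s:{a<..<b}|lborel. G s) + (LINT s:{b<..<c}|lborel. G s)"
proof -
  have "AE s in lborel. s \<noteq> b" by (rule AE_lborel_singleton)
  then have ae: "AE s in lborel. indicator {a<..<c} s *\<^sub>R G s = indicator {a<..<b} s *\<^sub>R G s + indicator {b<..<c} s *\<^sub>R G s"
    by eventually_elim (use ord in \<open>auto simp: indicator_def\<close>)
  have s: "integrable lborel (\<lambda>s. indicator {a<..<b} s *\<^sub>R G s + indicator {b<..<c} s *\<^sub>R G s)"
    using i by (simp add: set_integrable_def)
  show "set_integrable lborel {a<..<c} G"
    unfolding set_integrable_def using s ae by (subst integrable_cong_AE[OF _ _ ae]) auto
  have "(LINT s:{a<..<c}|lborel. G s) = (LINT s|lborel. indicator {a<..<b} s *\<^sub>R G s + indicator {b<..<c} s *\<^sub>R G s)"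
    unfolding set_lebesgue_integral_def by (rule integral_cong_AE[OF _ _ ae]) measurable
  also have "\<dots> = (LINT s:{a<..<b}|lborel. G s) + (LINT s:{b<..<c}|lborel. G s)"
    unfolding set_lebesgue_integral_def using i by (intro Bochner_Integration.integral_add) (auto simp: set_integrable_def)
  finally show "(LINT s:{a<..<c}|lborel. G s) = (LINT s:{a<..<b}|lborel. G s) + (LINT s:{b<..<c}|lborel. G s)" .
qed

lemma lborel_set_symmetric:
  fixes G :: "real \<Rightarrow> real"
  assumes G[measurable]: "G \<in> borel_measurable borel" 
    and i: "set_integrable lborel Omega G" "set_integrable lborel Omega (\<lambda>s. G (-s))"
  shows "set_integrable lborel {-1<..<1} G"
    and "(LINT s:{-1<..<1}|lborel. G s) = (LINT s:Omega|lborel. G s + G (-s))"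
proof -
  have i': "set_integrable lborel {-1<..<0} G" using i(2) lborel_set_reflect(1)[of 0 "-1" G] by simp
  show "set_integrable lborel {-1<..<1} G"
    by (rule lborel_set_join(1)[OF G _ _ i' i(1)]) auto
  have "(LINT s:{-1<..<1}|lborel. G s) = (LINT s:{-1<..<0}|lborel. G s) + (LINT s:Omega|lborel. G s)"
    by (rule lborel_set_join(2)[OF G _ _ i' i(1)]) auto
  also have "(LINT s:{-1<..<0}|lborel. G s) = (LINT s:Omega|lborel. G (-s))"
    using lborel_set_reflect(2)[of 0 "-1" G] by simp
  finally show "(LINT s:{-1<..<1}|lborel. G s) = (LINT s:Omega|lborel. G s + G (-s))"
    using i by (simp add: set_integral_add(2))
qed

lemma periodic_set_integral:
  fixes P :: "real \<Rightarrow> real"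
  assumes P[measurable]: "P \<in> borel_measurable borel" and per: "\<And>s. P (s + 2) = P s"
    and i: "set_integrable lborel {-1<..<1} P"
  shows "set_integrable lborel {c - 1<..<c + 1} P"
    and "(LINT s:{c - 1<..<c + 1}|lborel. P s) = (LINT s:{-1<..<1}|lborel. P s)"
proof -
  \<comment> \<open>A shift by an even integer reduces to an interval from \<open>m\<close> to
    \<open>m + 2\<close> with \<open>m\<close> in \<open>[-1, 1]\<close>. It is cut at 1, and the
    part beyond 1 is moved back by one period.\<close>
  define k where "k = \<lfloor>c / 2\<rfloor>"
  define m where "m = c - 2 * of_int k - 1"
  have "of_int k \<le> c / 2" "c / 2 < of_int k + 1" unfolding k_def by linarith+
  then have m: "-1 \<le> m" "m \<le> 1" by (auto simp: m_def)
  have i1: "set_integrable lborel {-1<..<m} P" and i2: "set_integrable lborel {m<..<1} P"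
    using m by (auto intro: set_integrable_subset[OF i])
  have p2: "P (s - 2) = P s" for s using per[of "s - 2"] by simp
  have i1': "set_integrable lborel {1<..<m + 2} P" and e1: "(LINT s:{1<..<m + 2}|lborel. P s) = (LINT s:{-1<..<m}|lborel. P s)"
    using lborel_set_shift[of "-1" "-2" m P] i1 by (simp_all add: p2)
  have j: "set_integrable lborel {m<..<m + 2} P"
    by (rule lborel_set_join(1)[OF P _ _ i2 i1']) (use m in auto)
  have "(LINT s:{m<..<m + 2}|lborel. P s) = (LINT s:{m<..<1}|lborel. P s) + (LINT s:{-1<..<m}|lborel. P s)"
    unfolding e1[symmetric] by (rule lborel_set_join(2)[OF P _ _ i2 i1']) (use m in auto)
  also have "\<dots> = (LINT s:{-1<..<1}|lborel. P s)"
    using lborel_set_join(2)[OF P m i1 i2] by simp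
  finally have e: "(LINT s:{m<..<m + 2}|lborel. P s) = (LINT s:{-1<..<1}|lborel. P s)" .
  have pk: "P (2 * of_int k + s) = P s" for s
    using periodic_int[of P s k] per by (simp add: add.commute)
  have cm: "c - 1 - 2 * of_int k = m" "c + 1 - 2 * of_int k = m + 2" by (auto simp: m_def)
  show "set_integrable lborel {c - 1<..<c + 1} P"
    "(LINT s:{c - 1<..<c + 1}|lborel. P s) = (LINT s:{-1<..<1}|lborel. P s)"
    using lborel_set_shift[of "c - 1" "2 * of_int k" "c + 1" P, unfolded pk cm] j e by simp_all
qed

lemma lebesgue_on_Omega_lborel:
  fixes G :: "real \<Rightarrow> real"
  assumes [measurable]: "G \<in> borel_measurable borel"
  shows "integrable (lebesgue_on Omega) G \<longleftrightarrow> set_integrable lborel Omega G"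
    and "(LINT x|lebesgue_on Omega. G x) = (LINT x:Omega|lborel. G x)"
proof -
  have m: "(\<lambda>x. indicator Omega x *\<^sub>R G x) \<in> borel_measurable lborel" by measurable
  show "integrable (lebesgue_on Omega) G \<longleftrightarrow> set_integrable lborel Omega G"
    using integrable_completion[OF m] by (simp add: integrable_restrict_space set_integrable_def)
  show "(LINT x|lebesgue_on Omega. G x) = (LINT x:Omega|lborel. G x)"
    using integral_completion[OF m] by (simp add: integral_restrict_space set_lebesgue_integral_def)
qed

text \<open>The data are replaced by Borel representatives because the oscillation estimates and
  changes of variables concern Borel functions.\<close>

lemma L2_Omega_borel_version:
  assumes g: "g \<in> L2 Omega"
  obtains h where "h \<in> borel_measurable borel" "AE x in lebesgue_on Omega. g x = h x" "h \<in> L2 Omega"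
proof -
  have "(\<lambda>x. if x \<in> Omega then g x else 0) \<in> borel_measurable lebesgue"
    by (rule borel_measurable_if_I[OF L2_measurable[OF g]]) simp
  then obtain h where h: "h \<in> borel_measurable lborel"
    and ae: "AE x in lborel. (if x \<in> Omega then g x else 0) = h x"
    using completion_ex_borel_measurable_real by blast
  from ae have "AE x in lborel. x \<in> Omega \<longrightarrow> g x = h x" by eventually_elim auto
  from AE_completion[OF this] have ae': "AE x in lebesgue_on Omega. g x = h x"
    by (simp add: AE_restrict_space_iff)
  have hm: "h \<in> borel_measurable (lebesgue_on Omega)"
    by (intro measurable_restrict_space1 measurable_completion h)
  have "integrable (lebesgue_on Omega) (\<lambda>x. (h x)\<^sup>2)"
    using L2_square[OF g]
  proof (rule integrable_cong_AE_imp)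
    show "(\<lambda>x. (h x)\<^sup>2) \<in> borel_measurable (lebesgue_on Omega)" using hm by simp
    show "AE x in lebesgue_on Omega. (g x)\<^sup>2 = (h x)\<^sup>2" using ae' by eventually_elim simp
  qed
  then show thesis using that[OF _ ae'] h hm by (simp add: L2_def)
qed

text \<open>The derivative of the profile in d'Alembert's formula \<open>F (t + x) - F (t - x)\<close>, for data with
  \<open>\<phi>0' = h\<close> and \<open>\<phi>1 = k\<close>.\<close>

definition profile :: "(real \<Rightarrow> real) \<Rightarrow> (real \<Rightarrow> real) \<Rightarrow> real \<Rightarrow> real" where
  "profile h k s = (let r = s - 2 * of_int \<lfloor>(s + 1) / 2\<rfloor> in
     if r > 0 then (h r + k r) / 2 else (h (-r) - k (-r)) / 2)"

lemma profile_measurable: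
  assumes [measurable]: "h \<in> borel_measurable borel" "k \<in> borel_measurable borel"
  shows "profile h k \<in> borel_measurable borel"
  unfolding profile_def[abs_def] Let_def by measurable

lemma profile_periodic: "profile h k (s + 2) = profile h k s"
proof -
  have "\<lfloor>(s + 2 + 1) / 2\<rfloor> = \<lfloor>(s + 1) / 2\<rfloor> + 1"
    using floor_add_int[of "(s + 1) / 2" 1] by (simp add: add_divide_distrib algebra_simps)
  then show ?thesis by (simp add: profile_def)
qed

lemma profile_pos: "s \<in> Omega \<Longrightarrow> profile h k s = (h s + k s) / 2"
  and profile_neg: "s \<in> Omega \<Longrightarrow> profile h k (-s) = (h s - k s) / 2"
proof -
  assume s: "s \<in> Omega"
  have "\<lfloor>(s + 1) / 2\<rfloor> = 0" "\<lfloor>(-s + 1) / 2\<rfloor> = 0" using s by (auto simp: floor_eq_iff)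
  then show "profile h k s = (h s + k s) / 2" "profile h k (-s) = (h s - k s) / 2"
    using s by (simp_all add: profile_def)
qed

context
  fixes h k :: "real \<Rightarrow> real"
  assumes hb[measurable]: "h \<in> borel_measurable borel" and h2: "h \<in> L2 Omega"
    and kb[measurable]: "k \<in> borel_measurable borel" and k2: "k \<in> L2 Omega"
begin

lemma profile_integrable_pos: "set_integrable lborel Omega (profile h k)"
  and profile_integrable_neg: "set_integrable lborel Omega (\<lambda>s. profile h k (-s))"
proof -
  have hk: "set_integrable lborel Omega h" "set_integrable lborel Omega k"
    using L2_Omega_integrable h2 k2 lebesgue_on_Omega_lborel(1) hb kb by blast+
  then have "set_integrable lborel Omega (\<lambda>s. (h s + k s) / 2)" "set_integrable lborel Omega (\<lambda>s. (h s - k s) / 2)" by auto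
  moreover have "set_integrable lborel Omega (profile h k) \<longleftrightarrow> set_integrable lborel Omega (\<lambda>s. (h s + k s) / 2)"
    "set_integrable lborel Omega (\<lambda>s. profile h k (-s)) \<longleftrightarrow> set_integrable lborel Omega (\<lambda>s. (h s - k s) / 2)"
    by (intro set_integrable_cong refl; simp add: profile_pos profile_neg)+
  ultimately show "set_integrable lborel Omega (profile h k)" "set_integrable lborel Omega (\<lambda>s. profile h k (-s))"
    by blast+
qed

text \<open>Adding the values at \<open>s\<close> and \<open>-s\<close> cancels the velocity part,
  so only the derivative of the initial position contributes to the mean.\<close>

lemma profile_integral:
  shows "set_integrable lborel {-1<..<1} (profile h k)"
    and "(LINT s:{-1<..<1}|lborel. profile h k s) = (LINT x|lebesgue_on Omega. h x)"
proof -
  note [measurable] = profile_measurable[OF hb kb]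
  show "set_integrable lborel {-1<..<1} (profile h k)"
    by (intro lborel_set_symmetric profile_integrable_pos profile_integrable_neg) measurable
  have "(LINT s:{-1<..<1}|lborel. profile h k s) = (LINT s:Omega|lborel. profile h k s + profile h k (-s))"
    by (intro lborel_set_symmetric profile_integrable_pos profile_integrable_neg) measurable
  also have "\<dots> = (LINT s:Omega|lborel. h s)"
    by (rule set_lebesgue_integral_cong) (auto simp: profile_pos profile_neg add_divide_distrib[symmetric])
  finally show "(LINT s:{-1<..<1}|lborel. profile h k s) = (LINT x|lebesgue_on Omega. h x)"
    using lebesgue_on_Omega_lborel(2)[OF hb] by simp
qed

text \<open>The mixed terms \<open>h * k\<close> at \<open>s\<close> and \<open>-s\<close> have
  opposite signs and cancel. This is the energy identity that makes the profile represent the norm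
  of the data.\<close>

lemma profile_square_integral:
  shows "set_integrable lborel {-1<..<1} (\<lambda>s. (profile h k s)\<^sup>2)"
    and "2 * (LINT s:{-1<..<1}|lborel. (profile h k s)\<^sup>2) = (L2_norm Omega h)\<^sup>2 + (L2_norm Omega k)\<^sup>2"
proof -
  note [measurable] = profile_measurable[OF hb kb]
  have [measurable]: "(\<lambda>x. (h x)\<^sup>2) \<in> borel_measurable borel" "(\<lambda>x. (k x)\<^sup>2) \<in> borel_measurable borel"
    "(\<lambda>x. h x * k x) \<in> borel_measurable borel" by measurable
  have sq: "set_integrable lborel Omega (\<lambda>x. (h x)\<^sup>2)" "set_integrable lborel Omega (\<lambda>x. (k x)\<^sup>2)"
      "set_integrable lborel Omega (\<lambda>x. h x * k x)"
    using L2_square[OF h2] L2_square[OF k2] L2_mult_integrable[OF h2 k2]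
    by (simp_all add: lebesgue_on_Omega_lborel(1)[symmetric])
  have "set_integrable lborel Omega (\<lambda>s. ((h s)\<^sup>2 + (k s)\<^sup>2 + 2 * (h s * k s)) / 4)"
    "set_integrable lborel Omega (\<lambda>s. ((h s)\<^sup>2 + (k s)\<^sup>2 - 2 * (h s * k s)) / 4)"
    using sq by (intro set_integrable_divide set_integral_add set_integral_diff set_integrable_mult_right; simp)+
  moreover have "set_integrable lborel Omega (\<lambda>s. (profile h k s)\<^sup>2) \<longleftrightarrow>
      set_integrable lborel Omega (\<lambda>s. ((h s)\<^sup>2 + (k s)\<^sup>2 + 2 * (h s * k s)) / 4)"
    "set_integrable lborel Omega (\<lambda>s. (profile h k (-s))\<^sup>2) \<longleftrightarrow>
      set_integrable lborel Omega (\<lambda>s. ((h s)\<^sup>2 + (k s)\<^sup>2 - 2 * (h s * k s)) / 4)"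
    by (intro set_integrable_cong refl; simp add: profile_pos profile_neg power_divide power2_sum power2_diff mult.assoc)+
  ultimately have "set_integrable lborel Omega (\<lambda>s. (profile h k s)\<^sup>2)" "set_integrable lborel Omega (\<lambda>s. (profile h k (-s))\<^sup>2)"
    by blast+
  note S = lborel_set_symmetric[OF _ this]
  show "set_integrable lborel {-1<..<1} (\<lambda>s. (profile h k s)\<^sup>2)" by (rule S(1)) measurable
  have "2 * (LINT s:{-1<..<1}|lborel. (profile h k s)\<^sup>2) = 2 * (LINT s:Omega|lborel. (profile h k s)\<^sup>2 + (profile h k (-s))\<^sup>2)"
    by (subst S(2)) simp_all
  also have "\<dots> = (LINT s:Omega|lborel. 2 * ((profile h k s)\<^sup>2 + (profile h k (-s))\<^sup>2))"
    by (rule set_integral_mult_right[symmetric])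
  also have "\<dots> = (LINT s:Omega|lborel. (h s)\<^sup>2 + (k s)\<^sup>2)"
    by (rule set_lebesgue_integral_cong) (auto simp: profile_pos profile_neg power2_eq_square field_simps)
  also have "\<dots> = (L2_norm Omega h)\<^sup>2 + (L2_norm Omega k)\<^sup>2"
    using sq by (simp add: L2_norm_power2 lebesgue_on_Omega_lborel(2) set_integral_add(2))
  finally show "2 * (LINT s:{-1<..<1}|lborel. (profile h k s)\<^sup>2) = (L2_norm Omega h)\<^sup>2 + (L2_norm Omega k)\<^sup>2" .
qed

text \<open>Oddness of the sine unfolds the two travelling waves into one integral over a full
  period. After a shift by \<open>t\<close>, periodicity returns the interval to its place, and
  folding it back exhibits the data.\<close>

lemma profile_sine_coefficient:
  fixes n :: nat and t :: real
  defines "\<kappa> \<equiv> real n * pi"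
  shows "integrable (lebesgue_on Omega) (\<lambda>x. profile h k (t + x) - profile h k (t - x))"
    and "(LINT x|lebesgue_on Omega. (profile h k (t + x) - profile h k (t - x)) * sin (\<kappa> * x))
      = (LINT x|lebesgue_on Omega. k x * sin (\<kappa> * x)) * cos (\<kappa> * t)
        - (LINT x|lebesgue_on Omega. h x * cos (\<kappa> * x)) * sin (\<kappa> * t)"
proof -
  let ?f = "profile h k"
  note fm[measurable] = profile_measurable[OF hb kb]
  have bd: "set_integrable lborel A (\<lambda>s. F s * g s)" 
    if "set_integrable lborel A F" "F \<in> borel_measurable borel" "g \<in> borel_measurable borel" "\<And>s. \<bar>g s\<bar> \<le> 1" "A \<in> sets borel" 
    for F g :: "real \<Rightarrow> real" and A
    using integrable_mult_bounded[OF that(1)[unfolded set_integrable_def], of g 1] that(3,4)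
    by (simp add: set_integrable_def mult.assoc)
  have tf: "set_integrable lborel {-1<..<1} (\<lambda>x. ?f (t + x))"
    using periodic_set_integral(1)[OF fm profile_periodic profile_integral(1), of t]
      lborel_set_shift(1)[of "t - 1" t "t + 1" ?f] by simp
  have p: "set_integrable lborel Omega (\<lambda>x. ?f (t + x))" by (rule set_integrable_subset[OF tf]) auto
  have "set_integrable lborel {-1<..<0} (\<lambda>x. ?f (t + x))" by (rule set_integrable_subset[OF tf]) auto
  then have m: "set_integrable lborel Omega (\<lambda>x. ?f (t - x))"
    using lborel_set_reflect(1)[of 0 "-1" "\<lambda>x. ?f (t + x)"] by simp
  show "integrable (lebesgue_on Omega) (\<lambda>x. ?f (t + x) - ?f (t - x))"
    using p m by (subst lebesgue_on_Omega_lborel) (auto intro: set_integral_diff)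
  have "(LINT x|lebesgue_on Omega. (?f (t + x) - ?f (t - x)) * sin (\<kappa> * x))
      = (LINT x:Omega|lborel. ?f (t + x) * sin (\<kappa> * x) + ?f (t + - x) * sin (\<kappa> * - x))"
    by (subst lebesgue_on_Omega_lborel) (auto simp: algebra_simps)
  also have "\<dots> = (LINT x:{-1<..<1}|lborel. ?f (t + x) * sin (\<kappa> * x))"
  proof (rule lborel_set_symmetric(2)[symmetric])
    show "set_integrable lborel Omega (\<lambda>x. ?f (t + x) * sin (\<kappa> * x))" by (intro bd p) auto
    have "set_integrable lborel Omega (\<lambda>x. ?f (t - x) * sin (\<kappa> * - x))" by (intro bd m) auto
    then show "set_integrable lborel Omega (\<lambda>x. ?f (t + - x) * sin (\<kappa> * - x))" by simp
  qed simp
  also have "\<dots> = (LINT s:{t - 1<..<t + 1}|lborel. ?f s * sin (\<kappa> * (s - t)))"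
    using lborel_set_shift(2)[of "t - 1" t "t + 1" "\<lambda>s. ?f s * sin (\<kappa> * (s - t))"] by simp
  also have "\<dots> = (LINT s:{-1<..<1}|lborel. ?f s * sin (\<kappa> * (s - t)))"
  proof (rule periodic_set_integral(2))
    fix s
    have "\<kappa> * (s + 2 - t) = \<kappa> * (s - t) + 2 * real n * pi" by (simp add: \<kappa>_def algebra_simps)
    then have "sin (\<kappa> * (s + 2 - t)) = sin (\<kappa> * (s - t))"
      by (simp only: sin_add cos_2npi sin_2npi)
    then show "?f (s + 2) * sin (\<kappa> * (s + 2 - t)) = ?f s * sin (\<kappa> * (s - t))" by (simp add: profile_periodic)
  qed (auto intro!: bd profile_integral(1))
  also have "\<dots> = (LINT s:Omega|lborel. ?f s * sin (\<kappa> * (s - t)) + ?f (-s) * sin (\<kappa> * (- s - t)))"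
    by (intro lborel_set_symmetric(2) bd profile_integrable_pos profile_integrable_neg) auto
  also have "\<dots> = (LINT s:Omega|lborel. k s * sin (\<kappa> * s) * cos (\<kappa> * t) - h s * cos (\<kappa> * s) * sin (\<kappa> * t))"
  proof (rule set_lebesgue_integral_cong)
    have "?f s * sin (\<kappa> * (s - t)) + ?f (-s) * sin (\<kappa> * (- s - t)) = k s * sin (\<kappa> * s) * cos (\<kappa> * t) - h s * cos (\<kappa> * s) * sin (\<kappa> * t)"
      if s: "s \<in> Omega" for s
    proof -
      have e: "sin (\<kappa> * (s - t)) = sin (\<kappa> * s) * cos (\<kappa> * t) - cos (\<kappa> * s) * sin (\<kappa> * t)"
        "sin (\<kappa> * (- s - t)) = - sin (\<kappa> * s) * cos (\<kappa> * t) - cos (\<kappa> * s) * sin (\<kappa> * t)"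
        using sin_diff[of "\<kappa> * s" "\<kappa> * t"] sin_diff[of "- (\<kappa> * s)" "\<kappa> * t"] by (simp_all add: right_diff_distrib)
      show ?thesis unfolding e profile_pos[OF s] profile_neg[OF s] by (simp add: field_simps)
    qed
    then show "\<forall>s. s \<in> Omega \<longrightarrow> ?f s * sin (\<kappa> * (s - t)) + ?f (-s) * sin (\<kappa> * (- s - t)) = k s * sin (\<kappa> * s) * cos (\<kappa> * t) - h s * cos (\<kappa> * s) * sin (\<kappa> * t)"
      by blast
  qed simp
  also have "\<dots> = (LINT x|lebesgue_on Omega. k x * sin (\<kappa> * x) * cos (\<kappa> * t) - h x * cos (\<kappa> * x) * sin (\<kappa> * t))"
    by (rule lebesgue_on_Omega_lborel(2)[symmetric]) measurable
  also have "\<dots> = (LINT x|lebesgue_on Omega. k x * sin (\<kappa> * x)) * cos (\<kappa> * t)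
        - (LINT x|lebesgue_on Omega. h x * cos (\<kappa> * x)) * sin (\<kappa> * t)"
  proof -
    have "integrable (lebesgue_on Omega) (\<lambda>x. k x * sin (\<kappa> * x))" "integrable (lebesgue_on Omega) (\<lambda>x. h x * cos (\<kappa> * x))"
      by (intro L2_mult_integrable h2 k2 continuous_L2_Omega continuous_intros)+
    then show ?thesis by simp
  qed
  finally show "(LINT x|lebesgue_on Omega. (?f (t + x) - ?f (t - x)) * sin (\<kappa> * x))
      = (LINT x|lebesgue_on Omega. k x * sin (\<kappa> * x)) * cos (\<kappa> * t)
        - (LINT x|lebesgue_on Omega. h x * cos (\<kappa> * x)) * sin (\<kappa> * t)" .
qed

end

text \<open>At each fixed time both sides have the same sine coefficients. The exceptional null set
  may depend on \<open>t\<close>.\<close>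

lemma wave_velocity_formula:
  assumes sol: "wave_solution T (\<phi>0, \<phi>1) \<phi> \<phi>t" and \<phi>0: "\<phi>0 \<in> H10" and \<phi>1: "\<phi>1 \<in> L2 Omega"
    and hb: "h \<in> borel_measurable borel" and h2: "h \<in> L2 Omega"
    and kb: "k \<in> borel_measurable borel" and k2: "k \<in> L2 Omega"
    and h: "AE x in lebesgue_on Omega. weak_deriv \<phi>0 x = h x" and k: "AE x in lebesgue_on Omega. \<phi>1 x = k x"
    and t: "0 < t" "t < T"
  shows "AE x in lebesgue_on Omega. \<phi>t (x, t) = profile h k (t + x) - profile h k (t - x)"
proof -
  have "continuous_curve (L2 Omega) (L2_norm Omega) T \<phi>t" using sol by (auto simp: wave_solution_def)
  then have \<phi>t: "(\<lambda>x. \<phi>t (x, t)) \<in> L2 Omega" using t by (auto simp: continuous_curve_def)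
  let ?d = "\<lambda>x. profile h k (t + x) - profile h k (t - x)"
  note d = profile_sine_coefficient[OF hb h2 kb k2]
  have "AE x in lebesgue_on Omega. \<phi>t (x, t) - ?d x = 0"
  proof (rule sine_uniqueness)
    show "integrable (lebesgue_on Omega) (\<lambda>x. \<phi>t (x, t) - ?d x)"
      by (intro Bochner_Integration.integrable_diff L2_Omega_integrable \<phi>t d)
    fix n
    have s: "(\<lambda>x. sin (real n * pi * x)) \<in> L2 Omega" "(\<lambda>x. cos (real n * pi * x)) \<in> L2 Omega"
      by (intro continuous_L2_Omega continuous_intros)+
    have w: "weak_deriv \<phi>0 \<in> L2 Omega" by (intro weak_deriv(1) H10_H1 \<phi>0)
    have "(LINT x|lebesgue_on Omega. (\<phi>t (x, t) - ?d x) * sin (real n * pi * x))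
      = (LINT x|lebesgue_on Omega. \<phi>t (x, t) * sin (real n * pi * x)) - (LINT x|lebesgue_on Omega. ?d x * sin (real n * pi * x))"
    proof -
      have "integrable (lebesgue_on Omega) (\<lambda>x. \<phi>t (x, t) * sin (real n * pi * x))"
        by (intro L2_mult_integrable \<phi>t s)
      moreover have "integrable (lebesgue_on Omega) (\<lambda>x. ?d x * sin (real n * pi * x))"
        by (rule integrable_mult_bounded[OF d(1), where C=1]) (auto intro!: L2_measurable s)
      ultimately show ?thesis by (simp add: left_diff_distrib)
    qed
    moreover have "(LINT x|lebesgue_on Omega. weak_deriv \<phi>0 x * cos (real n * pi * x)) = (LINT x|lebesgue_on Omega. h x * cos (real n * pi * x))"
    proof (rule integral_cong_AE)
      show "AE x in lebesgue_on Omega. weak_deriv \<phi>0 x * cos (real n * pi * x) = h x * cos (real n * pi * x)"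
        using h by eventually_elim simp
    qed (intro borel_measurable_times L2_measurable s w h2)+
    moreover have "(LINT x|lebesgue_on Omega. \<phi>1 x * sin (real n * pi * x)) = (LINT x|lebesgue_on Omega. k x * sin (real n * pi * x))"
    proof (rule integral_cong_AE)
      show "AE x in lebesgue_on Omega. \<phi>1 x * sin (real n * pi * x) = k x * sin (real n * pi * x)"
        using k by eventually_elim simp
    qed (intro borel_measurable_times L2_measurable s \<phi>1 k2)+
    ultimately show "(LINT x|lebesgue_on Omega. (\<phi>t (x, t) - ?d x) * sin (real n * pi * x)) = 0"
      by (simp add: d(2) wave_velocity_coefficient[OF sol \<phi>0 \<phi>1 t])
  qed
  then show ?thesis by simp
qed

section \<open>The observability inequality\<close>

lemma lebesgue_on_Omega_AE: "(AE x in lebesgue_on Omega. P x) \<longleftrightarrow> (AE x in lborel. x \<in> Omega \<longrightarrow> P x)"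
  by (simp add: AE_restrict_space_iff AE_completion_iff)

text \<open>The integral of a nonintegrable function is 0 by convention, so without this fact
  \<open>L2_norm q u\<close> would not be known to measure anything. The uniform bound on slices and
  Tonelli provide it.\<close>

lemma L2_curve_square_integrable:
  assumes u: "u \<in> borel_measurable (lebesgue_on (QT T))"
    and c: "continuous_curve (L2 Omega) (L2_norm Omega) T u"
  shows "integrable (lebesgue_on (QT T)) (\<lambda>p. (u p)\<^sup>2)"
proof -
  obtain v where v: "v \<in> borel_measurable borel" "\<And>p. p \<notin> QT T \<Longrightarrow> v p = 0"
    "AE p in lebesgue_on (QT T). u p = v p"
    "AE t in lborel. t \<in> {0<..<T} \<longrightarrow> (AE x in lebesgue_on Omega. u (x, t) = v (x, t))"
    by (rule QT_borel_version[OF u], rule that)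
  obtain B where B: "\<And>t. t \<in> {0..T} \<Longrightarrow> L2_norm Omega (\<lambda>x. u (x, t)) \<le> B" and B0: "B \<ge> 0"
    using L2_curve(1)[OF c] by blast
  have [measurable]: "v \<in> borel_measurable (borel \<Otimes>\<^sub>M borel)" using v(1) by (simp add: borel_prod)
  have slice: "(\<integral>\<^sup>+x. ennreal ((v (x, t))\<^sup>2) \<partial>lborel) \<le> ennreal (B\<^sup>2)"
    if t: "t \<in> {0<..<T}" and e: "AE x in lebesgue_on Omega. u (x, t) = v (x, t)" for t
  proof -
    have L: "(\<lambda>x. u (x, t)) \<in> L2 Omega" using c t by (auto simp: continuous_curve_def)
    have "(\<integral>\<^sup>+x. ennreal ((v (x, t))\<^sup>2) \<partial>lborel) = (\<integral>\<^sup>+x. ennreal ((v (x, t))\<^sup>2) \<partial>lebesgue_on Omega)"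
      by (rule nn_integral_lebesgue_on[symmetric]) (auto simp: v(2) QT_def)
    also have "\<dots> = (\<integral>\<^sup>+x. ennreal ((u (x, t))\<^sup>2) \<partial>lebesgue_on Omega)"
      by (rule nn_integral_cong_AE) (use e in \<open>eventually_elim, simp\<close>)
    also have "\<dots> = ennreal ((L2_norm Omega (\<lambda>x. u (x, t)))\<^sup>2)"
      unfolding L2_norm_power2 by (rule nn_integral_eq_integral[OF L2_square[OF L]]) simp
    also have "\<dots> \<le> ennreal (B\<^sup>2)"
      using B[of t] t by (intro ennreal_leI power_mono L2_norm_nonneg) auto
    finally show ?thesis .
  qed
  have "integrable (lborel \<Otimes>\<^sub>M lborel) (\<lambda>p. (v p)\<^sup>2)"
  proof (rule integrableI_bounded)
    have "(\<integral>\<^sup>+p. ennreal (norm ((v p)\<^sup>2)) \<partial>(lborel \<Otimes>\<^sub>M lborel)) = (\<integral>\<^sup>+t. \<integral>\<^sup>+x. ennreal ((v (x, t))\<^sup>2) \<partial>lborel \<partial>lborel)"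
      using lborel_pair.nn_integral_snd[of "\<lambda>p. ennreal ((v p)\<^sup>2)"] by simp
    also have "\<dots> \<le> (\<integral>\<^sup>+t. ennreal (B\<^sup>2) * indicator {0<..<T} t \<partial>lborel)"
    proof (rule nn_integral_mono_AE)
      show "AE t in lborel. (\<integral>\<^sup>+x. ennreal ((v (x, t))\<^sup>2) \<partial>lborel) \<le> ennreal (B\<^sup>2) * indicator {0<..<T} t"
        using v(4)
      proof eventually_elim
        case (elim t)
        show ?case
        proof (cases "t \<in> {0<..<T}")
          case False
          then have "v (x, t) = 0" for x by (intro v(2)) (auto simp: QT_def)
          then show ?thesis by simp
        qed (use slice elim in auto)
      qed
    qed
    also have "\<dots> < \<infinity>"
      using emeasure_bounded_finite[of "{0<..<T}"] by (simp add: nn_integral_cmult_indicator ennreal_mult_less_top)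
    finally show "(\<integral>\<^sup>+p. ennreal (norm ((v p)\<^sup>2)) \<partial>(lborel \<Otimes>\<^sub>M lborel)) < \<infinity>" .
  qed measurable
  then have "integrable lborel (\<lambda>p. (v p)\<^sup>2)" by (simp add: lborel_prod)
  then have "integrable lebesgue (\<lambda>p. (v p)\<^sup>2)" using v(1) by (subst integrable_completion) auto
  from integrable_mult_indicator[OF QT_sets_lebesgue this]
  have "integrable (lebesgue_on (QT T)) (\<lambda>p. (v p)\<^sup>2)"
    using QT_sets_lebesgue by (simp add: integrable_restrict_space)
  then show ?thesis
  proof (rule integrable_cong_AE_imp)
    show "(\<lambda>p. (u p)\<^sup>2) \<in> borel_measurable (lebesgue_on (QT T))" using u by simp
    show "AE p in lebesgue_on (QT T). (v p)\<^sup>2 = (u p)\<^sup>2" using v(3) by eventually_elim simp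
  qed
qed

text \<open>Integrating in \<open>x\<close> first needs the formula only for almost every
  \<open>x\<close> at each time, which removes the dependence of the null sets on \<open>t\<close>.
  The Borel version of \<open>u\<close> mediates between slices and the joint integral.\<close>

lemma L2_norm_observation:
  assumes u: "u \<in> borel_measurable (lebesgue_on (QT T))"
    and c: "continuous_curve (L2 Omega) (L2_norm Omega) T u"
    and q: "q \<subseteq> QT T" "open q" and f: "f \<in> borel_measurable borel"
    and eq: "\<And>t. 0 < t \<Longrightarrow> t < T \<Longrightarrow> AE x in lebesgue_on Omega. u (x, t) = f (t + x) - f (t - x)"
  shows "(\<integral>\<^sup>+p. ennreal ((f (snd p + fst p) - f (snd p - fst p))\<^sup>2) * indicator q p \<partial>lborel) = ennreal ((L2_norm q u)\<^sup>2)"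
proof -
  obtain v where v: "v \<in> borel_measurable borel" "\<And>p. p \<notin> QT T \<Longrightarrow> v p = 0"
    "AE p in lebesgue_on (QT T). u p = v p"
    "AE t in lborel. t \<in> {0<..<T} \<longrightarrow> (AE x in lebesgue_on Omega. u (x, t) = v (x, t))"
    by (rule QT_borel_version[OF u], rule that)
  have [measurable]: "v \<in> borel_measurable (borel \<Otimes>\<^sub>M borel)" using v(1) by (simp add: borel_prod)
  note f[measurable]
  have qb: "q \<in> sets borel" using q by simp
  then have [measurable]: "q \<in> sets (borel \<Otimes>\<^sub>M borel)" unfolding borel_prod .
  have qs: "q \<in> sets lebesgue" using qb by (simp add: sets_completionI_sets)
  have m: "(\<lambda>p. ennreal ((f (snd p + fst p) - f (snd p - fst p))\<^sup>2) * indicator q p) \<in> borel_measurable (lborel \<Otimes>\<^sub>M lborel)"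
    "(\<lambda>p. ennreal ((v p)\<^sup>2) * indicator q p) \<in> borel_measurable (lborel \<Otimes>\<^sub>M lborel)"
    by measurable
  have "(\<integral>\<^sup>+p. ennreal ((f (snd p + fst p) - f (snd p - fst p))\<^sup>2) * indicator q p \<partial>lborel)
     = (\<integral>\<^sup>+t. \<integral>\<^sup>+x. ennreal ((f (t + x) - f (t - x))\<^sup>2) * indicator q (x, t) \<partial>lborel \<partial>lborel)"
    using lborel_pair.nn_integral_snd[OF m(1)] by (simp add: lborel_prod)
  also have "\<dots> = (\<integral>\<^sup>+t. \<integral>\<^sup>+x. ennreal ((v (x, t))\<^sup>2) * indicator q (x, t) \<partial>lborel \<partial>lborel)"
  proof (rule nn_integral_cong_AE)
    show "AE t in lborel. (\<integral>\<^sup>+x. ennreal ((f (t + x) - f (t - x))\<^sup>2) * indicator q (x, t) \<partial>lborel)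
       = (\<integral>\<^sup>+x. ennreal ((v (x, t))\<^sup>2) * indicator q (x, t) \<partial>lborel)"
      using v(4)
    proof eventually_elim
      case (elim t)
      show ?case
      proof (cases "t \<in> {0<..<T}")
        case False
        then have "(x, t) \<notin> q" for x using q by (auto simp: QT_def)
        then show ?thesis by simp
      next
        case True
        have "AE x in lborel. x \<in> Omega \<longrightarrow> u (x, t) = v (x, t)" "AE x in lborel. x \<in> Omega \<longrightarrow> u (x, t) = f (t + x) - f (t - x)"
          using elim eq[of t] True by (auto simp: lebesgue_on_Omega_AE)
        then have "AE x in lborel. ennreal ((f (t + x) - f (t - x))\<^sup>2) * indicator q (x, t) = ennreal ((v (x, t))\<^sup>2) * indicator q (x, t)"
        proof eventually_elim
          case (elim x)
          then show ?case using q(1) by (cases "x \<in> Omega") (auto simp: QT_def indicator_def)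
        qed
        then show ?thesis by (rule nn_integral_cong_AE)
      qed
    qed
  qed
  also have "\<dots> = (\<integral>\<^sup>+p. ennreal ((v p)\<^sup>2) * indicator q p \<partial>lborel)"
    using lborel_pair.nn_integral_snd[OF m(2)] by (simp add: lborel_prod)
  also have "\<dots> = (\<integral>\<^sup>+p. ennreal ((v p)\<^sup>2) * indicator q p \<partial>lebesgue_on q)"
    by (rule nn_integral_lebesgue_on[OF _ qs, symmetric]) simp
  also have "\<dots> = (\<integral>\<^sup>+p. ennreal ((u p)\<^sup>2) \<partial>lebesgue_on q)"
  proof (rule nn_integral_cong_AE)
    have "AE p in lebesgue. p \<in> QT T \<longrightarrow> u p = v p" using v(3) QT_sets_lebesgue by (simp add: AE_restrict_space_iff)
    then have "AE p in lebesgue. p \<in> q \<longrightarrow> u p = v p" by eventually_elim (use q in auto)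
    then show "AE p in lebesgue_on q. ennreal ((v p)\<^sup>2) * indicator q p = ennreal ((u p)\<^sup>2)"
      using qs by (simp add: AE_restrict_space_iff) (elim eventually_mono, auto)
  qed
  also have "\<dots> = ennreal ((L2_norm q u)\<^sup>2)"
  proof -
    have "set_integrable lebesgue (QT T) (\<lambda>p. (u p)\<^sup>2)"
      using L2_curve_square_integrable[OF u c] QT_sets_lebesgue by (simp add: integrable_restrict_space set_integrable_def)
    then have "set_integrable lebesgue q (\<lambda>p. (u p)\<^sup>2)" by (rule set_integrable_subset[OF _ qs q(1)])
    then have "integrable (lebesgue_on q) (\<lambda>p. (u p)\<^sup>2)"
      using qs by (simp add: integrable_restrict_space set_integrable_def)
    then show ?thesis unfolding L2_norm_power2 by (rule nn_integral_eq_integral) simp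
  qed
  finally show ?thesis .
qed

theorem theorem1:
  fixes T \<epsilon> :: real
  assumes "T > 0" and "\<epsilon> > 0" and "Q_ad T \<epsilon> \<noteq> {}"
  shows "\<exists>C_obs>0. \<forall>q\<in>Q_ad T \<epsilon>. \<forall>(\<phi>0, \<phi>1)\<in>V_space. \<forall>\<phi> \<phi>t.
           wave_solution T (\<phi>0, \<phi>1) \<phi> \<phi>t \<longrightarrow>
             (V_norm (\<phi>0, \<phi>1))\<^sup>2 \<le> C_obs * (L2_norm q \<phi>t)\<^sup>2"
proof -
  \<comment> \<open>A chain of \<open>n\<close> steps of length \<open>\<epsilon>\<close> has to
    cover a period of length 2. The choice of \<open>n\<close> precedes \<open>q\<close> and the
    data, which makes the constant uniform.\<close>
  obtain n where n: "2 / \<epsilon> < real n" using reals_Archimedean2 by blast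
  then have n2: "2 \<le> real n * \<epsilon>" using assms(2) by (simp add: field_simps)
  have "(V_norm (\<phi>0, \<phi>1))\<^sup>2 \<le> (real (chain_const n) + 1) * (L2_norm q \<phi>t)\<^sup>2"
    if q: "q \<in> Q_ad T \<epsilon>" and \<phi>0: "\<phi>0 \<in> H10" and \<phi>1: "\<phi>1 \<in> L2 Omega" and sol: "wave_solution T (\<phi>0, \<phi>1) \<phi> \<phi>t"
    for q \<phi>0 \<phi>1 \<phi> \<phi>t
  proof -
    have w: "weak_deriv \<phi>0 \<in> L2 Omega" by (intro weak_deriv(1) H10_H1 \<phi>0)
    obtain h where hb: "h \<in> borel_measurable borel" and h: "AE x in lebesgue_on Omega. weak_deriv \<phi>0 x = h x" and h2: "h \<in> L2 Omega"
      by (rule L2_Omega_borel_version[OF w])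
    obtain k where kb: "k \<in> borel_measurable borel" and k: "AE x in lebesgue_on Omega. \<phi>1 x = k x" and k2: "k \<in> L2 Omega"
      by (rule L2_Omega_borel_version[OF \<phi>1])
    define f where "f = profile h k"
    have fb: "f \<in> borel_measurable borel" unfolding f_def by (rule profile_measurable[OF hb kb])
    note i1 = profile_integral(1)[OF hb h2 kb k2, folded f_def] 
    note sq = profile_square_integral[OF hb h2 kb k2, folded f_def]
    \<comment> \<open>The mean is read as the cosine coefficient of frequency 0, which vanishes by
      integration by parts.\<close>
    have "(LINT x|lebesgue_on Omega. h x) = (LINT x|lebesgue_on Omega. weak_deriv \<phi>0 x * cos (0 * x))"
      by (rule integral_cong_AE) (use h in \<open>auto intro!: L2_measurable h2 w elim: eventually_mono\<close>)
    also have "\<dots> = 0" using H10_sine_coefficient[OF \<phi>0, of 0] by simp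
    finally have mean: "(LINT s:{-1<..<1}|lborel. f s) = 0"
      using profile_integral(2)[OF hb h2 kb k2] by (simp add: f_def)
    have m: "\<phi>t \<in> borel_measurable (lebesgue_on (QT T))" "continuous_curve (L2 Omega) (L2_norm Omega) T \<phi>t"
      using sol by (auto simp: wave_solution_def)
    have qq: "q \<subseteq> QT T" "open q" using q by (auto simp: Q_ad_def)
    have per: "f (s + 2) = f s" for s unfolding f_def by (rule profile_periodic)
    have "(V_norm (\<phi>0, \<phi>1))\<^sup>2 = (L2_norm Omega h)\<^sup>2 + (L2_norm Omega k)\<^sup>2"
      using L2_norm_cong_AE[OF h L2_measurable[OF w] L2_measurable[OF h2]]
        L2_norm_cong_AE[OF k L2_measurable[OF \<phi>1] L2_measurable[OF k2]]
      by (simp add: V_norm_def)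
    then have "ennreal ((V_norm (\<phi>0, \<phi>1))\<^sup>2) = ennreal (2 * (LINT s:{-1<..<1}|lborel. (f s)\<^sup>2))" using sq(2) by simp
    also have "\<dots> = 2 * ennreal (LINT s:{-1<..<1}|lborel. (f s)\<^sup>2)"
      by (simp add: ennreal_mult' )
    also have "ennreal (LINT s:{-1<..<1}|lborel. (f s)\<^sup>2) = (\<integral>\<^sup>+s. ennreal ((f s)\<^sup>2) * indicator {-1<..<1} s \<partial>lborel)"
    proof -
      have "ennreal (LINT s:{-1<..<1}|lborel. (f s)\<^sup>2) = (\<integral>\<^sup>+s. ennreal (indicator {-1<..<1} s *\<^sub>R (f s)\<^sup>2) \<partial>lborel)"
        unfolding set_lebesgue_integral_def
        by (rule nn_integral_eq_integral[symmetric, OF sq(1)[unfolded set_integrable_def]]) simp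
      also have "\<dots> = (\<integral>\<^sup>+s. ennreal ((f s)\<^sup>2) * indicator {-1<..<1} s \<partial>lborel)"
        by (intro nn_integral_cong) (auto simp: indicator_def)
      finally show ?thesis .
    qed
    also have "2 * \<dots> \<le> of_nat (chain_const n) * 
       (\<integral>\<^sup>+p. ennreal ((f (snd p + fst p) - f (snd p - fst p))\<^sup>2) * indicator q p \<partial>lborel)"
      by (rule observability_characteristic[OF fb per i1 sq(1) mean assms(2) q n2])
    also have "\<dots> = of_nat (chain_const n) * ennreal ((L2_norm q \<phi>t)\<^sup>2)"
      using L2_norm_observation[OF m qq fb] wave_velocity_formula[OF sol \<phi>0 \<phi>1 hb h2 kb k2 h k]
      by (simp add: f_def)
    also have "\<dots> = ennreal (real (chain_const n) * (L2_norm q \<phi>t)\<^sup>2)"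
      by (simp add: ennreal_mult ennreal_of_nat_eq_real_of_nat)
    finally have "(V_norm (\<phi>0, \<phi>1))\<^sup>2 \<le> real (chain_const n) * (L2_norm q \<phi>t)\<^sup>2"
      by (simp add: ennreal_le_iff)
    \<comment> \<open>The added 1 makes positivity of the final constant immediate.\<close>
    then show ?thesis by (simp add: distrib_right add_increasing2)
  qed
  then show ?thesis
    by (intro exI[of _ "real (chain_const n) + 1"]) (auto simp: V_space_def)
qed

end
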